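(* Let $\theta\in(0,1]$ and let $\mathbb{T}\colon\mathcal{H}\to\mathcal{H}$ be $\theta$-averaged with respect to $\|\cdot\|_M$, with infimal displacement vector $\mathbf{v}$, where $\mathcal{H}=\mathcal{H}_0\oplus\mathcal{H}_1\oplus\cdots\oplus\mathcal{H}_m$. Assume that the block components of $U_2$ are orthogonal to each other with respect to $\langle\cdot,\cdot\rangle_M$. Let $\mathcal{I}^0,\mathcal{I}^1,\ldots$ be IID random vectors in $[0,1]^m$ whose common distribution (that of $\mathcal{I}$) satisfies $\mathbb{E}[\mathcal{I}]=\alpha\mathbf{1}$ with some $\alpha\in(0,1]$, where $\alpha\theta<1$. Let $x^0\in\mathcal{H}$ and $x^{k+1}=\mathbb{T}_{\mathcal{I}^k}x^k$ for $k=0,1,2,\dots$, where $$\mathbb{T}_{\mathcal{I}}=\mathrm{Id}-\theta\Big(\alpha\,\mathbb{G}+\sum_{i=1}^m\mathcal{I}_i\mathbb{H}_i\Big).$$ Let $c_F$ be the cosine of the Friedrichs angle between $U_1$ and $U_2$. (a) If $c_F\le\sqrt{\frac{1-\theta}{1-\alpha\theta}}$, then $x^k/k\to-\alpha\mathbf{v}$ in $L^2$ as $k\to\infty$. (b) If $c_F<\sqrt{\frac{1-\theta}{1-\alpha\theta}}$, then, with probability $1$, $x^k/k$ converges strongly to $-\alpha\mathbf{v}$ as $k\to\infty$. Furthermore, there exists $\beta>0$ with $\beta<\alpha/\theta$ and $$\mathbb{E}_{\mathcal{I}}\left[\|u_{\mathcal{I}}\|_M^2\right]\le\beta\|u\|_M^2\qquad\text{for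 all }u\in\mathcal{H},$$ and for every such $\beta$ the following bias and variance results hold: if $\mathbf{v}\in\mathrm{range}(\mathrm{Id}-\mathbb{T})$, then $$\limsup_{k\to\infty}\;k\,\mathbb{E}\left[\left\|\frac{x^k}{k}+\alpha\mathbf{v}\right\|_M^2\right]\le(\beta-\alpha^2)\|\mathbf{v}\|_M^2,$$ and, regardless of whether $\mathbf{v}\in\mathrm{range}(\mathrm{Id}-\mathbb{T})$ or not, $$\limsup_{k\to\infty}\;k\,\mathrm{Var}_M\left(\frac{x^k}{k}\right)\le(\beta-\alpha^2)\|\mathbf{v}\|_M^2 .$$
   Context: $\mathcal{H}=\mathcal{H}_0\oplus\mathcal{H}_1\oplus\cdots\oplus\mathcal{H}_m$ is a direct sum of real Hilbert spaces with the sum inner product $\langle\cdot,\cdot\rangle$. $M\colon\mathcal{H}\to\mathcal{H}$ is a bounded, linear, self-adjoint, positive definite operator; $\langle x,y\rangle_M=\langle x,My\rangle$ and $\|x\|_M=\sqrt{\langle x,Mx\rangle}$, and $\mathcal{H}$ with $\langle\cdot,\cdot\rangle_M$ is again a Hilbert space. $\mathrm{Id}$ is the identity operator. For an $\mathcal{H}$-valued random variable $X$, $\mathrm{Var}_M[X]=\mathbb{E}[\|X\|_M^2]-\|\mathbb{E}[X]\|_M^2$. $L^2$ convergence $X_k\to X$ means $\mathbb{E}[\|X_k-X\|_M^2]\to0$. $U_1=\{(x_0,0,\dots,0):x_0\in\mathcal{H}_0\}$ and $U_2=\{(0,x_1,\dots,x_m):x_i\in\mathcal{H}_i,\ 1\le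 i\le m\}$. The block components of $U_2$ being orthogonal to each other means that $\langle(0,\dots,x_i,\dots,0),(0,\dots,x_j,\dots,0)\rangle_M=0$ for all $x_i\in\mathcal{H}_i$, $x_j\in\mathcal{H}_j$, $1\le i<j\le m$. The cosine $c_F$ of the Friedrichs angle between $U_1$ and $U_2$ is the smallest $c\in[0,1]$ such that $|\langle u_1,u_2\rangle_M|\le c\|u_1\|_M\|u_2\|_M$ for all $u_1\in U_1$, $u_2\in U_2$. An operator $\mathbb{T}$ is $\theta$-averaged with respect to a norm, $\theta\in(0,1]$, if $\mathbb{T}=(1-\theta)\mathrm{Id}+\theta\mathbb{C}$ for some operator $\mathbb{C}$ that is non-expansive (1-Lipschitz) in that norm; for $\theta=1$ this just means $\mathbb{T}$ is non-expansive. Put $\mathbb{S}=\theta^{-1}(\mathrm{Id}-\mathbb{T})$. The operators $\mathbb{G},\mathbb{H}$ are defined by $\mathbb{S}x=\mathbb{G}x+\mathbb{H}x$ with $\mathbb{G}x\in U_1$, $\mathbb{H}x\in U_2$ for all $x\in\mathcal{H}$; $\mathbb{H}_ix=(0,\dots,0,(\mathbb{H}x)_i,0,\dots,0)$ keeps only the $\mathcal{H}_i$-block, $i=1,\dots,m$. For $u\in\mathcal{H}$ written as $u=g+h$ with $g\in U_1$, $h\in U_2$ having blocks $h_i\in\mathcal{H}_i$, and for $\mathcal{I}\in[0,1]^m$, put $u_{\mathcal{I}}=\alpha g+\sum_{i=1}^m\mathcal{I}_i(0,\dots,0,h_i,0,\dots,0)$. $\mathbf{1}\in\mathbb{R}^m$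 is the all-ones vector. The infimal displacement vector $\mathbf{v}$ of $\mathbb{T}$ is the unique minimum-$M$-norm element of the nonempty closed convex set $\overline{\mathrm{range}(\mathrm{Id}-\mathbb{T})}$. The starting point $x^0$ is deterministic. *)

theory Defs
  imports "HOL-Probability.Probability"
begin

text \<open>
  Since the blocks of a direct sum of Hilbert spaces may have different types, the sum
  \<open>H\<^sub>0 \<oplus> H\<^sub>1 \<oplus> \<dots> \<oplus> H\<^sub>m\<close> is rendered internally: the ambient type \<open>'a\<close> is the whole space
  with the sum inner product, and block \<open>H\<^sub>i\<close>, identified with \<open>{(0, \<dots>, x\<^sub>i, \<dots>, 0)}\<close>, is a
  closed subspace of it.  The blocks are indexed by \<open>'m option\<close>: \<open>E None\<close> is \<open>H\<^sub>0\<close>, and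
  \<open>E (Some i)\<close>, with \<open>i\<close> in the finite type \<open>'m\<close>, are \<open>H\<^sub>1, \<dots>, H\<^sub>m\<close> where \<open>m = CARD('m)\<close>.
  Thus \<open>component E j x\<close> is \<open>(0, \<dots>, x\<^sub>j, \<dots>, 0)\<close>.
\<close>

definition hilbert_direct_sum :: "('j::finite \<Rightarrow> 'a::{real_inner, banach} set) \<Rightarrow> bool" where
  "hilbert_direct_sum E \<longleftrightarrow>
     (\<forall>j. subspace (E j) \<and> closed (E j)) \<and>
     (\<forall>i j. i \<noteq> j \<longrightarrow> (\<forall>x\<in>E i. \<forall>y\<in>E j. x \<bullet> y = 0)) \<and>
     (\<forall>x. \<exists>f. (\<forall>j. f j \<in> E j) \<and> x = (\<Sum>j\<in>UNIV. f j))"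

definition component :: "('j::finite \<Rightarrow> 'a::{real_inner, banach} set) \<Rightarrow> 'j \<Rightarrow> 'a \<Rightarrow> 'a" where
  "component E j x = (THE f. (\<forall>j. f j \<in> E j) \<and> x = (\<Sum>j\<in>UNIV. f j)) j"

lemma component_eq:
  assumes E: "hilbert_direct_sum E" and f: "\<And>j. f j \<in> E j"
  shows "component E j (\<Sum>j\<in>UNIV. f j) = f j"
proof -
  have uniq: "g = f" if g: "\<forall>j. g j \<in> E j" and eq: "(\<Sum>j\<in>UNIV. f j) = (\<Sum>j\<in>UNIV. g j)" for g
  proof
    fix i
    have d: "f k - g k \<in> E k" for k
      using E f g by (auto simp: hilbert_direct_sum_def intro: subspace_diff)
    have "0 = (f i - g i) \<bullet> (\<Sum>k\<in>UNIV. f k - g k)"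
      using eq by (simp add: sum_subtractf)
    also have "\<dots> = (\<Sum>k\<in>UNIV. (f i - g i) \<bullet> (f k - g k))"
      by (rule inner_sum_right)
    also have "\<dots> = (\<Sum>k\<in>UNIV. if k = i then (f i - g i) \<bullet> (f i - g i) else 0)"
    proof (rule sum.cong[OF refl])
      fix k
      show "(f i - g i) \<bullet> (f k - g k) = (if k = i then (f i - g i) \<bullet> (f i - g i) else 0)"
        using E d[of i] d[of k] unfolding hilbert_direct_sum_def by (cases "k = i"; simp; metis)
    qed
    finally show "g i = f i" by simp
  qed
  have "(THE g. (\<forall>j. g j \<in> E j) \<and> (\<Sum>j\<in>UNIV. f j) = (\<Sum>j\<in>UNIV. g j)) = f"
    using f uniq by (intro the_equality) auto
  then show ?thesis by (simp add: component_def)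
qed

definition U1 :: "('m::finite option \<Rightarrow> 'a::{real_inner, banach} set) \<Rightarrow> 'a set" where
  "U1 E = E None"

definition U2 :: "('m::finite option \<Rightarrow> 'a::{real_inner, banach} set) \<Rightarrow> 'a set" where
  "U2 E = {(\<Sum>i\<in>UNIV. h i) | h. \<forall>i. h i \<in> E (Some i)}"

definition inner_M :: "('a::real_inner \<Rightarrow> 'a) \<Rightarrow> 'a \<Rightarrow> 'a \<Rightarrow> real" where
  "inner_M M x y = x \<bullet> M y"

definition norm_M :: "('a::real_inner \<Rightarrow> 'a) \<Rightarrow> 'a \<Rightarrow> real" where
  "norm_M M x = sqrt (inner_M M x x)"

definition complete_M :: "('a::real_inner \<Rightarrow> 'a) \<Rightarrow> bool" where
  "complete_M M \<longleftrightarrow>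
     (\<forall>X :: nat \<Rightarrow> 'a.
        (\<forall>e>0. \<exists>N. \<forall>k\<ge>N. \<forall>l\<ge>N. norm_M M (X k - X l) < e) \<longrightarrow>
        (\<exists>L. (\<lambda>k. norm_M M (X k - L)) \<longlonglongrightarrow> 0))"

text \<open>
  In infinite dimensions pointwise positivity of \<open>M\<close> does not imply that \<open>\<langle>\<cdot>,\<cdot>\<rangle>\<^sub>M\<close> is a Hilbert
  space inner product, so completeness is required explicitly.  Completeness of both norms makes
  them equivalent, so that closures and strong limits may be taken in either of them.
\<close>

definition metric_operator :: "('a::{real_inner, banach} \<Rightarrow> 'a) \<Rightarrow> bool" where
  "metric_operator M \<longleftrightarrow>
     bounded_linear M \<and> (\<forall>x y. x \<bullet> M y = M x \<bullet> y) \<and> (\<forall>x. x \<noteq> 0 \<longrightarrow> 0 < x \<bullet> M x) \<and>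
     complete_M M"

definition blocks_orthogonal_M ::
    "('a \<Rightarrow> 'a) \<Rightarrow> ('m::finite option \<Rightarrow> 'a::{real_inner, banach} set) \<Rightarrow> bool" where
  "blocks_orthogonal_M M E \<longleftrightarrow>
     (\<forall>i j. i \<noteq> j \<longrightarrow> (\<forall>x\<in>E (Some i). \<forall>y\<in>E (Some j). inner_M M x y = 0))"

definition friedrichs_cos :: "('a::real_inner \<Rightarrow> 'a) \<Rightarrow> 'a set \<Rightarrow> 'a set \<Rightarrow> real" where
  "friedrichs_cos M U V =
     (LEAST c. 0 \<le> c \<and> c \<le> 1 \<and>
        (\<forall>u\<in>U. \<forall>v\<in>V. \<bar>inner_M M u v\<bar> \<le> c * norm_M M u * norm_M M v))"

definition nonexpansive_M :: "('a::real_inner \<Rightarrow> 'a) \<Rightarrow> ('a \<Rightarrow> 'a) \<Rightarrow> bool" where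
  "nonexpansive_M M C \<longleftrightarrow> (\<forall>x y. norm_M M (C x - C y) \<le> norm_M M (x - y))"

definition averaged_M :: "('a::real_inner \<Rightarrow> 'a) \<Rightarrow> real \<Rightarrow> ('a \<Rightarrow> 'a) \<Rightarrow> bool" where
  "averaged_M M \<theta> T \<longleftrightarrow>
     0 < \<theta> \<and> \<theta> \<le> 1 \<and>
     (\<exists>C. nonexpansive_M M C \<and> (\<forall>x. T x = (1 - \<theta>) *\<^sub>R x + \<theta> *\<^sub>R C x))"

definition inf_displacement :: "('a::real_inner \<Rightarrow> 'a) \<Rightarrow> ('a \<Rightarrow> 'a) \<Rightarrow> 'a" where
  "inf_displacement M T =
     (THE v. v \<in> closure (range (\<lambda>x. x - T x)) \<and>
             (\<forall>w\<in>closure (range (\<lambda>x. x - T x)). norm_M M v \<le> norm_M M w))"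

definition S_op :: "real \<Rightarrow> ('a \<Rightarrow> 'a) \<Rightarrow> 'a \<Rightarrow> 'a::real_vector" where
  "S_op \<theta> T x = (1 / \<theta>) *\<^sub>R (x - T x)"

definition G_op :: "('m::finite option \<Rightarrow> 'a::{real_inner, banach} set) \<Rightarrow> real \<Rightarrow> ('a \<Rightarrow> 'a) \<Rightarrow> 'a \<Rightarrow> 'a"
  where "G_op E \<theta> T x = component E None (S_op \<theta> T x)"

definition H_op :: "('m::finite option \<Rightarrow> 'a::{real_inner, banach} set) \<Rightarrow> real \<Rightarrow> ('a \<Rightarrow> 'a) \<Rightarrow> 'a \<Rightarrow> 'a"
  where "H_op E \<theta> T x = (\<Sum>i\<in>UNIV. component E (Some i) (S_op \<theta> T x))"

definition Hi_op ::
    "('m::finite option \<Rightarrow> 'a::{real_inner, banach} set) \<Rightarrow> real \<Rightarrow> ('a \<Rightarrow> 'a) \<Rightarrow> 'm \<Rightarrow> 'a \<Rightarrow> 'a"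
  where "Hi_op E \<theta> T i x = component E (Some i) (H_op E \<theta> T x)"

text \<open>
  With \<open>\<iota>\<close> a value of the random vector \<open>\<I>\<close>, \<open>T_sel E \<theta> \<alpha> T \<iota>\<close> is \<open>T\<^sub>\<I>\<close> and \<open>sel E \<alpha> \<iota> u\<close> is \<open>u\<^sub>\<I>\<close>.
\<close>

definition T_sel ::
    "('m::finite option \<Rightarrow> 'a::{real_inner, banach} set) \<Rightarrow> real \<Rightarrow> real \<Rightarrow> ('a \<Rightarrow> 'a) \<Rightarrow>
     real ^ 'm \<Rightarrow> 'a \<Rightarrow> 'a"
  where "T_sel E \<theta> \<alpha> T \<iota> x =
     x - \<theta> *\<^sub>R (\<alpha> *\<^sub>R G_op E \<theta> T x + (\<Sum>i\<in>UNIV. (\<iota> $ i) *\<^sub>R Hi_op E \<theta> T i x))"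

definition sel :: "('m::finite option \<Rightarrow> 'a::{real_inner, banach} set) \<Rightarrow> real \<Rightarrow> real ^ 'm \<Rightarrow> 'a \<Rightarrow> 'a"
  where "sel E \<alpha> \<iota> u =
     \<alpha> *\<^sub>R component E None u + (\<Sum>i\<in>UNIV. (\<iota> $ i) *\<^sub>R component E (Some i) u)"

text \<open>
  The Bochner integral of HOL-Analysis is restricted to second countable (hence separable) spaces.
  As the Hilbert spaces here are arbitrary, its definition is repeated without this restriction.
\<close>

definition has_expectation ::
    "'w measure \<Rightarrow> ('w \<Rightarrow> 'a::{real_normed_vector}) \<Rightarrow> 'a \<Rightarrow> bool" where
  "has_expectation P X e \<longleftrightarrow>
     X \<in> borel_measurable P \<and>
     (\<exists>s :: nat \<Rightarrow> 'w \<Rightarrow> 'a.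
        (\<forall>i. Bochner_Integration.simple_bochner_integrable P (s i)) \<and>
        (\<lambda>i. \<integral>\<^sup>+\<omega>. norm (X \<omega> - s i \<omega>) \<partial>P) \<longlonglongrightarrow> 0 \<and>
        (\<lambda>i. Bochner_Integration.simple_bochner_integral P (s i)) \<longlonglongrightarrow> e)"

lemma has_expectation_iff_has_bochner_integral:
  fixes X :: "'w \<Rightarrow> 'a::{real_normed_vector, second_countable_topology}"
  shows "has_expectation P X e \<longleftrightarrow> has_bochner_integral P X e"
  unfolding has_expectation_def has_bochner_integral.simps by blast

definition vec_expectation :: "'w measure \<Rightarrow> ('w \<Rightarrow> 'a::real_normed_vector) \<Rightarrow> 'a" where
  "vec_expectation P X = (THE e. has_expectation P X e)"

definition Var_M :: "('a::{real_inner, banach} \<Rightarrow> 'a) \<Rightarrow> 'w measure \<Rightarrow> ('w \<Rightarrow> 'a) \<Rightarrow> real" where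
  "Var_M M P X = (\<integral>\<omega>. (norm_M M (X \<omega>))\<^sup>2 \<partial>P) - (norm_M M (vec_expectation P X))\<^sup>2"

text \<open>Integrability is demanded because a non-integrable function has Lebesgue integral 0 here.\<close>

definition L2_tendsto_M ::
    "('a::{real_inner, banach} \<Rightarrow> 'a) \<Rightarrow> 'w measure \<Rightarrow> (nat \<Rightarrow> 'w \<Rightarrow> 'a) \<Rightarrow> ('w \<Rightarrow> 'a) \<Rightarrow> bool" where
  "L2_tendsto_M M P X Y \<longleftrightarrow>
     (\<forall>k. integrable P (\<lambda>\<omega>. (norm_M M (X k \<omega> - Y \<omega>))\<^sup>2)) \<and>
     (\<lambda>k. \<integral>\<omega>. (norm_M M (X k \<omega> - Y \<omega>))\<^sup>2 \<partial>P) \<longlonglongrightarrow> 0"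

end

theory Submission
  imports Defs "HOL-Library.Discrete_Functions"
begin

text \<open>
  Put \<open>S = \<theta>\<^bsup>-1\<^esup>(Id - T)\<close>, \<open>a = \<alpha>\<theta>\<close> and \<open>u = v / \<theta>\<close>.  A random step from \<open>x\<close> has mean \<open>x - a S x\<close>, so the iterates
  are compared with a deterministic trajectory \<open>y\<^sub>k\<^sub>+\<^sub>1 = y\<^sub>k - a S y\<^sub>k\<close>.  For the latter \<open>S y\<^sub>k \<longlonglongrightarrow> u\<close>
  (\<open>forward_displacement_tendsto\<close>), hence \<open>y\<^sub>k / k \<longlonglongrightarrow> - a u = - \<alpha> v\<close>, and everything depends on how fast
  \<open>d\<^sub>k = E \<parallel>x\<^sub>k - y\<^sub>k\<parallel>\<^sup>2\<close> grows.
  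
  Since \<open>T\<close> is averaged, \<open>S\<close> is cocoercive: \<open>\<parallel>S x - S y\<parallel>\<^sup>2 \<le> 2 \<langle>x - y, S x - S y\<rangle>\<close>.  If the second moment of the
  selection of any vector \<open>w\<close> is at most \<open>\<beta> \<parallel>w\<parallel>\<^sup>2\<close>, expanding one step (\<open>integral_move_square_le\<close>) gives
  
    \<open>d\<^sub>k\<^sub>+\<^sub>1 \<le> d\<^sub>k - (a - \<theta>\<^sup>2 \<beta>) E \<parallel>S x\<^sub>k - S y\<^sub>k\<parallel>\<^sup>2 + \<theta>\<^sup>2 (\<beta> - \<alpha>\<^sup>2) (2 E \<langle>S x\<^sub>k - S y\<^sub>k, S y\<^sub>k\<rangle> + \<parallel>S y\<^sub>k\<parallel>\<^sup>2)\<close>.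
  
  The angle enters only here: \<open>\<beta> \<le> \<alpha> / \<theta>\<close>, which makes the second term a gain, is possible when
  \<open>c\<^sub>F\<^sup>2 \<le> (1 - \<theta>) / (1 - \<alpha>\<theta>)\<close>, with strict inequalities going together.  In the cross term \<open>S y\<^sub>k\<close> may be replaced by
  its limit \<open>u\<close> at a small cost, and then it telescopes, because \<open>a E \<langle>S x\<^sub>k - S y\<^sub>k, u\<rangle>\<close> is the decrease of
  \<open>E \<langle>x\<^sub>k - y\<^sub>k, u\<rangle> = O(sqrt d\<^sub>k)\<close>.  What remains is growth by \<open>\<theta>\<^sup>2 (\<beta> - \<alpha>\<^sup>2) \<parallel>u\<parallel>\<^sup>2 = (\<beta> - \<alpha>\<^sup>2) \<parallel>v\<parallel>\<^sup>2\<close> per step.  For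
  \<open>\<beta> = \<alpha> / \<theta>\<close> the cost of the replacement is controlled only well enough for \<open>d\<^sub>k = o(k\<^sup>2)\<close> (\<open>dist_sublinear\<close>),
  which is convergence in \<open>L\<^sup>2\<close>; for \<open>\<beta> < \<alpha> / \<theta>\<close> one gets \<open>limsup d\<^sub>k / k \<le> (\<beta> - \<alpha>\<^sup>2) \<parallel>v\<parallel>\<^sup>2\<close> (\<open>dist_eventually_le\<close>).
  This bounds the variance, as \<open>y\<^sub>k\<close> is deterministic, and also the bias when \<open>v\<close> is attained, as then \<open>y\<^sub>0\<close> can
  be chosen with \<open>y\<^sub>k = y\<^sub>0 - k \<alpha> v\<close>.  Almost sure convergence follows from the same recursion by a weighted
  summation and passage through the subsequence of square indices (\<open>AE_dist_sublinear\<close>).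
  
  Two foundations are needed.  The minimal displacement exists because the resolvents of \<open>S\<close> produce a
  Cauchy sequence of displacements (\<open>minimal_range_element\<close>), and the norms of the two inner products are
  equivalent by Baire's theorem (\<open>norm_le_nm\<close>), which makes \<open>T\<close> and the block projections continuous in both.
  As the space may be nonseparable, random vectors are treated as uniform limits of simple functions.
\<close>

section \<open>The geometry of the \<open>M\<close>-inner product\<close>

locale metric_op =
  fixes M :: "'a::{real_inner, banach} \<Rightarrow> 'a"
  assumes metric: "metric_operator M"
begin

abbreviation ip :: "'a \<Rightarrow> 'a \<Rightarrow> real" (\<open>\<langle>_, _\<rangle>\<close>) where
  "\<langle>x, y\<rangle> \<equiv> inner_M M x y"

abbreviation nm :: "'a \<Rightarrow> real" (\<open>\<parallel>_\<parallel>\<close>) where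
  "\<parallel>x\<parallel> \<equiv> norm_M M x"

lemma bounded_linear_M: "bounded_linear M"
  using metric by (simp add: metric_operator_def)

lemma linear_M: "linear M"
  using bounded_linear_M by (rule bounded_linear.linear)

lemma ip_commute: "\<langle>x, y\<rangle> = \<langle>y, x\<rangle>"
  using metric by (simp add: metric_operator_def inner_M_def inner_commute)

lemma ip_simps:
  "\<langle>x + y, z\<rangle> = \<langle>x, z\<rangle> + \<langle>y, z\<rangle>" "\<langle>z, x + y\<rangle> = \<langle>z, x\<rangle> + \<langle>z, y\<rangle>"
  "\<langle>x - y, z\<rangle> = \<langle>x, z\<rangle> - \<langle>y, z\<rangle>" "\<langle>z, x - y\<rangle> = \<langle>z, x\<rangle> - \<langle>z, y\<rangle>"
  "\<langle>r *\<^sub>R x, z\<rangle> = r * \<langle>x, z\<rangle>" "\<langle>z, r *\<^sub>R x\<rangle> = r * \<langle>z, x\<rangle>"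
  "\<langle>- x, z\<rangle> = - \<langle>x, z\<rangle>" "\<langle>z, - x\<rangle> = - \<langle>z, x\<rangle>"
  "\<langle>0, z\<rangle> = 0" "\<langle>z, 0\<rangle> = 0"
  by (simp_all add: inner_M_def linear_M linear_add linear_diff linear_scale linear_neg linear_0
      inner_add_left inner_add_right inner_diff_left inner_diff_right)

lemma ip_sum_left: "\<langle>sum f A, z\<rangle> = (\<Sum>i\<in>A. \<langle>f i, z\<rangle>)"
  by (simp add: inner_M_def inner_sum_left)

lemma ip_sum_right: "\<langle>z, sum f A\<rangle> = (\<Sum>i\<in>A. \<langle>z, f i\<rangle>)"
  unfolding ip_commute[of z] by (rule ip_sum_left)

lemma ip_self_pos: "x \<noteq> 0 \<Longrightarrow> 0 < \<langle>x, x\<rangle>"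
  using metric unfolding metric_operator_def inner_M_def by blast

lemma ip_self_nonneg: "0 \<le> \<langle>x, x\<rangle>"
  using ip_self_pos[of x] by (cases "x = 0") (auto simp: ip_simps)

lemma nm_nonneg [simp]: "0 \<le> \<parallel>x\<parallel>"
  by (simp add: norm_M_def ip_self_nonneg)

lemma nm_eq_0_iff [simp]: "\<parallel>x\<parallel> = 0 \<longleftrightarrow> x = 0"
  using ip_self_pos[of x] by (cases "x = 0") (auto simp: norm_M_def ip_simps)

lemma nm_0 [simp]: "\<parallel>0\<parallel> = 0"
  by simp

lemma nm_square: "\<parallel>x\<parallel>\<^sup>2 = \<langle>x, x\<rangle>"
  by (simp add: norm_M_def ip_self_nonneg)

lemma nm_scaleR: "\<parallel>r *\<^sub>R x\<parallel> = \<bar>r\<bar> * \<parallel>x\<parallel>"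
  by (simp add: norm_M_def ip_simps real_sqrt_mult flip: mult.assoc)

lemma nm_minus: "\<parallel>- x\<parallel> = \<parallel>x\<parallel>"
  using nm_scaleR[of "-1" x] by simp

lemma nm_minus_commute: "\<parallel>x - y\<parallel> = \<parallel>y - x\<parallel>"
  using nm_minus[of "x - y"] by simp

lemma nm_square_add: "\<parallel>x + y\<parallel>\<^sup>2 = \<parallel>x\<parallel>\<^sup>2 + 2 * \<langle>x, y\<rangle> + \<parallel>y\<parallel>\<^sup>2"
  by (simp add: nm_square ip_simps ip_commute[of y x])

lemma nm_square_diff: "\<parallel>x - y\<parallel>\<^sup>2 = \<parallel>x\<parallel>\<^sup>2 - 2 * \<langle>x, y\<rangle> + \<parallel>y\<parallel>\<^sup>2"
  by (simp add: nm_square ip_simps ip_commute[of y x])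

lemma ip_le: "\<bar>\<langle>x, y\<rangle>\<bar> \<le> \<parallel>x\<parallel> * \<parallel>y\<parallel>"
proof (cases "y = 0")
  case False
  then have y: "0 < \<parallel>y\<parallel>\<^sup>2" by (simp add: nm_square ip_self_pos)
  define t where "t = \<langle>x, y\<rangle> / \<parallel>y\<parallel>\<^sup>2"
  have "0 \<le> \<parallel>x - t *\<^sub>R y\<parallel>\<^sup>2" by simp
  also have "\<dots> = \<parallel>x\<parallel>\<^sup>2 - 2 * t * \<langle>x, y\<rangle> + t\<^sup>2 * \<parallel>y\<parallel>\<^sup>2"
    by (simp add: nm_square_diff ip_simps nm_scaleR power_mult_distrib)
  also have "\<dots> = \<parallel>x\<parallel>\<^sup>2 - \<langle>x, y\<rangle>\<^sup>2 / \<parallel>y\<parallel>\<^sup>2"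
    using y False unfolding t_def by (simp add: field_simps power2_eq_square)
  finally have "\<langle>x, y\<rangle>\<^sup>2 \<le> (\<parallel>x\<parallel> * \<parallel>y\<parallel>)\<^sup>2"
    using y by (simp add: field_simps power_mult_distrib)
  then show ?thesis by (metis abs_le_square_iff abs_of_nonneg mult_nonneg_nonneg nm_nonneg)
qed (simp add: ip_simps)

lemma ip_le': "\<langle>x, y\<rangle> \<le> \<parallel>x\<parallel> * \<parallel>y\<parallel>"
  using ip_le[of x y] by linarith

lemma nm_triangle: "\<parallel>x + y\<parallel> \<le> \<parallel>x\<parallel> + \<parallel>y\<parallel>"
proof -
  have "\<parallel>x + y\<parallel>\<^sup>2 \<le> (\<parallel>x\<parallel> + \<parallel>y\<parallel>)\<^sup>2"
    using ip_le'[of x y] unfolding nm_square_add by (simp add: power2_sum)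
  then show ?thesis by (rule power2_le_imp_le) simp
qed

lemma nm_triangle_sub: "\<parallel>x\<parallel> \<le> \<parallel>y\<parallel> + \<parallel>x - y\<parallel>"
  using nm_triangle[of y "x - y"] by simp

lemma nm_triangle_diff: "\<parallel>x - y\<parallel> \<le> \<parallel>x\<parallel> + \<parallel>y\<parallel>"
  using nm_triangle[of x "- y"] by (simp add: nm_minus)

lemma nm_sum: "\<parallel>sum f A\<parallel> \<le> (\<Sum>i\<in>A. \<parallel>f i\<parallel>)"
proof (induction A rule: infinite_finite_induct)
  case (insert i A)
  then show ?case using nm_triangle[of "f i" "sum f A"] by simp
qed auto

lemma nm_square_le_2: "\<parallel>x + y\<parallel>\<^sup>2 \<le> 2 * \<parallel>x\<parallel>\<^sup>2 + 2 * \<parallel>y\<parallel>\<^sup>2"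
proof -
  have "0 \<le> \<parallel>x - y\<parallel>\<^sup>2" by simp
  then show ?thesis unfolding nm_square_add nm_square_diff by linarith
qed

sublocale M: Metric_space UNIV "\<lambda>x y. \<parallel>x - y\<parallel>"
  by standard (use nm_triangle[of "x - y" "y - z" for x y z] in \<open>auto simp: nm_minus_commute\<close>)

lemma limitin_M: "limitin M.mtopology X l sequentially \<longleftrightarrow> (\<lambda>k. \<parallel>X k - l\<parallel>) \<longlonglongrightarrow> 0"
  by (auto simp: M.limit_metric_sequentially LIMSEQ_def)

lemma mcomplete_M: "M.mcomplete"
proof -
  have c: "complete_M M" using metric by (simp add: metric_operator_def)
  show ?thesis
    unfolding M.mcomplete_def M.MCauchy_def limitin_M using c unfolding complete_M_def by metis
qed

lemma nm_le_norm: "\<exists>K>0. \<forall>x. \<parallel>x\<parallel> \<le> K * norm x"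
proof -
  obtain B where B: "0 < B" "\<And>x. norm (M x) \<le> norm x * B"
    using bounded_linear.pos_bounded[OF bounded_linear_M] by blast
  have "\<parallel>x\<parallel> \<le> sqrt B * norm x" for x
  proof -
    have "\<langle>x, x\<rangle> \<le> norm x * norm (M x)"
      unfolding inner_M_def by (rule norm_cauchy_schwarz)
    also have "\<dots> \<le> norm x * (norm x * B)"
      by (intro mult_left_mono B) simp
    finally have "sqrt \<langle>x, x\<rangle> \<le> sqrt (B * (norm x)\<^sup>2)"
      by (intro real_sqrt_le_mono) (simp add: power2_eq_square algebra_simps)
    then show ?thesis by (simp add: norm_M_def real_sqrt_mult)
  qed
  then show ?thesis using B by (intro exI[of _ "sqrt B"]) auto
qed

section \<open>The element of minimal norm in the closed range of a cocoercive operator\<close>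

lemma nonexpansive_imp_cocoercive:
  assumes C: "nonexpansive_M M C" and S: "\<And>x. S x = x - C x"
  shows "\<parallel>S x - S y\<parallel>\<^sup>2 \<le> 2 * \<langle>x - y, S x - S y\<rangle>"
proof -
  have "\<parallel>C x - C y\<parallel>\<^sup>2 \<le> \<parallel>x - y\<parallel>\<^sup>2"
    using C by (intro power_mono) (auto simp: nonexpansive_M_def)
  moreover have "C x - C y = (x - y) - (S x - S y)" by (simp add: S)
  ultimately show ?thesis by (simp add: nm_square_diff)
qed

text \<open>
  The equation says that \<open>x\<close> is a fixed point of the contraction \<open>(1 + e)\<^bsup>-1\<^esup> C\<close>.
\<close>

lemma resolvent_exists:
  assumes C: "nonexpansive_M M C" and S: "\<And>x. S x = x - C x" and e: "0 < e"
  shows "\<exists>x. e *\<^sub>R x + S x = 0"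
proof -
  let ?f = "\<lambda>x. (1 / (1 + e)) *\<^sub>R C x"
  have "\<parallel>?f x - ?f y\<parallel> \<le> (1 / (1 + e)) * \<parallel>x - y\<parallel>" for x y
  proof -
    have "?f x - ?f y = (1 / (1 + e)) *\<^sub>R (C x - C y)" by (simp add: scaleR_diff_right)
    then have "\<parallel>?f x - ?f y\<parallel> = (1 / (1 + e)) * \<parallel>C x - C y\<parallel>" using e by (simp only: nm_scaleR) simp
    also have "\<dots> \<le> (1 / (1 + e)) * \<parallel>x - y\<parallel>"
      using C e by (intro mult_left_mono) (auto simp: nonexpansive_M_def)
    finally show ?thesis .
  qed
  then obtain x where "?f x = x"
    using M.Banach_fixedpoint_thm[OF mcomplete_M, of ?f "1 / (1 + e)"] e by auto
  then have "(1 + e) *\<^sub>R x = (1 + e) *\<^sub>R ?f x" by (simp only:)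
  then have "(1 + e) *\<^sub>R x = C x" using e by simp
  then show ?thesis by (intro exI[of _ x]) (simp add: S algebra_simps)
qed

text \<open>
  The values \<open>u\<^sub>n\<close> of \<open>S\<close> at the solutions of \<open>z/n + S z = 0\<close> form a Cauchy sequence: monotonicity of
  \<open>S\<close> at two solutions bounds \<open>\<parallel>u\<^sub>n - u\<^sub>m\<parallel>\<^sup>2\<close> by a difference of the decreasing numbers \<open>\<parallel>u\<^sub>n\<parallel>\<^sup>2\<close>, and at a
  solution and an arbitrary point it gives the variational inequality in the limit.  That
  inequality says that \<open>u\<close> is the unique element of minimal norm in the closed range.
\<close>

theorem minimal_range_element:
  assumes C: "nonexpansive_M M C" and S: "\<And>x. S x = x - C x"
  obtains u z where "(\<lambda>n. \<parallel>S (z n) - u\<parallel>) \<longlonglongrightarrow> 0" "\<And>x. \<parallel>u\<parallel>\<^sup>2 \<le> \<langle>u, S x\<rangle>"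
proof -
  have "\<exists>x. (1 / real (Suc n)) *\<^sub>R x + S x = 0" for n
    by (rule resolvent_exists[OF C S]) auto
  then obtain z where z: "\<And>n. (1 / real (Suc n)) *\<^sub>R z n + S (z n) = 0" by metis
  define u where "u n = S (z n)" for n
  have z_eq: "z n = - (real (Suc n) *\<^sub>R u n)" for n
  proof -
    have "real (Suc n) *\<^sub>R ((1 / real (Suc n)) *\<^sub>R z n + S (z n)) = 0" using z by simp
    then show ?thesis by (simp add: scaleR_add_right u_def eq_neg_iff_add_eq_0 del: of_nat_Suc)
  qed
  have mono: "0 \<le> \<langle>x - y, S x - S y\<rangle>" for x y
    using nonexpansive_imp_cocoercive[OF C S, of x y] zero_le_power2[of "\<parallel>S x - S y\<parallel>"] by linarith
  have key: "\<parallel>u n - u m\<parallel>\<^sup>2 \<le> \<parallel>u m\<parallel>\<^sup>2 - \<parallel>u n\<parallel>\<^sup>2" if "m < n" for m n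
  proof -
    let ?l = "real (Suc n)" and ?k = "real (Suc m)"
    have "0 \<le> \<langle>z n - z m, u n - u m\<rangle>" unfolding u_def by (rule mono)
    also have "\<dots> = (?l + ?k) * \<langle>u n, u m\<rangle> - ?l * \<parallel>u n\<parallel>\<^sup>2 - ?k * \<parallel>u m\<parallel>\<^sup>2"
      unfolding z_eq by (simp add: ip_simps nm_square ip_commute[of "u m" "u n"] algebra_simps)
    finally have "2 * (?l * \<parallel>u n\<parallel>\<^sup>2 + ?k * \<parallel>u m\<parallel>\<^sup>2) \<le> (?l + ?k) * (2 * \<langle>u n, u m\<rangle>)"
      by (simp add: algebra_simps)
    also have "2 * \<langle>u n, u m\<rangle> = \<parallel>u n\<parallel>\<^sup>2 + \<parallel>u m\<parallel>\<^sup>2 - \<parallel>u n - u m\<parallel>\<^sup>2"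
      by (simp add: nm_square_diff)
    finally have le: "(?l + ?k) * \<parallel>u n - u m\<parallel>\<^sup>2 \<le> (?l - ?k) * (\<parallel>u m\<parallel>\<^sup>2 - \<parallel>u n\<parallel>\<^sup>2)"
      by (simp add: algebra_simps)
    have pos: "0 < ?l - ?k" using that by simp
    have "0 \<le> (?l - ?k) * (\<parallel>u m\<parallel>\<^sup>2 - \<parallel>u n\<parallel>\<^sup>2)"
      by (rule order_trans[OF _ le]) simp
    then have nn: "0 \<le> \<parallel>u m\<parallel>\<^sup>2 - \<parallel>u n\<parallel>\<^sup>2" using pos by (simp add: zero_le_mult_iff)
    have "(?l + ?k) * \<parallel>u n - u m\<parallel>\<^sup>2 \<le> (?l + ?k) * (\<parallel>u m\<parallel>\<^sup>2 - \<parallel>u n\<parallel>\<^sup>2)"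
      by (rule order_trans[OF le]) (intro mult_right_mono nn, simp)
    then show ?thesis by (simp add: mult_le_cancel_left)
  qed
  have "decseq (\<lambda>n. \<parallel>u n\<parallel>\<^sup>2)"
    unfolding decseq_Suc_iff
  proof
    fix n show "\<parallel>u (Suc n)\<parallel>\<^sup>2 \<le> \<parallel>u n\<parallel>\<^sup>2"
      using order_trans[OF zero_le_power2 key[of n "Suc n"]] by linarith
  qed
  then have "convergent (\<lambda>n. \<parallel>u n\<parallel>\<^sup>2)"
    by (rule decseq_convergent[where B=0]) (auto simp: convergent_def)
  then have Cau: "Cauchy (\<lambda>n. \<parallel>u n\<parallel>\<^sup>2)" by (simp add: Cauchy_convergent_iff)
  have "M.MCauchy u"
    unfolding M.MCauchy_def
  proof (intro conjI allI impI)
    fix e :: real assume e: "0 < e"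
    obtain N where N: "\<And>m n. N \<le> m \<Longrightarrow> N \<le> n \<Longrightarrow> \<bar>\<parallel>u m\<parallel>\<^sup>2 - \<parallel>u n\<parallel>\<^sup>2\<bar> < e\<^sup>2"
      using metric_CauchyD[OF Cau, of "e\<^sup>2"] e by (auto simp: dist_real_def)
    have *: "\<parallel>u n - u m\<parallel> < e" if "N \<le> m" "m < n" for m n
    proof -
      have "\<parallel>u n - u m\<parallel>\<^sup>2 < e\<^sup>2"
        using key[OF that(2)] N[of m n] that by linarith
      then show ?thesis using e by (simp add: power2_less_imp_less)
    qed
    have "\<parallel>u n - u m\<parallel> < e" if "N \<le> m" "N \<le> n" for m n
      using *[of m n] *[of n m] that e by (cases m n rule: linorder_cases) (auto simp: nm_minus_commute)
    then show "\<exists>N. \<forall>n n'. N \<le> n \<longrightarrow> N \<le> n' \<longrightarrow> \<parallel>u n - u n'\<parallel> < e" by blast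
  qed simp
  then obtain l where l: "(\<lambda>n. \<parallel>u n - l\<parallel>) \<longlonglongrightarrow> 0"
    using mcomplete_M unfolding M.mcomplete_def limitin_M by blast
  have ip_lim: "(\<lambda>n. \<langle>u n, w\<rangle>) \<longlonglongrightarrow> \<langle>l, w\<rangle>" for w
  proof -
    have "(\<lambda>n. \<parallel>u n - l\<parallel> * \<parallel>w\<parallel>) \<longlonglongrightarrow> 0" by (rule tendsto_mult_left_zero[OF l])
    then have "(\<lambda>n. \<langle>u n, w\<rangle> - \<langle>l, w\<rangle>) \<longlonglongrightarrow> 0"
      by (rule Lim_null_comparison[rotated]) (use ip_le[of "u n - l" w for n] in \<open>auto simp: ip_simps\<close>)
    then show ?thesis by (simp add: LIM_zero_iff)
  qed
  have nm_lim: "(\<lambda>n. \<parallel>u n\<parallel>) \<longlonglongrightarrow> \<parallel>l\<parallel>"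
  proof -
    have "(\<lambda>n. \<parallel>u n\<parallel> - \<parallel>l\<parallel>) \<longlonglongrightarrow> 0"
    proof (rule Lim_null_comparison[OF always_eventually l], rule allI)
      fix n show "norm (\<parallel>u n\<parallel> - \<parallel>l\<parallel>) \<le> \<parallel>u n - l\<parallel>"
        using nm_triangle_sub[of "u n" l] nm_triangle_sub[of l "u n"] nm_minus_commute[of "u n" l]
        by auto
    qed
    then show ?thesis by (simp add: LIM_zero_iff)
  qed
  have "\<parallel>l\<parallel>\<^sup>2 \<le> \<langle>l, S x\<rangle>" for x
  proof (rule LIMSEQ_le)
    show "(\<lambda>n. \<parallel>u n\<parallel>\<^sup>2 + (1 / real (Suc n)) * (\<langle>x, u n\<rangle> - \<langle>x, S x\<rangle>)) \<longlonglongrightarrow> \<parallel>l\<parallel>\<^sup>2"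
    proof -
      have "(\<lambda>n. 1 / real (Suc n)) \<longlonglongrightarrow> 0"
        using LIMSEQ_inverse_real_of_nat by (simp add: inverse_eq_divide)
      then have "(\<lambda>n. \<parallel>u n\<parallel>\<^sup>2 + (1 / real (Suc n)) * (\<langle>u n, x\<rangle> - \<langle>x, S x\<rangle>))
          \<longlonglongrightarrow> \<parallel>l\<parallel>\<^sup>2 + 0 * (\<langle>l, x\<rangle> - \<langle>x, S x\<rangle>)"
        by (intro tendsto_intros nm_lim ip_lim)
      then show ?thesis by (simp add: ip_commute)
    qed
    show "(\<lambda>n. \<langle>u n, S x\<rangle>) \<longlonglongrightarrow> \<langle>l, S x\<rangle>" by (rule ip_lim)
    have "\<parallel>u n\<parallel>\<^sup>2 + (1 / real (Suc n)) * (\<langle>x, u n\<rangle> - \<langle>x, S x\<rangle>) \<le> \<langle>u n, S x\<rangle>" for n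
    proof -
      have "0 \<le> (1 / real (Suc n)) * \<langle>z n - x, u n - S x\<rangle>"
        unfolding u_def by (intro mult_nonneg_nonneg mono) auto
      also have "\<dots> = \<langle>(1 / real (Suc n)) *\<^sub>R z n, u n - S x\<rangle> - (1 / real (Suc n)) * \<langle>x, u n - S x\<rangle>"
        by (simp add: ip_simps algebra_simps)
      also have "(1 / real (Suc n)) *\<^sub>R z n = - u n"
        using z[of n] unfolding u_def by (simp add: eq_neg_iff_add_eq_0)
      finally show ?thesis by (simp add: ip_simps nm_square algebra_simps)
    qed
    then show "\<exists>N. \<forall>n\<ge>N. \<parallel>u n\<parallel>\<^sup>2 + (1 / real (Suc n)) * (\<langle>x, u n\<rangle> - \<langle>x, S x\<rangle>) \<le> \<langle>u n, S x\<rangle>"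
      by blast
  qed
  then show thesis using that[of z l] l by (simp add: u_def)
qed

end

section \<open>Equivalence of the two norms\<close>

text \<open>
  Results about \<open>M\<close> apply to the ambient inner product as well.
\<close>

lemma metric_operator_id: "metric_operator (\<lambda>x. x)"
proof -
  have "complete_M (\<lambda>x. x :: 'a)"
    unfolding complete_M_def
  proof (intro allI impI)
    fix X :: "nat \<Rightarrow> 'a"
    assume "\<forall>e>0. \<exists>N. \<forall>k\<ge>N. \<forall>l\<ge>N. norm_M (\<lambda>x. x) (X k - X l) < e"
    then have "Cauchy X"
      by (simp add: Cauchy_def norm_M_def inner_M_def dist_norm norm_eq_sqrt_inner)
    then obtain L where "X \<longlonglongrightarrow> L" using Cauchy_convergent convergentD by blast
    then have "(\<lambda>k. norm (X k - L)) \<longlonglongrightarrow> 0"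
      by (simp add: LIM_zero_iff tendsto_norm_zero_iff)
    then show "\<exists>L. (\<lambda>k. norm_M (\<lambda>x. x) (X k - L)) \<longlonglongrightarrow> 0"
      by (auto simp: norm_M_def inner_M_def norm_eq_sqrt_inner)
  qed
  then show ?thesis
    by (auto simp: metric_operator_def bounded_linear_ident)
qed

context metric_op
begin

lemma norm_M_square_bound: "\<exists>B>0. \<forall>x. (norm (M x))\<^sup>2 \<le> B * \<langle>x, x\<rangle>"
proof -
  obtain B where B: "0 < B" "\<And>x. norm (M x) \<le> norm x * B"
    using bounded_linear.pos_bounded[OF bounded_linear_M] by blast
  have "(norm (M x))\<^sup>2 \<le> B * \<langle>x, x\<rangle>" for x
  proof (cases "M x = 0")
    case True
    then show ?thesis using B by (simp add: ip_self_nonneg)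
  next
    case False
    have eq: "\<langle>x, M x\<rangle> = (norm (M x))\<^sup>2"
      using metric by (simp add: inner_M_def metric_operator_def power2_norm_eq_inner)
    have "((norm (M x))\<^sup>2)\<^sup>2 \<le> (\<parallel>x\<parallel> * \<parallel>M x\<parallel>)\<^sup>2"
      using ip_le[of x "M x"] unfolding eq by (intro power_mono) auto
    also have "\<dots> = \<langle>x, x\<rangle> * (M x \<bullet> M (M x))"
      unfolding power_mult_distrib nm_square by (simp add: inner_M_def)
    also have "\<dots> \<le> \<langle>x, x\<rangle> * (norm (M x) * (norm (M x) * B))"
      by (intro mult_left_mono order_trans[OF norm_cauchy_schwarz] B ip_self_nonneg) auto
    finally have *: "(norm (M x))\<^sup>2 * (norm (M x))\<^sup>2 \<le> (norm (M x))\<^sup>2 * (B * \<langle>x, x\<rangle>)"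
      by (simp add: power2_eq_square mult_ac)
    show ?thesis by (rule mult_left_le_imp_le[OF *]) (use False in simp)
  qed
  then show ?thesis using B by blast
qed

text \<open>
  For \<open>w\<close> in the space, the affine map \<open>x \<mapsto> (M x - w) / B\<close> is cocoercive in the ambient inner product.
  The minimal element \<open>u\<close> of its closed range satisfies \<open>\<parallel>u\<parallel>\<^sup>2 \<le> u \<bullet> (M x - w) / B\<close> for all \<open>x\<close>; since the
  right-hand side is affine and bounded below along the line through \<open>u\<close>, the vector \<open>u\<close> is zero and
  \<open>w\<close> is a limit of values of \<open>M\<close>.
\<close>

lemma closure_range_M: "closure (range M) = UNIV"
proof -
  interpret id: metric_op "\<lambda>x :: 'a. x"
    by standard (rule metric_operator_id)
  have id_ip: "inner_M (\<lambda>x :: 'a. x) x y = x \<bullet> y" for x y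
    by (simp add: inner_M_def)
  have id_nm: "norm_M (\<lambda>x :: 'a. x) x = norm x" for x
    by (simp add: norm_M_def inner_M_def norm_eq_sqrt_inner)
  obtain B where B: "0 < B" "\<And>x. (norm (M x))\<^sup>2 \<le> B * \<langle>x, x\<rangle>"
    using norm_M_square_bound by blast
  have "w \<in> closure (range M)" for w
  proof -
    define S where "S x = (1 / B) *\<^sub>R (M x - w)" for x
    define C where "C x = x - S x" for x
    have SC: "S x = x - C x" for x by (simp add: C_def)
    have ne: "nonexpansive_M (\<lambda>x :: 'a. x) C"
      unfolding nonexpansive_M_def id_nm
    proof (intro allI)
      fix x y
      have eq: "C x - C y = (x - y) - (1 / B) *\<^sub>R M (x - y)"
        by (simp add: C_def S_def linear_diff[OF linear_M] algebra_simps)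
      have "(norm (C x - C y))\<^sup>2 = (norm (x - y))\<^sup>2 - (2 / B) * \<langle>x - y, x - y\<rangle>
          + (1 / B)\<^sup>2 * (norm (M (x - y)))\<^sup>2"
        unfolding eq power2_norm_eq_inner inner_M_def
        by (simp add: inner_diff_left inner_diff_right inner_commute power2_eq_square
            diff_divide_distrib)
      also have "\<dots> \<le> (norm (x - y))\<^sup>2 - (2 / B) * \<langle>x - y, x - y\<rangle>
          + (1 / B)\<^sup>2 * (B * \<langle>x - y, x - y\<rangle>)"
        by (intro add_left_mono mult_left_mono B) auto
      also have "\<dots> = (norm (x - y))\<^sup>2 - (1 / B) * \<langle>x - y, x - y\<rangle>"
        using B by (simp add: power2_eq_square field_simps)
      also have "\<dots> \<le> (norm (x - y))\<^sup>2"
        using B(1) ip_self_nonneg[of "x - y"] by simp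
      finally show "norm (C x - C y) \<le> norm (x - y)" by (rule power2_le_imp_le) simp
    qed
    obtain u z where z: "(\<lambda>n. norm (S (z n) - u)) \<longlonglongrightarrow> 0"
      and u: "\<And>x. (norm u)\<^sup>2 \<le> u \<bullet> S x"
      using id.minimal_range_element[OF ne SC] unfolding id_ip id_nm by blast
    have "u = 0"
    proof (rule ccontr)
      assume "u \<noteq> 0"
      then have pos: "0 < \<langle>u, u\<rangle>" by (rule ip_self_pos)
      \<comment> \<open>At this multiple of \<open>u\<close> the lower bound would have to be at most \<open>-1\<close>.\<close>
      define t where "t = ((u \<bullet> w) - 1) / \<langle>u, u\<rangle>"
      have "0 \<le> B * (u \<bullet> S (t *\<^sub>R u))"
        using u[of "t *\<^sub>R u"] B(1) by (intro mult_nonneg_nonneg) (auto intro: order_trans[OF zero_le_power2])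
      also have "\<dots> = t * \<langle>u, u\<rangle> - u \<bullet> w"
        using B(1) by (simp add: S_def linear_scale[OF linear_M] inner_diff_right inner_M_def)
      also have "\<dots> = -1" using pos by (simp add: t_def)
      finally show False by simp
    qed
    then have "(\<lambda>n. S (z n)) \<longlonglongrightarrow> 0"
      using z by (simp add: tendsto_norm_zero_iff)
    then have "(\<lambda>n. B *\<^sub>R S (z n)) \<longlonglongrightarrow> B *\<^sub>R 0"
      by (rule tendsto_scaleR[OF tendsto_const])
    then have "(\<lambda>n. B *\<^sub>R S (z n) + w) \<longlonglongrightarrow> B *\<^sub>R 0 + w"
      by (rule tendsto_add[OF _ tendsto_const])
    moreover have "B *\<^sub>R S x + w = M x" for x using B by (simp add: S_def)
    ultimately have "(\<lambda>n. M (z n)) \<longlonglongrightarrow> w" by simp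
    then show ?thesis
      unfolding closure_sequential by (intro exI[of _ "\<lambda>n. M (z n)"]) auto
  qed
  then show ?thesis by blast
qed

text \<open>
  A uniform boundedness argument in the complete \<open>M\<close>-norm.  By Cauchy-Schwarz every \<open>x\<close> lies in one of
  the \<open>M\<close>-closed sets \<open>F n\<close> on which \<open>\<bar>x \<bullet> M y\<bar> \<le> n \<parallel>M y\<parallel>\<close>, so by Baire one of them contains a ball.  This
  bounds \<open>x \<bullet> M y\<close> by a multiple of \<open>\<parallel>x\<parallel>\<^sub>M \<parallel>M y\<parallel>\<close>, and letting \<open>M y\<close> tend to \<open>x\<close> bounds \<open>\<parallel>x\<parallel>\<^sup>2\<close>.
\<close>

theorem norm_le_nm: "\<exists>K>0. \<forall>x. norm x \<le> K * \<parallel>x\<parallel>"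
proof -
  define F where "F n = {x. \<forall>y. \<bar>\<langle>x, y\<rangle>\<bar> \<le> real n * norm (M y)}" for n :: nat
  have closed: "closedin M.mtopology (F n)" for n
    unfolding M.metric_closedin_iff_sequentially_closed limitin_M
  proof (intro conjI allI impI)
    fix X l assume X: "range X \<subseteq> F n \<and> (\<lambda>k. \<parallel>X k - l\<parallel>) \<longlonglongrightarrow> 0"
    have "\<bar>\<langle>l, y\<rangle>\<bar> \<le> real n * norm (M y)" for y
    proof (rule LIMSEQ_le_const)
      show "(\<lambda>k. real n * norm (M y) + \<parallel>X k - l\<parallel> * \<parallel>y\<parallel>) \<longlonglongrightarrow> real n * norm (M y)"
        using X by (auto intro!: tendsto_eq_intros)
      have "\<bar>\<langle>l, y\<rangle>\<bar> \<le> real n * norm (M y) + \<parallel>X k - l\<parallel> * \<parallel>y\<parallel>" for k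
      proof -
        have "X k \<in> F n" using X by blast
        then have "\<bar>\<langle>X k, y\<rangle>\<bar> \<le> real n * norm (M y)" by (simp add: F_def)
        then show ?thesis using ip_le[of "X k - l" y] by (simp add: ip_simps)
      qed
      then show "\<exists>N. \<forall>k\<ge>N. \<bar>\<langle>l, y\<rangle>\<bar> \<le> real n * norm (M y) + \<parallel>X k - l\<parallel> * \<parallel>y\<parallel>" by blast
    qed
    then show "l \<in> F n" by (simp add: F_def)
  qed simp
  have cover: "(\<Union>n. F n) = UNIV"
  proof -
    have "x \<in> F (nat \<lceil>norm x\<rceil>)" for x
    proof -
      have "\<bar>\<langle>x, y\<rangle>\<bar> \<le> norm x * norm (M y)" for y
        unfolding inner_M_def by (rule Cauchy_Schwarz_ineq2)
      also have "norm x * norm (M y) \<le> real (nat \<lceil>norm x\<rceil>) * norm (M y)" for y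
        by (intro mult_right_mono real_nat_ceiling_ge) simp
      finally show ?thesis by (simp add: F_def)
    qed
    then show ?thesis by blast
  qed
  have "\<exists>n. M.mtopology interior_of F n \<noteq> {}"
  proof (rule ccontr)
    assume "\<not> ?thesis"
    then have "M.mtopology interior_of \<Union>(range F) = {}"
      using closed by (intro M.metric_Baire_category_alt mcomplete_M) auto
    then show False
      unfolding cover using interior_of_topspace[of M.mtopology] by simp
  qed
  then obtain n x0 where "x0 \<in> M.mtopology interior_of F n" by blast
  then obtain r where r: "0 < r" "M.mball x0 r \<subseteq> F n"
    unfolding M.in_interior_of_mball by blast
  then have F: "\<bar>\<langle>x, y\<rangle>\<bar> \<le> real n * norm (M y)" if "\<parallel>x0 - x\<parallel> < r" for x y
    using that by (auto simp: F_def)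
  define K where "K = 4 * (real n + 1) / r"
  have K: "0 < K" using r by (simp add: K_def)
  have bnd: "\<bar>\<langle>x, y\<rangle>\<bar> \<le> K * \<parallel>x\<parallel> * norm (M y)" for x y
  proof (cases "x = 0")
    case False
    then have pos: "0 < \<parallel>x\<parallel>" using nm_nonneg[of x] nm_eq_0_iff[of x] by linarith
    define t where "t = r / (2 * \<parallel>x\<parallel>)"
    have t: "0 < t" using r pos by (simp add: t_def)
    have "\<parallel>t *\<^sub>R x\<parallel> < r" using r pos by (simp add: nm_scaleR t_def)
    then have "\<parallel>x0 - (x0 + t *\<^sub>R x)\<parallel> < r" by (simp add: nm_minus)
    then have "\<bar>\<langle>x0 + t *\<^sub>R x, y\<rangle>\<bar> \<le> real n * norm (M y)" "\<bar>\<langle>x0, y\<rangle>\<bar> \<le> real n * norm (M y)"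
      using r by (auto intro!: F)
    then have "\<bar>t * \<langle>x, y\<rangle>\<bar> \<le> 2 * (real n * norm (M y))" by (simp add: ip_simps)
    also have "\<dots> \<le> 2 * ((real n + 1) * norm (M y))" by (simp add: mult_right_mono)
    finally have "t * \<bar>\<langle>x, y\<rangle>\<bar> \<le> 2 * ((real n + 1) * norm (M y))" using t by (simp add: abs_mult)
    also have "\<dots> = t * (K * \<parallel>x\<parallel> * norm (M y))"
      using pos r False by (simp add: t_def K_def)
    finally show ?thesis using t by simp
  qed (simp add: ip_simps)
  have "norm x \<le> K * \<parallel>x\<parallel>" for x
  proof -
    have "x \<in> closure (range M)" by (simp add: closure_range_M)
    then obtain X where X: "\<And>k. X k \<in> range M" "X \<longlonglongrightarrow> x"
      unfolding closure_sequential by blast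
    have "(norm x)\<^sup>2 \<le> K * \<parallel>x\<parallel> * norm x"
      unfolding power2_norm_eq_inner
    proof (rule LIMSEQ_le)
      show "(\<lambda>k. x \<bullet> X k) \<longlonglongrightarrow> x \<bullet> x" by (intro tendsto_intros X)
      show "(\<lambda>k. K * \<parallel>x\<parallel> * norm (X k)) \<longlonglongrightarrow> K * \<parallel>x\<parallel> * norm x" by (intro tendsto_intros X)
      have "x \<bullet> X k \<le> K * \<parallel>x\<parallel> * norm (X k)" for k
      proof -
        obtain y where "X k = M y" using X(1)[of k] by blast
        then show ?thesis using bnd[of x y] by (simp add: inner_M_def)
      qed
      then show "\<exists>N. \<forall>k\<ge>N. x \<bullet> X k \<le> K * \<parallel>x\<parallel> * norm (X k)" by blast
    qed
    then show ?thesis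
      using K by (cases "x = 0") (auto simp: power2_eq_square mult_le_cancel_right)
  qed
  then show ?thesis using K by blast
qed

lemma nm_tendsto_imp_norm_tendsto:
  assumes "(\<lambda>k. \<parallel>X k - l\<parallel>) \<longlonglongrightarrow> 0" shows "X \<longlonglongrightarrow> l"
proof -
  obtain K where K: "0 < K" "\<And>x. norm x \<le> K * \<parallel>x\<parallel>" using norm_le_nm by blast
  have "(\<lambda>k. K * \<parallel>X k - l\<parallel>) \<longlonglongrightarrow> 0"
    by (rule tendsto_mult_right_zero[OF assms])
  then have "(\<lambda>k. X k - l) \<longlonglongrightarrow> 0"
    by (rule Lim_null_comparison[rotated]) (use K in auto)
  then show ?thesis by (simp add: LIM_zero_iff)
qed

section \<open>The infimal displacement vector\<close>

text \<open>
  Here \<open>u\<close> is the displacement vector of the scaled operator \<open>S = \<theta>\<^bsup>-1\<^esup>(Id - T)\<close>.  Besides \<open>u\<close>, the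
  convergence proof uses the variational inequality and the points at which \<open>S\<close> comes close to \<open>u\<close>.
\<close>

theorem inf_displacement_props:
  assumes C: "nonexpansive_M M C" and S: "\<And>x. S x = x - C x"
    and \<theta>: "0 < \<theta>" and T: "\<And>x. T x = x - \<theta> *\<^sub>R S x"
  obtains u z where "inf_displacement M T = \<theta> *\<^sub>R u" "(\<lambda>n. \<parallel>S (z n) - u\<parallel>) \<longlonglongrightarrow> 0"
    "\<And>x. \<parallel>u\<parallel>\<^sup>2 \<le> \<langle>u, S x\<rangle>"
proof -
  obtain u z where z: "(\<lambda>n. \<parallel>S (z n) - u\<parallel>) \<longlonglongrightarrow> 0" and u: "\<And>x. \<parallel>u\<parallel>\<^sup>2 \<le> \<langle>u, S x\<rangle>"
    using minimal_range_element[OF C S] by blast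
  let ?R = "closure (range (\<lambda>x. x - T x))"
  have R: "(\<lambda>x. x - T x) = (\<lambda>x. \<theta> *\<^sub>R S x)" by (simp add: T)
  have mem: "\<theta> *\<^sub>R u \<in> ?R"
  proof -
    have "(\<lambda>n. \<theta> *\<^sub>R S (z n)) \<longlonglongrightarrow> \<theta> *\<^sub>R u"
      by (intro tendsto_intros nm_tendsto_imp_norm_tendsto z)
    then show ?thesis unfolding closure_sequential R by (intro exI[of _ "\<lambda>n. \<theta> *\<^sub>R S (z n)"]) auto
  qed
  have ge: "\<parallel>\<theta> *\<^sub>R u\<parallel>\<^sup>2 \<le> \<langle>\<theta> *\<^sub>R u, w\<rangle>" if w: "w \<in> ?R" for w
  proof -
    obtain X where X: "\<forall>k. X k \<in> range (\<lambda>x. \<theta> *\<^sub>R S x)" "X \<longlonglongrightarrow> w"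
      using w unfolding closure_sequential R by blast
    show ?thesis
    proof (rule LIMSEQ_le_const)
      show "(\<lambda>k. \<langle>\<theta> *\<^sub>R u, X k\<rangle>) \<longlonglongrightarrow> \<langle>\<theta> *\<^sub>R u, w\<rangle>"
        unfolding inner_M_def
        by (intro tendsto_intros bounded_linear.tendsto[OF bounded_linear_M] X)
      have "\<parallel>\<theta> *\<^sub>R u\<parallel>\<^sup>2 \<le> \<langle>\<theta> *\<^sub>R u, X k\<rangle>" for k
      proof -
        obtain y where "X k = \<theta> *\<^sub>R S y" using X(1) by blast
        then show ?thesis
          using u[of y] \<theta> by (simp add: nm_scaleR ip_simps power_mult_distrib power2_eq_square)
      qed
      then show "\<exists>N. \<forall>k\<ge>N. \<parallel>\<theta> *\<^sub>R u\<parallel>\<^sup>2 \<le> \<langle>\<theta> *\<^sub>R u, X k\<rangle>" by blast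
    qed
  qed
  have "inf_displacement M T = \<theta> *\<^sub>R u"
    unfolding inf_displacement_def
  proof (rule the_equality)
    have "\<parallel>\<theta> *\<^sub>R u\<parallel> \<le> \<parallel>w\<parallel>" if "w \<in> ?R" for w
    proof (cases "\<theta> *\<^sub>R u = 0")
      case False
      then have "0 < \<parallel>\<theta> *\<^sub>R u\<parallel>" using nm_nonneg nm_eq_0_iff order_less_le by metis
      moreover have "\<parallel>\<theta> *\<^sub>R u\<parallel> * \<parallel>\<theta> *\<^sub>R u\<parallel> \<le> \<parallel>\<theta> *\<^sub>R u\<parallel> * \<parallel>w\<parallel>"
        using order_trans[OF ge[OF that] ip_le'] by (simp add: power2_eq_square)
      ultimately show ?thesis by simp
    next
      case True
      show ?thesis unfolding True by simp
    qed
    then show "\<theta> *\<^sub>R u \<in> ?R \<and> (\<forall>w\<in>?R. \<parallel>\<theta> *\<^sub>R u\<parallel> \<le> \<parallel>w\<parallel>)" using mem by blast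
  next
    fix w assume w: "w \<in> ?R \<and> (\<forall>w'\<in>?R. \<parallel>w\<parallel> \<le> \<parallel>w'\<parallel>)"
    then have "\<parallel>w\<parallel>\<^sup>2 \<le> \<parallel>\<theta> *\<^sub>R u\<parallel>\<^sup>2" using mem by (intro power_mono) auto
    then have "\<parallel>w - \<theta> *\<^sub>R u\<parallel>\<^sup>2 \<le> 0"
      unfolding nm_square_diff using ge[of w] w ip_commute[of w "\<theta> *\<^sub>R u"] by linarith
    then have "\<parallel>w - \<theta> *\<^sub>R u\<parallel> = 0" by simp
    then show "w = \<theta> *\<^sub>R u" unfolding nm_eq_0_iff by simp
  qed
  then show thesis using that z u by blast
qed

end

section \<open>Real sequences with controlled increments\<close>

lemma square_less_self: "0 < a \<Longrightarrow> a < 1 \<Longrightarrow> a\<^sup>2 < a" for a :: real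
  using mult_strict_left_mono[of a 1 a] by (simp add: power2_eq_square)

lemma young: "2 * (p * q) \<le> s * p\<^sup>2 + q\<^sup>2 / s" if "0 < s" for p q s :: real
proof -
  have "0 \<le> (s * p - q)\<^sup>2 / s" using that by simp
  also have "\<dots> = s * p\<^sup>2 + q\<^sup>2 / s - 2 * (p * q)"
    using that by (simp add: field_simps power2_eq_square)
  finally show ?thesis by simp
qed

lemma eventually_le_linear:
  fixes f h :: "nat \<Rightarrow> real"
  assumes step: "\<And>k. f (Suc k) \<le> f k + h k" and h: "h \<longlonglongrightarrow> L" and \<eta>: "0 < \<eta>"
  shows "\<forall>\<^sub>F k in sequentially. f k \<le> (L + \<eta>) * real k"
proof -
  have "\<forall>\<^sub>F k in sequentially. h k < L + \<eta> / 2"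
    using h \<eta> by (intro order_tendstoD) auto
  then obtain J where J: "\<And>k. J \<le> k \<Longrightarrow> h k < L + \<eta> / 2"
    unfolding eventually_sequentially by blast
  have bound: "f k \<le> f J + (L + \<eta> / 2) * (real k - real J)" if "J \<le> k" for k
    using that
  proof (induction k rule: dec_induct)
    case (step k)
    then show ?case using assms(1)[of k] J[of k] by (simp add: field_simps)
  qed simp
  define N where "N = max J (nat \<lceil>(f J - (L + \<eta> / 2) * real J) / (\<eta> / 2)\<rceil>)"
  have "f k \<le> (L + \<eta>) * real k" if k: "N \<le> k" for k
  proof -
    have "(f J - (L + \<eta> / 2) * real J) / (\<eta> / 2) \<le> real k"
      using k unfolding N_def by (meson max.boundedE nat_ceiling_le_eq)
    then have "f J - (L + \<eta> / 2) * real J \<le> \<eta> / 2 * real k"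
      using \<eta> by (simp add: field_simps)
    moreover have "f k \<le> f J + ((L + \<eta> / 2) * real k - (L + \<eta> / 2) * real J)"
      using bound[of k] k unfolding N_def by (simp add: right_diff_distrib)
    moreover have "(L + \<eta>) * real k = (L + \<eta> / 2) * real k + \<eta> / 2 * real k"
      by (simp add: algebra_simps)
    ultimately show ?thesis by linarith
  qed
  then show ?thesis unfolding eventually_sequentially by blast
qed

text \<open>
  In the application \<open>d k\<close> is a mean squared distance and \<open>f k\<close> differs from it by a cross term of
  order \<open>sqrt (d k)\<close>.  If \<open>f\<close> grows in each step by \<open>o(sqrt d)\<close> and a constant, then comparison with the
  square of \<open>q k = \<eta> k + A\<close>, whose increments are of order \<open>\<eta> (\<eta> k + A)\<close>, shows \<open>sqrt (d k) \<le> \<eta> k + A\<close> for every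
  slope \<open>\<eta>\<close>, with \<open>A\<close> depending on \<open>\<eta>\<close>.
\<close>

lemma sqrt_sublinear:
  fixes d f e :: "nat \<Rightarrow> real"
  assumes d: "\<And>k. 0 \<le> d k" and c: "0 \<le> c" and N: "0 \<le> N"
    and near: "\<And>k. d k - c * sqrt (d k) \<le> f k"
    and step: "\<And>k. f (Suc k) \<le> f k + e k * sqrt (d k) + N"
    and e: "e \<longlonglongrightarrow> 0"
  shows "(\<lambda>k. sqrt (d k) / real k) \<longlonglongrightarrow> 0"
proof -
  have linear: "\<exists>A J. \<forall>k\<ge>J. sqrt (d k) \<le> \<eta> * real k + A" if \<eta>: "0 < \<eta>" for \<eta>
  proof -
    have "\<forall>\<^sub>F k in sequentially. e k < \<eta>"
      using e \<eta> by (intro order_tendstoD) auto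
    then obtain J where J: "\<And>k. J \<le> k \<Longrightarrow> e k < \<eta>"
      unfolding eventually_sequentially by blast
    \<comment> \<open>\<open>A\<close> exceeds \<open>c\<close> to make \<open>r\<^sup>2 - c r\<close> increasing beyond it, absorbs \<open>N\<close>, and starts the induction at \<open>J\<close>.\<close>
    define A where "A = c + N / \<eta> + \<bar>f J\<bar> + 1"
    have N\<eta>: "0 \<le> N / \<eta>" using N \<eta> by simp
    have A1: "c + 1 \<le> A" "0 < A" "\<bar>f J\<bar> \<le> A"
      using c N\<eta> unfolding A_def by linarith+
    have "\<eta> * (c + N / \<eta>) \<le> \<eta> * A"
      using \<eta> unfolding A_def by (intro mult_left_mono) auto
    then have AN: "\<eta> * c + N \<le> \<eta> * A" using \<eta> by (simp add: algebra_simps)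
    define q where "q k = \<eta> * real k + A" for k
    have qA: "A \<le> q k" for k using \<eta> by (simp add: q_def)
    have sqrt_le: "sqrt (d k) \<le> q k" if le: "f k \<le> (q k)\<^sup>2 - c * q k" for k
    proof (rule ccontr)
      assume "\<not> ?thesis"
      then have "0 < (sqrt (d k) - q k) * (sqrt (d k) + q k - c)"
        using qA[of k] A1 c by (intro mult_pos_pos) auto
      also have "\<dots> = d k - c * sqrt (d k) - ((q k)\<^sup>2 - c * q k)"
        using d[of k] by (simp add: algebra_simps power2_eq_square)
      finally show False using near[of k] le by linarith
    qed
    have bound: "f k \<le> (q k)\<^sup>2 - c * q k" if "J \<le> k" for k
      using that
    proof (induction k rule: dec_induct)
      case base
      have "\<bar>f J\<bar> * 1 \<le> q J * (q J - c)"
        using qA[of J] A1 by (intro mult_mono) linarith+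
      then show ?case by (simp add: algebra_simps power2_eq_square)
    next
      case (step k)
      have "e k * sqrt (d k) \<le> \<eta> * q k"
        using J[of k] step \<eta> sqrt_le d[of k] by (intro mult_mono) auto
      moreover have "\<eta> * c + N \<le> \<eta> * q k"
        using AN qA[of k] \<eta> by (auto intro: order_trans mult_left_mono)
      moreover have "(q (Suc k))\<^sup>2 - c * q (Suc k)
          = (q k)\<^sup>2 - c * q k + 2 * (\<eta> * q k) + \<eta>\<^sup>2 - \<eta> * c"
        by (simp add: q_def algebra_simps power2_eq_square)
      moreover have "0 \<le> \<eta>\<^sup>2" by simp
      ultimately show ?case using assms(5)[of k] step.IH by linarith
    qed
    show ?thesis using sqrt_le bound unfolding q_def by blast
  qed
  show ?thesis
  proof (rule LIMSEQ_I)
    fix r :: real assume r: "0 < r"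
    obtain A J where AJ: "\<And>k. J \<le> k \<Longrightarrow> sqrt (d k) \<le> (r / 2) * real k + A"
      using linear[of "r / 2"] r by auto
    define K where "K = Max {J, 1, nat \<lceil>2 * A / r\<rceil> + 1}"
    have "norm (sqrt (d k) / real k - 0) < r" if k: "K \<le> k" for k
    proof -
      have "J \<le> k" "1 \<le> k" "nat \<lceil>2 * A / r\<rceil> + 1 \<le> k" using k by (auto simp: K_def)
      then have "2 * A / r < real k" by linarith
      then have "A < (r / 2) * real k" using r by (simp add: field_simps)
      then have "sqrt (d k) < r * real k" using AJ[of k] \<open>J \<le> k\<close> by simp
      then show ?thesis using \<open>1 \<le> k\<close> d[of k] by (simp add: field_simps)
    qed
    then show "\<exists>K. \<forall>k\<ge>K. norm (sqrt (d k) / real k - 0) < r" by blast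
  qed
qed

lemma eventually_le_linear_perturbed:
  fixes d f h :: "nat \<Rightarrow> real"
  assumes near: "\<And>k. d k - c * sqrt (d k) \<le> f k"
    and step: "\<And>k. f (Suc k) \<le> f k + h k" and h: "h \<longlonglongrightarrow> L"
    and sub: "(\<lambda>k. sqrt (d k) / real k) \<longlonglongrightarrow> 0" and \<eta>: "0 < \<eta>"
  shows "\<forall>\<^sub>F k in sequentially. d k \<le> (L + \<eta>) * real k"
proof -
  have "(\<lambda>k. c * (sqrt (d k) / real k)) \<longlonglongrightarrow> 0"
    by (rule tendsto_mult_right_zero[OF sub])
  then have "\<forall>\<^sub>F k in sequentially. c * (sqrt (d k) / real k) < \<eta> / 2"
    using \<eta> by (intro order_tendstoD) auto
  moreover have "\<forall>\<^sub>F k in sequentially. f k \<le> (L + \<eta> / 2) * real k"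
    using eventually_le_linear[OF step h, of "\<eta> / 2"] \<eta> by simp
  ultimately show ?thesis
    using eventually_gt_at_top[of 0]
  proof eventually_elim
    case (elim k)
    then have "c * sqrt (d k) < \<eta> / 2 * real k" by (simp add: field_simps)
    then show ?case using near[of k] elim(2) by (simp add: algebra_simps)
  qed
qed

lemma descent_le_linear:
  fixes d p :: "nat \<Rightarrow> real"
  assumes step: "\<And>k. d (Suc k) \<le> d k - p k + C" and p: "\<And>k. 0 \<le> p k"
  shows "d k \<le> d 0 + C * real k"
proof (induction k)
  case (Suc k)
  then show ?case using step[of k] p[of k] by (simp add: algebra_simps)
qed simp

text \<open>
  Summing the descent inequality itself only bounds averages of \<open>p\<close>, because of the constant \<open>C\<close>.
  Multiplied by summable decreasing weights it telescopes with a convergent error.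
\<close>

lemma descent_weighted_summable:
  fixes d p w :: "nat \<Rightarrow> real"
  assumes d: "\<And>k. 0 \<le> d k" and p: "\<And>k. 0 \<le> p k"
    and step: "\<And>k. d (Suc k) \<le> d k - p k + C" and C: "0 \<le> C"
    and w: "\<And>k. 0 \<le> w k" "decseq w" "summable w"
  shows "summable (\<lambda>k. w k * p k)"
proof (rule summableI_nonneg_bounded)
  show "0 \<le> w k * p k" for k using w p by simp
  have *: "(\<Sum>j<k. w j * p j) + w k * d k \<le> w 0 * d 0 + C * (\<Sum>j<k. w j)" for k
  proof (induction k)
    case (Suc k)
    have "w (Suc k) * d (Suc k) \<le> w k * d (Suc k)"
      using w d by (intro mult_right_mono) (auto simp: decseq_Suc_iff)
    also have "\<dots> \<le> w k * (d k - p k + C)"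
      using w step by (intro mult_left_mono) auto
    finally show ?case using Suc by (simp add: algebra_simps)
  qed simp
  show "(\<Sum>j<k. w j * p j) \<le> w 0 * d 0 + C * suminf w" for k
  proof -
    have "(\<Sum>j<k. w j) \<le> suminf w" using w by (intro sum_le_suminf) auto
    then have "C * (\<Sum>j<k. w j) \<le> C * suminf w" using C by (rule mult_left_mono)
    moreover have "0 \<le> w k * d k" using w d by simp
    ultimately show ?thesis using *[of k] by linarith
  qed
qed

lemma filterlim_floor_sqrt: "filterlim floor_sqrt at_top at_top"
  unfolding filterlim_at_top
proof
  fix Z :: nat
  have "Z \<le> floor_sqrt k" if "Z\<^sup>2 \<le> k" for k
    using monoD[OF mono_floor_sqrt that] by simp
  then show "\<forall>\<^sub>F k in at_top. Z \<le> floor_sqrt k"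
    unfolding eventually_at_top_linorder by blast
qed

text \<open>
  This passes from the subsequence of squares to all indices.  For \<open>n\<^sup>2 \<le> k < (n+1)\<^sup>2\<close> there are at most \<open>2 n\<close>
  steps from \<open>n\<^sup>2\<close> to \<open>k\<close>.  By Cauchy-Schwarz their total length is at most \<open>sqrt (2 n \<Sum> s\<^sub>j\<^sup>2)\<close>, and since the
  weights are at least \<open>(n+1)\<^bsup>-3\<^esup>\<close> on this block, that is \<open>n\<^sup>2\<close> times the square root of a block of a
  convergent series, hence \<open>o(n\<^sup>2)\<close>.
\<close>

lemma sublinear_from_squares:
  fixes \<delta> s :: "nat \<Rightarrow> real"
  assumes \<delta>: "\<And>k. 0 \<le> \<delta> k" and s: "\<And>k. 0 \<le> s k" and K: "0 \<le> K" and N: "0 \<le> N"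
    and step: "\<And>k. \<delta> (Suc k) \<le> \<delta> k + K * (s k + N)"
    and sum: "summable (\<lambda>k. real (Suc k) powr (-3/2) * (s k)\<^sup>2)"
    and squares: "(\<lambda>n. \<delta> (n\<^sup>2) / real (n\<^sup>2)) \<longlonglongrightarrow> 0"
  shows "(\<lambda>k. \<delta> k / real k) \<longlonglongrightarrow> 0"
proof -
  define a where "a k = real (Suc k) powr (-3/2) * (s k)\<^sup>2" for k
  have a: "0 \<le> a k" for k by (simp add: a_def)
  define \<tau> where "\<tau> n = (\<Sum>j\<in>{n\<^sup>2..<(Suc n)\<^sup>2}. a j)" for n
  define G where "G n = \<delta> (n\<^sup>2) / real (n\<^sup>2) + 2 * K * N * (1 / real n) + 4 * K * sqrt (\<tau> n)" for n
  have "\<tau> \<longlonglongrightarrow> 0"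
  proof -
    have sq: "filterlim (\<lambda>n::nat. n\<^sup>2) at_top at_top"
      unfolding filterlim_at_top eventually_at_top_linorder
      by (metis dual_order.trans power2_nat_le_imp_le self_le_power zero_less_numeral le_square power2_eq_square)
    have S: "(\<lambda>n. \<Sum>j<n. a j) \<longlonglongrightarrow> suminf a"
      using sum unfolding a_def by (rule summable_LIMSEQ)
    have S1: "(\<lambda>n. \<Sum>j<n\<^sup>2. a j) \<longlonglongrightarrow> suminf a"
      by (rule filterlim_compose[OF S sq])
    have S2: "(\<lambda>n. \<Sum>j<(Suc n)\<^sup>2. a j) \<longlonglongrightarrow> suminf a"
      using S1 by (rule LIMSEQ_Suc)
    have "\<tau> n = (\<Sum>j<(Suc n)\<^sup>2. a j) - (\<Sum>j<n\<^sup>2. a j)" for n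
      unfolding \<tau>_def by (subst sum_diff[symmetric]) (auto intro!: sum.cong simp: power2_eq_square)
    then have "\<tau> = (\<lambda>n. (\<Sum>j<(Suc n)\<^sup>2. a j) - (\<Sum>j<n\<^sup>2. a j))" by (rule ext)
    then show ?thesis using tendsto_diff[OF S2 S1] by simp
  qed
  then have "(\<lambda>n. sqrt (\<tau> n)) \<longlonglongrightarrow> 0"
    using tendsto_real_sqrt by fastforce
  then have "G \<longlonglongrightarrow> 0 + 2 * K * N * 0 + 4 * K * 0"
    unfolding G_def by (intro tendsto_intros squares lim_1_over_n)
  then have G: "(\<lambda>k. G (floor_sqrt k)) \<longlonglongrightarrow> 0"
    using filterlim_compose[OF _ filterlim_floor_sqrt] by simp
  have walk: "\<delta> k \<le> \<delta> m + K * (\<Sum>j\<in>{m..<k}. s j + N)" if "m \<le> k" for m k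
    using that
  proof (induction k rule: dec_induct)
    case (step k)
    have "\<delta> (Suc k) \<le> \<delta> k + K * (s k + N)" by (rule assms(5))
    also have "\<dots> \<le> \<delta> m + K * (\<Sum>j\<in>{m..<k}. s j + N) + K * (s k + N)"
      using step.IH by simp
    also have "\<dots> = \<delta> m + K * (\<Sum>j\<in>{m..<Suc k}. s j + N)"
      using step by (simp add: algebra_simps)
    finally show ?case .
  qed simp
  have le: "\<delta> k / real k \<le> G (floor_sqrt k)" if k: "1 \<le> k" for k
  proof -
    define n where "n = floor_sqrt k"
    have n1: "n\<^sup>2 \<le> k" and n2: "k < (Suc n)\<^sup>2" and n: "1 \<le> n"
      using k Suc_floor_sqrt_power2_gt[of k] unfolding n_def by (auto simp: Suc_le_eq)
    have pos: "0 < real (n\<^sup>2)" using n by simp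
    have card: "real (card {n\<^sup>2..<k}) \<le> 2 * real n"
      using n2 by (simp add: power2_eq_square)
    have nn: "real n + 1 \<le> 2 * real n" using n by simp
    have sum_sq: "(\<Sum>j\<in>{n\<^sup>2..<k}. (s j)\<^sup>2) \<le> (2 * real n) ^ 3 * \<tau> n"
    proof -
      have "(s j)\<^sup>2 \<le> (2 * real n) ^ 3 * a j" if j: "j \<in> {n\<^sup>2..<k}" for j
      proof -
        have "Suc j \<le> (Suc n)\<^sup>2" using j n2 by simp
        then have le': "real (Suc j) \<le> (real n + 1)\<^sup>2"
          using of_nat_le_iff[where 'a=real, of "Suc j" "(Suc n)\<^sup>2"] by (simp add: add.commute)
        have "real (Suc j) powr (3/2) \<le> ((real n + 1)\<^sup>2) powr (3/2)"
          using le' by (intro powr_mono2) auto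
        also have "\<dots> = (real n + 1) ^ 3"
          by (simp add: powr_powr powr_numeral flip: powr_numeral)
        also have "\<dots> \<le> (2 * real n) ^ 3" using nn by (intro power_mono) auto
        finally have "real (Suc j) powr (3/2) * (real (Suc j) powr (-3/2) * (s j)\<^sup>2)
            \<le> (2 * real n) ^ 3 * a j"
          unfolding a_def by (intro mult_right_mono) auto
        moreover have "real (Suc j) powr (3/2) * (real (Suc j) powr (-3/2) * (s j)\<^sup>2) = (s j)\<^sup>2"
          by (simp add: powr_add[symmetric] flip: mult.assoc)
        ultimately show ?thesis by (simp only:)
      qed
      then have "(\<Sum>j\<in>{n\<^sup>2..<k}. (s j)\<^sup>2) \<le> (2 * real n) ^ 3 * (\<Sum>j\<in>{n\<^sup>2..<k}. a j)"
        unfolding sum_distrib_left by (intro sum_mono) auto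
      also have "\<dots> \<le> (2 * real n) ^ 3 * \<tau> n"
        unfolding \<tau>_def using n2 by (intro mult_left_mono sum_mono2 a) auto
      finally show ?thesis .
    qed
    have \<tau>: "0 \<le> \<tau> n" unfolding \<tau>_def by (intro sum_nonneg a)
    have "(\<Sum>j\<in>{n\<^sup>2..<k}. s j)\<^sup>2 \<le> (\<Sum>j\<in>{n\<^sup>2..<k}. (s j)\<^sup>2) * real (card {n\<^sup>2..<k})"
      by (rule sum_squared_le_sum_of_squares)
    also have "\<dots> \<le> ((2 * real n) ^ 3 * \<tau> n) * (2 * real n)"
      using \<tau> by (intro mult_mono sum_sq card) auto
    also have "\<dots> = (4 * real (n\<^sup>2) * sqrt (\<tau> n))\<^sup>2"
      using \<tau> by (simp add: power_mult_distrib eval_nat_numeral)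
    finally have s_sum: "(\<Sum>j\<in>{n\<^sup>2..<k}. s j) \<le> 4 * real (n\<^sup>2) * sqrt (\<tau> n)"
      by (rule power2_le_imp_le) (use \<tau> in auto)
    have "\<delta> k \<le> \<delta> (n\<^sup>2) + K * ((\<Sum>j\<in>{n\<^sup>2..<k}. s j) + real (card {n\<^sup>2..<k}) * N)"
      using walk[OF n1] by (simp add: sum.distrib)
    also have "\<dots> \<le> \<delta> (n\<^sup>2) + K * (4 * real (n\<^sup>2) * sqrt (\<tau> n) + 2 * real n * N)"
      by (intro add_left_mono mult_left_mono add_mono s_sum mult_right_mono card K N)
    also have "\<dots> = G n * real (n\<^sup>2)"
      using n by (simp add: G_def field_simps power2_eq_square)
    finally have "\<delta> k \<le> G n * real (n\<^sup>2)" .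
    then have "\<delta> k / real (n\<^sup>2) \<le> G n" using pos by (simp add: field_simps)
    moreover have "\<delta> k / real k \<le> \<delta> k / real (n\<^sup>2)"
      using n1 pos k \<delta>[of k] by (intro divide_left_mono mult_pos_pos) auto
    ultimately show ?thesis unfolding n_def by linarith
  qed
  show ?thesis
  proof (rule tendsto_sandwich[OF _ _ tendsto_const G])
    show "\<forall>\<^sub>F k in sequentially. 0 \<le> \<delta> k / real k" using \<delta> by simp
    show "\<forall>\<^sub>F k in sequentially. \<delta> k / real k \<le> G (floor_sqrt k)"
      using eventually_ge_at_top[of 1] by eventually_elim (rule le)
  qed
qed

lemma summable_weights: "summable (\<lambda>k. real (Suc k) powr (-3/2))"
  using summable_real_powr_iff[of "-3/2"] by (subst summable_Suc_iff) simp

lemma decseq_weights: "decseq (\<lambda>k. real (Suc k) powr (-3/2))"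
  unfolding decseq_Suc_iff by (intro allI powr_mono2') auto

section \<open>Uniform limits of simple functions\<close>

text \<open>
  Continuity does not combine well with measurability in spaces that are not separable: sums of
  Borel functions need not be Borel, as the Borel sets of a product can exceed the product
  \<open>\<sigma>\<close>-algebra.  Uniform limits of simple functions form a class that is closed under sums, products with
  scalars and uniformly continuous maps, and whose members are Borel, bounded and integrable.
\<close>

definition unif_simple :: "'s measure \<Rightarrow> ('s \<Rightarrow> 'b::metric_space) \<Rightarrow> bool" where
  "unif_simple N f \<longleftrightarrow>
     (\<forall>e>0. \<exists>s. simple_function N s \<and> (\<forall>\<omega>\<in>space N. dist (f \<omega>) (s \<omega>) < e))"

lemma unif_simple_simple: "simple_function N s \<Longrightarrow> unif_simple N s"
  unfolding unif_simple_def by (metis dist_self)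

lemma unif_simple_const: "unif_simple N (\<lambda>_. c)"
  by (rule unif_simple_simple) simp

lemma unif_simple_sequence:
  assumes "unif_simple N f"
  obtains s where "\<And>n. simple_function N (s n)"
    "\<And>n \<omega>. \<omega> \<in> space N \<Longrightarrow> dist (f \<omega>) (s n \<omega>) < 1 / real (Suc n)"
proof -
  have "\<exists>s. simple_function N s \<and> (\<forall>\<omega>\<in>space N. dist (f \<omega>) (s \<omega>) < 1 / real (Suc n))" for n
    using assms unfolding unif_simple_def by simp
  then show thesis using that by metis
qed

lemma unif_simple_uniformly_continuous:
  assumes f: "unif_simple N f" and g: "uniformly_continuous_on UNIV g"
  shows "unif_simple N (\<lambda>\<omega>. g (f \<omega>))"
  unfolding unif_simple_def
proof (intro allI impI)
  fix e :: real assume "0 < e"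
  then obtain d where d: "0 < d" "\<And>x y. dist x y < d \<Longrightarrow> dist (g x) (g y) < e"
    using g unfolding uniformly_continuous_on_def by (metis UNIV_I dist_commute)
  obtain s where "simple_function N s" "\<forall>\<omega>\<in>space N. dist (f \<omega>) (s \<omega>) < d"
    using f d(1) unfolding unif_simple_def by blast
  then show "\<exists>s. simple_function N s \<and> (\<forall>\<omega>\<in>space N. dist (g (f \<omega>)) (s \<omega>) < e)"
    using d(2) by (intro exI[of _ "\<lambda>\<omega>. g (s \<omega>)"]) (auto intro: simple_function_compose1)
qed

lemma unif_simple_Pair:
  assumes f: "unif_simple N f" and g: "unif_simple N g"
  shows "unif_simple N (\<lambda>\<omega>. (f \<omega>, g \<omega>))"
  unfolding unif_simple_def
proof (intro allI impI)
  fix e :: real assume "0 < e"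
  then have "0 < e / 2" by simp
  obtain s where s: "simple_function N s" "\<forall>\<omega>\<in>space N. dist (f \<omega>) (s \<omega>) < e / 2"
    using f \<open>0 < e / 2\<close> unfolding unif_simple_def by blast
  obtain t where t: "simple_function N t" "\<forall>\<omega>\<in>space N. dist (g \<omega>) (t \<omega>) < e / 2"
    using g \<open>0 < e / 2\<close> unfolding unif_simple_def by blast
  have "dist (f \<omega>, g \<omega>) (s \<omega>, t \<omega>) < e" if "\<omega> \<in> space N" for \<omega>
  proof -
    have "dist (f \<omega>, g \<omega>) (s \<omega>, t \<omega>) \<le> \<bar>dist (f \<omega>) (s \<omega>)\<bar> + \<bar>dist (g \<omega>) (t \<omega>)\<bar>"
      unfolding dist_Pair_Pair by (rule sqrt_sum_squares_le_sum_abs)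
    then show ?thesis using s(2) t(2) that by fastforce
  qed
  then show "\<exists>r. simple_function N r \<and> (\<forall>\<omega>\<in>space N. dist (f \<omega>, g \<omega>) (r \<omega>) < e)"
    using s(1) t(1) by (intro exI[of _ "\<lambda>\<omega>. (s \<omega>, t \<omega>)"]) auto
qed

lemma unif_simple_add:
  fixes f g :: "'s \<Rightarrow> 'b::real_normed_vector"
  assumes "unif_simple N f" "unif_simple N g"
  shows "unif_simple N (\<lambda>\<omega>. f \<omega> + g \<omega>)"
proof -
  have "uniformly_continuous_on UNIV (\<lambda>p :: 'b \<times> 'b. fst p + snd p)"
    by (intro uniformly_continuous_on_add
        bounded_linear.uniformly_continuous_on[OF bounded_linear_fst]
        bounded_linear.uniformly_continuous_on[OF bounded_linear_snd] uniformly_continuous_on_id)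
  from unif_simple_uniformly_continuous[OF unif_simple_Pair[OF assms] this] show ?thesis by simp
qed

lemma unif_simple_bounded_linear:
  assumes "unif_simple N f" "bounded_linear g"
  shows "unif_simple N (\<lambda>\<omega>. g (f \<omega>))"
  by (rule unif_simple_uniformly_continuous[OF assms(1)])
     (intro bounded_linear.uniformly_continuous_on[OF assms(2)] uniformly_continuous_on_id)

lemma unif_simple_diff:
  fixes f g :: "'s \<Rightarrow> 'b::real_normed_vector"
  assumes "unif_simple N f" "unif_simple N g"
  shows "unif_simple N (\<lambda>\<omega>. f \<omega> - g \<omega>)"
  using unif_simple_add[OF assms(1) unif_simple_bounded_linear[OF assms(2)
      bounded_linear_minus[OF bounded_linear_ident]]] by simp

lemma unif_simple_sum:
  fixes f :: "'i \<Rightarrow> 's \<Rightarrow> 'b::real_normed_vector"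
  assumes "\<And>i. i \<in> I \<Longrightarrow> unif_simple N (f i)"
  shows "unif_simple N (\<lambda>\<omega>. \<Sum>i\<in>I. f i \<omega>)"
  using assms
  by (induction I rule: infinite_finite_induct) (auto intro: unif_simple_const unif_simple_add)

lemma unif_simple_norm_bounded:
  fixes f :: "'s \<Rightarrow> 'b::real_normed_vector"
  assumes "unif_simple N f"
  obtains B where "0 < B" "\<And>\<omega>. \<omega> \<in> space N \<Longrightarrow> norm (f \<omega>) \<le> B"
proof -
  obtain s where s: "simple_function N s" "\<forall>\<omega>\<in>space N. dist (f \<omega>) (s \<omega>) < 1"
    using assms unfolding unif_simple_def by (meson zero_less_one)
  define B where "B = Max (norm ` s ` space N)"
  have B: "norm (s \<omega>) \<le> B" if "\<omega> \<in> space N" for \<omega>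
    unfolding B_def using simple_functionD(1)[OF s(1)] that by (intro Max_ge) auto
  have "norm (f \<omega>) \<le> \<bar>B\<bar> + 1" if "\<omega> \<in> space N" for \<omega>
    using B[OF that] s(2) that norm_triangle_sub[of "f \<omega>" "s \<omega>"] by (fastforce simp: dist_norm)
  then show thesis using that[of "\<bar>B\<bar> + 1"] by auto
qed

lemma unif_simple_scaleR:
  fixes f :: "'s \<Rightarrow> 'b::real_normed_vector"
  assumes c: "unif_simple N c" and f: "unif_simple N f"
  shows "unif_simple N (\<lambda>\<omega>. c \<omega> *\<^sub>R f \<omega>)"
  unfolding unif_simple_def
proof (intro allI impI)
  fix e :: real assume e: "0 < e"
  obtain A where A: "0 < A" "\<And>\<omega>. \<omega> \<in> space N \<Longrightarrow> norm (c \<omega>) \<le> A"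
    using unif_simple_norm_bounded[OF c] by blast
  have "0 < e / (2 * A)" using e A by simp
  then obtain s where s: "simple_function N s" "\<forall>\<omega>\<in>space N. dist (f \<omega>) (s \<omega>) < e / (2 * A)"
    using f unfolding unif_simple_def by blast
  obtain B where B: "0 < B" "\<And>\<omega>. \<omega> \<in> space N \<Longrightarrow> norm (s \<omega>) \<le> B"
    using unif_simple_norm_bounded[OF unif_simple_simple[OF s(1)]] by blast
  have "0 < e / (2 * B)" using e B by simp
  then obtain t where t: "simple_function N t" "\<forall>\<omega>\<in>space N. dist (c \<omega>) (t \<omega>) < e / (2 * B)"
    using c unfolding unif_simple_def by blast
  have "dist (c \<omega> *\<^sub>R f \<omega>) (t \<omega> *\<^sub>R s \<omega>) < e" if \<omega>: "\<omega> \<in> space N" for \<omega>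
  proof -
    have "c \<omega> *\<^sub>R f \<omega> - t \<omega> *\<^sub>R s \<omega> = c \<omega> *\<^sub>R (f \<omega> - s \<omega>) + (c \<omega> - t \<omega>) *\<^sub>R s \<omega>"
      by (simp add: algebra_simps)
    then have "norm (c \<omega> *\<^sub>R f \<omega> - t \<omega> *\<^sub>R s \<omega>)
        \<le> norm (c \<omega>) * norm (f \<omega> - s \<omega>) + norm (c \<omega> - t \<omega>) * norm (s \<omega>)"
      using norm_triangle_ineq[of "c \<omega> *\<^sub>R (f \<omega> - s \<omega>)" "(c \<omega> - t \<omega>) *\<^sub>R s \<omega>"] by simp
    also have "\<dots> < A * (e / (2 * A)) + (e / (2 * B)) * B"
    proof (rule add_le_less_mono)
      show "norm (c \<omega>) * norm (f \<omega> - s \<omega>) \<le> A * (e / (2 * A))"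
        using A s(2) \<omega> by (intro mult_mono) (auto simp: dist_norm intro: less_imp_le)
      have "norm (c \<omega> - t \<omega>) * norm (s \<omega>) \<le> norm (c \<omega> - t \<omega>) * B"
        using B \<omega> by (intro mult_left_mono) auto
      also have "\<dots> < (e / (2 * B)) * B"
        using t(2) \<omega> B by (intro mult_strict_right_mono) (auto simp: dist_norm)
      finally show "norm (c \<omega> - t \<omega>) * norm (s \<omega>) < (e / (2 * B)) * B" .
    qed
    also have "\<dots> = e" using A B by simp
    finally show ?thesis by (simp add: dist_norm)
  qed
  moreover have "simple_function N (\<lambda>\<omega>. t \<omega> *\<^sub>R s \<omega>)"
    using t(1) s(1) by (rule simple_function_compose2)
  ultimately show "\<exists>r. simple_function N r \<and> (\<forall>\<omega>\<in>space N. dist (c \<omega> *\<^sub>R f \<omega>) (r \<omega>) < e)"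
    by (intro exI[of _ "\<lambda>\<omega>. t \<omega> *\<^sub>R s \<omega>"] conjI ballI)
qed

text \<open>
  Rounding down to multiples of \<open>1/n\<close> gives the simple approximations.
\<close>

lemma unif_simple_unit_interval:
  fixes f :: "'s \<Rightarrow> real"
  assumes f: "f \<in> borel_measurable N" and range: "\<And>\<omega>. \<omega> \<in> space N \<Longrightarrow> 0 \<le> f \<omega> \<and> f \<omega> \<le> 1"
  shows "unif_simple N f"
  unfolding unif_simple_def
proof (intro allI impI)
  fix e :: real assume "0 < e"
  then obtain m where m: "1 / real (Suc m) < e"
    using reals_Archimedean[of e] by (auto simp: inverse_eq_divide)
  define n where "n = Suc m"
  have n: "n \<noteq> 0" "1 / real n < e" using m by (auto simp: n_def)
  define s where "s \<omega> = real_of_int \<lfloor>f \<omega> * real n\<rfloor> / real n" for \<omega>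
  have "simple_function N s"
  proof (rule simple_function_borel_measurable)
    show "s \<in> borel_measurable N" unfolding s_def using f by measurable
    have "\<lfloor>f \<omega> * real n\<rfloor> \<in> {0..int n}" if "\<omega> \<in> space N" for \<omega>
    proof -
      have "0 \<le> f \<omega> * real n" "f \<omega> * real n \<le> real n"
        using range[OF that] by (auto simp: mult_left_le_one_le)
      then show ?thesis by (auto simp: le_floor_iff floor_le_iff)
    qed
    then have "s ` space N \<subseteq> (\<lambda>j. real_of_int j / real n) ` {0..int n}"
      unfolding s_def by blast
    then show "finite (s ` space N)" by (rule finite_subset) simp
  qed
  moreover have "dist (f \<omega>) (s \<omega>) < e" for \<omega>
  proof -
    have "f \<omega> - s \<omega> = (f \<omega> * real n - real_of_int \<lfloor>f \<omega> * real n\<rfloor>) / real n"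
      using n by (simp add: s_def field_simps)
    moreover have "0 \<le> f \<omega> * real n - real_of_int \<lfloor>f \<omega> * real n\<rfloor>"
      "f \<omega> * real n - real_of_int \<lfloor>f \<omega> * real n\<rfloor> \<le> 1" by linarith+
    ultimately have "\<bar>f \<omega> - s \<omega>\<bar> \<le> 1 / real n"
      using n by (simp add: divide_right_mono)
    then show ?thesis using n by (simp add: dist_real_def)
  qed
  ultimately show "\<exists>s. simple_function N s \<and> (\<forall>\<omega>\<in>space N. dist (f \<omega>) (s \<omega>) < e)" by blast
qed

lemma unif_simple_comp:
  assumes "unif_simple N' f" "\<phi> \<in> measurable N N'"
  shows "unif_simple N (\<lambda>\<omega>. f (\<phi> \<omega>))"
  unfolding unif_simple_def
proof (intro allI impI)
  fix e :: real assume "0 < e"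
  then obtain s where "simple_function N' s" "\<forall>\<omega>\<in>space N'. dist (f \<omega>) (s \<omega>) < e"
    using assms(1) unfolding unif_simple_def by blast
  then show "\<exists>s. simple_function N s \<and> (\<forall>\<omega>\<in>space N. dist (f (\<phi> \<omega>)) (s \<omega>) < e)"
    using measurable_space[OF assms(2)] simple_function_comp[OF assms(2)]
    by (intro exI[of _ "\<lambda>\<omega>. s (\<phi> \<omega>)"]) auto
qed

lemma unif_simple_borel_measurable:
  assumes "unif_simple N f" shows "f \<in> borel_measurable N"
proof -
  obtain s where s: "\<And>n. simple_function N (s n)"
    "\<And>n \<omega>. \<omega> \<in> space N \<Longrightarrow> dist (f \<omega>) (s n \<omega>) < 1 / real (Suc n)"
    using unif_simple_sequence[OF assms] by blast
  show ?thesis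
  proof (rule borel_measurable_LIMSEQ_metric)
    show "s n \<in> borel_measurable N" for n using s(1) by (rule borel_measurable_simple_function)
    show "(\<lambda>n. s n \<omega>) \<longlonglongrightarrow> f \<omega>" if "\<omega> \<in> space N" for \<omega>
    proof -
      have lim: "(\<lambda>n. 1 / real (Suc n)) \<longlonglongrightarrow> 0"
        using LIMSEQ_inverse_real_of_nat by (simp add: inverse_eq_divide)
      have le: "norm (dist (s n \<omega>) (f \<omega>)) \<le> 1 / real (Suc n)" for n
        using s(2)[OF that, of n] by (simp add: dist_commute)
      have "(\<lambda>n. dist (s n \<omega>) (f \<omega>)) \<longlonglongrightarrow> 0"
        by (rule Lim_null_comparison[OF always_eventually[OF allI[OF le]] lim])
      then show ?thesis by (subst tendsto_dist_iff)
    qed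
  qed
qed

lemma (in finite_measure) unif_simple_integrable:
  fixes \<phi> :: "'b::real_normed_vector \<Rightarrow> real"
  assumes X: "unif_simple M X" and \<phi>: "continuous_on UNIV \<phi>"
    and bnd: "\<And>B. \<exists>C. \<forall>x. norm x \<le> B \<longrightarrow> \<bar>\<phi> x\<bar> \<le> C"
  shows "integrable M (\<lambda>\<omega>. \<phi> (X \<omega>))"
proof -
  obtain B where B: "\<And>\<omega>. \<omega> \<in> space M \<Longrightarrow> norm (X \<omega>) \<le> B"
    using unif_simple_norm_bounded[OF X] by blast
  obtain C where C: "\<And>x. norm x \<le> B \<Longrightarrow> \<bar>\<phi> x\<bar> \<le> C"
    using bnd by blast
  show ?thesis
  proof (rule integrable_const_bound[where B=C])
    show "AE \<omega> in M. norm (\<phi> (X \<omega>)) \<le> C" using B C by auto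
    show "(\<lambda>\<omega>. \<phi> (X \<omega>)) \<in> borel_measurable M"
      by (rule borel_measurable_continuous_on[OF \<phi> unif_simple_borel_measurable[OF X]])
  qed
qed

section \<open>Expectation of vector-valued random variables\<close>

context prob_space
begin

lemma simple_bochner_integrableI: "simple_function M s \<Longrightarrow> Bochner_Integration.simple_bochner_integrable M s"
  by (intro simple_bochner_integrable.intros) auto

lemma simple_bochner_integral_dist:
  fixes s t :: "'a \<Rightarrow> 'b::real_normed_vector"
  assumes s: "simple_function M s" and t: "simple_function M t"
    and le: "\<And>\<omega>. \<omega> \<in> space M \<Longrightarrow> norm (s \<omega> - t \<omega>) \<le> e"
  shows "norm (Bochner_Integration.simple_bochner_integral M s - Bochner_Integration.simple_bochner_integral M t) \<le> e"
proof -
  have st: "simple_function M (\<lambda>\<omega>. s \<omega> - t \<omega>)" using s t by (rule simple_function_compose2)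
  have n: "Bochner_Integration.simple_bochner_integrable M (\<lambda>\<omega>. norm (s \<omega> - t \<omega>))"
    by (rule simple_bochner_integrableI[OF simple_function_compose1[OF st, where g=norm]])
  have "norm (Bochner_Integration.simple_bochner_integral M s - Bochner_Integration.simple_bochner_integral M t)
      = norm (Bochner_Integration.simple_bochner_integral M (\<lambda>\<omega>. s \<omega> - t \<omega>))"
    using s t by (simp add: simple_bochner_integral_diff simple_bochner_integrableI)
  also have "\<dots> \<le> Bochner_Integration.simple_bochner_integral M (\<lambda>\<omega>. norm (s \<omega> - t \<omega>))"
    by (intro simple_bochner_integral_norm_bound simple_bochner_integrableI st)
  also have "\<dots> = (\<integral>\<omega>. norm (s \<omega> - t \<omega>) \<partial>M)"
    by (rule simple_bochner_integrable_eq_integral[OF n])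
  also have "\<dots> \<le> (\<integral>\<omega>. e \<partial>M)"
    using integrable.intros[OF has_bochner_integral_simple_bochner_integrable[OF n]] le
    by (intro integral_mono) auto
  finally show ?thesis by (simp add: prob_space)
qed

lemma has_expectation_exists:
  fixes X :: "'a \<Rightarrow> 'b::banach"
  assumes X: "unif_simple M X"
  shows "\<exists>e. has_expectation M X e"
proof -
  obtain s where s: "\<And>n. simple_function M (s n)"
    "\<And>n \<omega>. \<omega> \<in> space M \<Longrightarrow> dist (X \<omega>) (s n \<omega>) < 1 / real (Suc n)"
    using unif_simple_sequence[OF X] by blast
  have lim: "(\<lambda>n. 1 / real (Suc n)) \<longlonglongrightarrow> 0"
    using LIMSEQ_inverse_real_of_nat by (simp add: inverse_eq_divide)
  have "Cauchy (\<lambda>n. Bochner_Integration.simple_bochner_integral M (s n))"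
  proof (rule metric_CauchyI)
    fix e :: real assume e: "0 < e"
    then obtain N where N: "\<And>n. N \<le> n \<Longrightarrow> 1 / real (Suc n) < e / 2"
      using order_tendstoD(2)[OF lim, of "e / 2"] unfolding eventually_sequentially by auto
    have "dist (Bochner_Integration.simple_bochner_integral M (s m)) (Bochner_Integration.simple_bochner_integral M (s n)) < e"
      if "N \<le> m" "N \<le> n" for m n
    proof -
      have "norm (s m \<omega> - s n \<omega>) \<le> 1 / real (Suc m) + 1 / real (Suc n)" if "\<omega> \<in> space M" for \<omega>
        using s(2)[OF that, of m] s(2)[OF that, of n] dist_triangle3[of "s m \<omega>" "s n \<omega>" "X \<omega>"]
        unfolding dist_norm[symmetric] by linarith
      then have "norm (Bochner_Integration.simple_bochner_integral M (s m) - Bochner_Integration.simple_bochner_integral M (s n))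
          \<le> 1 / real (Suc m) + 1 / real (Suc n)"
        by (intro simple_bochner_integral_dist s)
      then show ?thesis using N[OF that(1)] N[OF that(2)] unfolding dist_norm by linarith
    qed
    then show "\<exists>N. \<forall>m\<ge>N. \<forall>n\<ge>N.
        dist (Bochner_Integration.simple_bochner_integral M (s m)) (Bochner_Integration.simple_bochner_integral M (s n)) < e" by blast
  qed
  then obtain e where e: "(\<lambda>n. Bochner_Integration.simple_bochner_integral M (s n)) \<longlonglongrightarrow> e"
    using Cauchy_convergent convergentD by blast
  have "(\<lambda>n. \<integral>\<^sup>+\<omega>. norm (X \<omega> - s n \<omega>) \<partial>M) \<longlonglongrightarrow> 0"
  proof (rule tendsto_sandwich[OF _ _ tendsto_const])
    show "(\<lambda>n. ennreal (1 / real (Suc n))) \<longlonglongrightarrow> 0"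
      using lim tendsto_ennrealI by fastforce
    have "(\<integral>\<^sup>+\<omega>. norm (X \<omega> - s n \<omega>) \<partial>M) \<le> (\<integral>\<^sup>+\<omega>. ennreal (1 / real (Suc n)) \<partial>M)" for n
      using s(2) by (intro nn_integral_mono ennreal_leI) (auto simp: dist_norm less_imp_le)
    then show "\<forall>\<^sub>F n in sequentially.
        (\<integral>\<^sup>+\<omega>. norm (X \<omega> - s n \<omega>) \<partial>M) \<le> ennreal (1 / real (Suc n))"
      by (simp add: emeasure_space_1)
  qed auto
  then show ?thesis
    unfolding has_expectation_def
    using unif_simple_borel_measurable[OF X] simple_bochner_integrableI[OF s(1)] e by blast
qed

text \<open>
  An expectation is determined by its images under bounded linear functionals, which are ordinary
  integrals.  This gives uniqueness in \<open>vec_expectation_linear\<close>, and it is the only information about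
  the expectation that the variance estimate needs.
\<close>

lemma has_expectation_linear:
  fixes X :: "'a \<Rightarrow> 'b::real_normed_vector" and l :: "'b \<Rightarrow> real"
  assumes X: "unif_simple M X" and e: "has_expectation M X e" and l: "bounded_linear l"
  shows "l e = (\<integral>\<omega>. l (X \<omega>) \<partial>M)"
proof -
  obtain s where s: "\<And>i. Bochner_Integration.simple_bochner_integrable M (s i)"
    "(\<lambda>i. \<integral>\<^sup>+\<omega>. norm (X \<omega> - s i \<omega>) \<partial>M) \<longlonglongrightarrow> 0"
    "(\<lambda>i. Bochner_Integration.simple_bochner_integral M (s i)) \<longlonglongrightarrow> e"
    using e unfolding has_expectation_def by blast
  obtain K where K: "0 < K" "\<And>x. norm (l x) \<le> norm x * K"
    using bounded_linear.pos_bounded[OF l] by blast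
  have lin: "l (x - y) = l x - l y" for x y
    using l by (simp add: bounded_linear.linear linear_diff)
  have X_meas: "(\<lambda>\<omega>. l (X \<omega>)) \<in> borel_measurable M"
    by (intro unif_simple_borel_measurable unif_simple_bounded_linear[OF X l])
  have sf: "simple_function M (s i)" for i
    using s(1)[of i] by (simp add: simple_bochner_integrable.simps)
  have ls: "Bochner_Integration.simple_bochner_integrable M (\<lambda>\<omega>. l (s i \<omega>))" for i
    by (rule simple_bochner_integrableI[OF simple_function_compose1[OF sf, where g=l]])
  have "has_bochner_integral M (\<lambda>\<omega>. l (X \<omega>)) (l e)"
  proof (rule has_bochner_integral.intros[OF X_meas])
    show "Bochner_Integration.simple_bochner_integrable M (\<lambda>\<omega>. l (s i \<omega>))" for i by (rule ls)
    show "(\<lambda>i. Bochner_Integration.simple_bochner_integral M (\<lambda>\<omega>. l (s i \<omega>))) \<longlonglongrightarrow> l e"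
      using bounded_linear.tendsto[OF l s(3)]
      by (simp add: simple_bochner_integral_linear[OF bounded_linear.linear[OF l] s(1)])
    show "(\<lambda>i. \<integral>\<^sup>+\<omega>. norm (l (X \<omega>) - l (s i \<omega>)) \<partial>M) \<longlonglongrightarrow> 0"
    proof (rule tendsto_sandwich[OF _ _ tendsto_const])
      have "(\<lambda>i. ennreal K * (\<integral>\<^sup>+\<omega>. norm (X \<omega> - s i \<omega>) \<partial>M)) \<longlonglongrightarrow> ennreal K * 0"
        by (intro ennreal_tendsto_cmult s) simp
      then show "(\<lambda>i. ennreal K * (\<integral>\<^sup>+\<omega>. norm (X \<omega> - s i \<omega>) \<partial>M)) \<longlonglongrightarrow> 0" by simp
      have "(\<integral>\<^sup>+\<omega>. norm (l (X \<omega>) - l (s i \<omega>)) \<partial>M) \<le> ennreal K * (\<integral>\<^sup>+\<omega>. norm (X \<omega> - s i \<omega>) \<partial>M)"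
        for i
      proof -
        have "(\<integral>\<^sup>+\<omega>. norm (l (X \<omega>) - l (s i \<omega>)) \<partial>M) \<le> (\<integral>\<^sup>+\<omega>. ennreal K * norm (X \<omega> - s i \<omega>) \<partial>M)"
          using K by (intro nn_integral_mono) (simp add: lin[symmetric] mult.commute flip: ennreal_mult)
        also have "(\<lambda>\<omega>. ennreal (norm (X \<omega> - s i \<omega>))) \<in> borel_measurable M"
        proof -
          have "unif_simple M (\<lambda>\<omega>. X \<omega> - s i \<omega>)"
            by (intro unif_simple_diff X unif_simple_simple sf)
          then have "(\<lambda>\<omega>. X \<omega> - s i \<omega>) \<in> borel_measurable M"
            by (rule unif_simple_borel_measurable)
          then show ?thesis by simp
        qed
        then have "(\<integral>\<^sup>+\<omega>. ennreal K * norm (X \<omega> - s i \<omega>) \<partial>M)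
            = ennreal K * (\<integral>\<^sup>+\<omega>. norm (X \<omega> - s i \<omega>) \<partial>M)"
          by (rule nn_integral_cmult)
        finally show ?thesis .
      qed
      then show "\<forall>\<^sub>F i in sequentially. (\<integral>\<^sup>+\<omega>. norm (l (X \<omega>) - l (s i \<omega>)) \<partial>M)
          \<le> ennreal K * (\<integral>\<^sup>+\<omega>. norm (X \<omega> - s i \<omega>) \<partial>M)" by simp
    qed auto
  qed
  then show ?thesis by (rule has_bochner_integral_integral_eq[symmetric])
qed

lemma vec_expectation_linear:
  fixes X :: "'a \<Rightarrow> 'b::{real_inner, banach}" and l :: "'b \<Rightarrow> real"
  assumes X: "unif_simple M X" and l: "bounded_linear l"
  shows "l (vec_expectation M X) = (\<integral>\<omega>. l (X \<omega>) \<partial>M)"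
proof -
  obtain e where e: "has_expectation M X e" using has_expectation_exists[OF X] by blast
  have "e' = e" if e': "has_expectation M X e'" for e'
  proof -
    have "w \<bullet> e' = w \<bullet> e" for w
      using has_expectation_linear[OF X e' bounded_linear_inner_right[of w]]
        has_expectation_linear[OF X e bounded_linear_inner_right[of w]] by simp
    then have "(e' - e) \<bullet> (e' - e) = 0" by (simp add: inner_diff_right)
    then show ?thesis by simp
  qed
  then have "vec_expectation M X = e"
    unfolding vec_expectation_def by (rule the_equality[where P="has_expectation M X", OF e])
  then show ?thesis using has_expectation_linear[OF X e l] by simp
qed

end

section \<open>The deterministic forward iteration\<close>

text \<open>
  The constant 2 is the cocoercivity of \<open>Id - C\<close> for nonexpansive \<open>C\<close>.  The last two assumptions
  characterize \<open>u\<close> as the element of minimal norm in the closed range.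
\<close>

locale cocoercive_op = metric_op M
  for M :: "'a::{real_inner, banach} \<Rightarrow> 'a" +
  fixes S :: "'a \<Rightarrow> 'a" and u :: 'a
  assumes cocoercive: "\<parallel>S x - S y\<parallel>\<^sup>2 \<le> 2 * \<langle>x - y, S x - S y\<rangle>"
    and approached: "\<exists>z. (\<lambda>n. \<parallel>S (z n) - u\<parallel>) \<longlonglongrightarrow> 0"
    and minimal: "\<parallel>u\<parallel>\<^sup>2 \<le> \<langle>u, S x\<rangle>"
begin

lemma S_lipschitz: "\<parallel>S x - S y\<parallel> \<le> 2 * \<parallel>x - y\<parallel>"
proof (cases "S x - S y = 0")
  case False
  then have pos: "0 < \<parallel>S x - S y\<parallel>" using nm_nonneg nm_eq_0_iff order_less_le by metis
  have "\<parallel>S x - S y\<parallel> * \<parallel>S x - S y\<parallel> \<le> (2 * \<parallel>x - y\<parallel>) * \<parallel>S x - S y\<parallel>"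
    using cocoercive[of x y] ip_le'[of "x - y" "S x - S y"] by (simp add: power2_eq_square)
  then show ?thesis using pos by simp
next
  case True
  show ?thesis unfolding True by simp
qed

lemma dist_minimal_square: "\<parallel>S x - u\<parallel>\<^sup>2 \<le> \<parallel>S x\<parallel>\<^sup>2 - \<parallel>u\<parallel>\<^sup>2"
  unfolding nm_square_diff using minimal[of x] by (simp add: ip_commute)

lemma minimal_nm: "\<parallel>u\<parallel> \<le> \<parallel>S x\<parallel>"
proof -
  have "0 \<le> \<parallel>S x - u\<parallel>\<^sup>2" by simp
  then have "\<parallel>u\<parallel>\<^sup>2 \<le> \<parallel>S x\<parallel>\<^sup>2" using dist_minimal_square[of x] by linarith
  then show ?thesis by (rule power2_le_imp_le) simp
qed

lemma forward_step:
  assumes a: "0 \<le> a"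
  shows "\<parallel>(x - a *\<^sub>R S x) - (y - a *\<^sub>R S y)\<parallel>\<^sup>2 \<le> \<parallel>x - y\<parallel>\<^sup>2 - (a - a\<^sup>2) * \<parallel>S x - S y\<parallel>\<^sup>2"
proof -
  have eq: "(x - a *\<^sub>R S x) - (y - a *\<^sub>R S y) = (x - y) - a *\<^sub>R (S x - S y)"
    by (simp add: algebra_simps)
  have "a * \<parallel>S x - S y\<parallel>\<^sup>2 \<le> a * (2 * \<langle>x - y, S x - S y\<rangle>)"
    by (intro mult_left_mono cocoercive a)
  then show ?thesis
    unfolding eq nm_square_diff[of "x - y"] nm_scaleR ip_simps(6)
    by (simp add: power_mult_distrib left_diff_distrib)
qed

context
  fixes a :: real and y :: "nat \<Rightarrow> 'a"
  assumes a: "0 < a" "a < 1" and y_Suc: "\<And>k. y (Suc k) = y k - a *\<^sub>R S (y k)"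
begin

lemma forward_decseq: "decseq (\<lambda>k. \<parallel>S (y k)\<parallel>)"
  unfolding decseq_Suc_iff
proof
  fix k
  have "\<parallel>- (a *\<^sub>R S (y (Suc k)))\<parallel>\<^sup>2 \<le> \<parallel>- (a *\<^sub>R S (y k))\<parallel>\<^sup>2 - (a - a\<^sup>2) * \<parallel>S (y (Suc k)) - S (y k)\<parallel>\<^sup>2"
    using forward_step[of a "y (Suc k)" "y k"] a y_Suc[of "k"] y_Suc[of "Suc k"] by simp
  also have "\<dots> \<le> \<parallel>- (a *\<^sub>R S (y k))\<parallel>\<^sup>2" using square_less_self[OF a] by simp
  finally have "\<parallel>- (a *\<^sub>R S (y (Suc k)))\<parallel> \<le> \<parallel>- (a *\<^sub>R S (y k))\<parallel>"
    by (rule power2_le_imp_le) simp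
  then show "\<parallel>S (y (Suc k))\<parallel> \<le> \<parallel>S (y k)\<parallel>" using a by (simp add: nm_minus nm_scaleR)
qed

lemma forward_bounded: "\<parallel>S (y k)\<parallel> \<le> \<parallel>S (y 0)\<parallel>"
  using decseqD[OF forward_decseq, of 0 k] by simp

end

text \<open>
  Each step decreases the squared distance of the two trajectories by a fixed multiple of
  \<open>\<parallel>S y\<^sub>k - S z\<^sub>k\<parallel>\<^sup>2\<close>, so these numbers are summable.
\<close>

lemma forward_difference_tendsto:
  assumes a: "0 < a" "a < 1"
    and y: "\<And>k. y (Suc k) = y k - a *\<^sub>R S (y k)" and z: "\<And>k. z (Suc k) = z k - a *\<^sub>R S (z k)"
  shows "(\<lambda>k. \<parallel>S (y k) - S (z k)\<parallel>) \<longlonglongrightarrow> 0"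
proof -
  have aa: "0 < a - a\<^sup>2" using square_less_self[OF a] by simp
  have tele: "(\<Sum>j<k. (a - a\<^sup>2) * \<parallel>S (y j) - S (z j)\<parallel>\<^sup>2) \<le> \<parallel>y 0 - z 0\<parallel>\<^sup>2 - \<parallel>y k - z k\<parallel>\<^sup>2" for k
  proof (induction k)
    case (Suc k)
    then show ?case using forward_step[of a "y k" "z k"] a y[of k] z[of k] by simp
  qed simp
  have "summable (\<lambda>j. (a - a\<^sup>2) * \<parallel>S (y j) - S (z j)\<parallel>\<^sup>2)"
  proof (rule summableI_nonneg_bounded)
    show "0 \<le> (a - a\<^sup>2) * \<parallel>S (y j) - S (z j)\<parallel>\<^sup>2" for j using aa by simp
    show "(\<Sum>j<k. (a - a\<^sup>2) * \<parallel>S (y j) - S (z j)\<parallel>\<^sup>2) \<le> \<parallel>y 0 - z 0\<parallel>\<^sup>2" for k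
      by (rule order_trans[OF tele]) simp
  qed
  then have "(\<lambda>j. (a - a\<^sup>2) * \<parallel>S (y j) - S (z j)\<parallel>\<^sup>2) \<longlonglongrightarrow> 0" by (rule summable_LIMSEQ_zero)
  then have "(\<lambda>j. (1 / (a - a\<^sup>2)) * ((a - a\<^sup>2) * \<parallel>S (y j) - S (z j)\<parallel>\<^sup>2)) \<longlonglongrightarrow> 0"
    by (rule tendsto_mult_right_zero)
  then have "(\<lambda>j. \<parallel>S (y j) - S (z j)\<parallel>\<^sup>2) \<longlonglongrightarrow> 0" using aa by simp
  then have "(\<lambda>j. sqrt (\<parallel>S (y j) - S (z j)\<parallel>\<^sup>2)) \<longlonglongrightarrow> sqrt 0" by (rule tendsto_real_sqrt)
  then show ?thesis by simp
qed

text \<open>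
  Compare with a trajectory that starts where \<open>S\<close> is nearly minimal in norm: along it the norm of \<open>S\<close> does not
  increase, and the displacements of the two trajectories approach each other.  Hence \<open>\<parallel>S y\<^sub>k\<parallel> \<longlonglongrightarrow> \<parallel>u\<parallel>\<close>, and
  the variational inequality turns convergence of norms into convergence of vectors.
\<close>

theorem forward_displacement_tendsto:
  assumes a: "0 < a" "a < 1" and y: "\<And>k. y (Suc k) = y k - a *\<^sub>R S (y k)"
  shows "(\<lambda>k. \<parallel>S (y k) - u\<parallel>) \<longlonglongrightarrow> 0"
proof -
  have nm_lim: "(\<lambda>k. \<parallel>S (y k)\<parallel>) \<longlonglongrightarrow> \<parallel>u\<parallel>"
  proof (rule order_tendstoI)
    fix r assume "r < \<parallel>u\<parallel>"
    then show "\<forall>\<^sub>F k in sequentially. r < \<parallel>S (y k)\<parallel>"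
      using minimal_nm by (auto intro!: always_eventually intro: less_le_trans)
  next
    fix r assume r: "\<parallel>u\<parallel> < r"
    define e where "e = (r - \<parallel>u\<parallel>) / 2"
    have e: "0 < e" using r by (simp add: e_def)
    obtain z' where "(\<lambda>n. \<parallel>S (z' n) - u\<parallel>) \<longlonglongrightarrow> 0" using approached by blast
    then have "\<forall>\<^sub>F n in sequentially. \<parallel>S (z' n) - u\<parallel> < e" using e by (rule order_tendstoD)
    then obtain z0 where z0: "\<parallel>S z0 - u\<parallel> < e" unfolding eventually_sequentially by blast
    define z where "z k = ((\<lambda>x. x - a *\<^sub>R S x) ^^ k) z0" for k
    have z: "z (Suc k) = z k - a *\<^sub>R S (z k)" for k by (simp add: z_def)
    have z_le: "\<parallel>S (z k)\<parallel> < \<parallel>u\<parallel> + e" for k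
      using forward_bounded[where y=z and k=k, OF a z] nm_triangle_sub[of "S z0" u] z0 by (simp add: z_def)
    have "\<forall>\<^sub>F k in sequentially. \<parallel>S (y k) - S (z k)\<parallel> < e"
      using forward_difference_tendsto[where y=y and z=z, OF a y z] e by (rule order_tendstoD)
    then show "\<forall>\<^sub>F k in sequentially. \<parallel>S (y k)\<parallel> < r"
    proof eventually_elim
      case (elim k)
      have "\<parallel>S (y k)\<parallel> \<le> \<parallel>S (z k)\<parallel> + \<parallel>S (y k) - S (z k)\<parallel>" by (rule nm_triangle_sub)
      moreover have "r = \<parallel>u\<parallel> + e + e" by (simp add: e_def)
      ultimately show ?case using elim z_le[of k] by linarith
    qed
  qed
  have "(\<lambda>k. sqrt (\<parallel>S (y k)\<parallel>\<^sup>2 - \<parallel>u\<parallel>\<^sup>2)) \<longlonglongrightarrow> sqrt (\<parallel>u\<parallel>\<^sup>2 - \<parallel>u\<parallel>\<^sup>2)"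
    by (intro tendsto_intros nm_lim)
  then have lim: "(\<lambda>k. sqrt (\<parallel>S (y k)\<parallel>\<^sup>2 - \<parallel>u\<parallel>\<^sup>2)) \<longlonglongrightarrow> 0" by simp
  have le: "norm (\<parallel>S (y k) - u\<parallel>) \<le> sqrt (\<parallel>S (y k)\<parallel>\<^sup>2 - \<parallel>u\<parallel>\<^sup>2)" for k
    using dist_minimal_square[of "y k"] by (simp add: real_le_rsqrt)
  show ?thesis
    by (rule Lim_null_comparison[OF always_eventually[OF allI[OF le]] lim])
qed

lemma forward_average:
  assumes a: "0 < a" "a < 1" and y: "\<And>k. y (Suc k) = y k - a *\<^sub>R S (y k)"
  shows "(\<lambda>k. \<parallel>y k + (real k * a) *\<^sub>R u\<parallel> / real k) \<longlonglongrightarrow> 0"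
proof -
  let ?D = "\<lambda>k. \<parallel>y k + (real k * a) *\<^sub>R u\<parallel>"
  have step: "?D (Suc k) \<le> ?D k + a * \<parallel>S (y k) - u\<parallel>" for k
  proof -
    have "y (Suc k) + (real (Suc k) * a) *\<^sub>R u
        = (y k + (real k * a) *\<^sub>R u) - a *\<^sub>R (S (y k) - u)"
      by (simp add: y algebra_simps)
    then show ?thesis
      using nm_triangle_diff[of "y k + (real k * a) *\<^sub>R u" "a *\<^sub>R (S (y k) - u)"] a
      by (simp add: nm_scaleR)
  qed
  have lim: "(\<lambda>k. a * \<parallel>S (y k) - u\<parallel>) \<longlonglongrightarrow> 0"
    by (rule tendsto_mult_right_zero[OF forward_displacement_tendsto[where y=y, OF a y]])
  show ?thesis
  proof (rule order_tendstoI)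
    fix r :: real assume r: "0 < r"
    have "\<forall>\<^sub>F k in sequentially. ?D k \<le> (0 + r / 2) * real k"
      by (rule eventually_le_linear[OF step lim]) (use r in simp)
    then show "\<forall>\<^sub>F k in sequentially. ?D k / real k < r"
      using eventually_gt_at_top[of 0]
    proof eventually_elim
      case (elim k)
      then have "?D k / real k \<le> r / 2" by (simp add: field_simps)
      then show ?case using r by linarith
    qed
  next
    fix r :: real assume "r < 0"
    then show "\<forall>\<^sub>F k in sequentially. r < ?D k / real k"
      by (intro always_eventually allI) (auto intro: less_le_trans)
  qed
qed

text \<open>
  The norm of \<open>S\<close> along the trajectory cannot rise above the minimum that it starts with, and the
  minimum is attained only at \<open>u\<close>.  So the trajectory is a straight line.
\<close>

lemma forward_from_minimal:
  assumes a: "0 < a" "a < 1" and y: "\<And>k. y (Suc k) = y k - a *\<^sub>R S (y k)" and y0: "S (y 0) = u"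
  shows "y k = y 0 - (real k * a) *\<^sub>R u"
proof (induction k)
  case (Suc k)
  have "\<parallel>S (y k)\<parallel>\<^sup>2 \<le> \<parallel>u\<parallel>\<^sup>2"
    using forward_bounded[where y=y and k=k, OF a y] y0 by (intro power_mono) auto
  then have "\<parallel>S (y k) - u\<parallel>\<^sup>2 \<le> 0" using dist_minimal_square[of "y k"] by linarith
  then have "\<parallel>S (y k) - u\<parallel> = 0" by simp
  then have "S (y k) = u" unfolding nm_eq_0_iff by simp
  then have "y (Suc k) = y k - a *\<^sub>R u" using y[of k] by (simp only:)
  then show ?case by (simp add: Suc.IH algebra_simps)
qed simp

end

section \<open>Block selections\<close>

lemma component_props:
  assumes E: "hilbert_direct_sum E"
  shows component_mem: "component E j x \<in> E j" and sum_component: "(\<Sum>j\<in>UNIV. component E j x) = x"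
proof -
  obtain f where f: "\<And>j. f j \<in> E j" "x = (\<Sum>j\<in>UNIV. f j)"
    using E unfolding hilbert_direct_sum_def by metis
  have c: "component E j x = f j" for j using component_eq[OF E f(1)] f(2) by simp
  show "component E j x \<in> E j" using f c by simp
  show "(\<Sum>j\<in>UNIV. component E j x) = x" using f c by simp
qed

lemma component_unique:
  assumes "hilbert_direct_sum E" "\<And>j. f j \<in> E j" "x = (\<Sum>j\<in>UNIV. f j)"
  shows "component E j x = f j"
  using component_eq[OF assms(1,2)] assms(3) by simp

lemma bounded_linear_component:
  assumes E: "hilbert_direct_sum E"
  shows "bounded_linear (component E j)"
proof (rule bounded_linear_intro[where K=1])
  have sub: "subspace (E k)" for k using E by (simp add: hilbert_direct_sum_def)
  fix x y :: 'b and r :: real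
  show "component E j (x + y) = component E j x + component E j y"
    by (rule component_unique[OF E])
       (auto simp: sum.distrib sum_component[OF E] intro!: subspace_add[OF sub] component_mem[OF E])
  show "component E j (r *\<^sub>R x) = r *\<^sub>R component E j x"
    by (rule component_unique[OF E])
       (auto simp: scaleR_sum_right[symmetric] sum_component[OF E]
          intro!: subspace_scale[OF sub] component_mem[OF E])
  have orth: "component E j x \<bullet> component E k x = 0" if "k \<noteq> j" for k
    using E component_mem[OF E] that unfolding hilbert_direct_sum_def by metis
  have "component E j x \<bullet> x = (\<Sum>k\<in>UNIV. component E j x \<bullet> component E k x)"
    by (subst (2) sum_component[OF E, symmetric]) (rule inner_sum_right)
  also have "\<dots> = (\<Sum>k\<in>UNIV. if k = j then component E j x \<bullet> component E j x else 0)"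
    using orth by (intro sum.cong) auto
  finally have "(norm (component E j x))\<^sup>2 = component E j x \<bullet> x"
    by (simp add: power2_norm_eq_inner)
  also have "\<dots> \<le> norm (component E j x) * norm x" by (rule norm_cauchy_schwarz)
  finally show "norm (component E j x) \<le> norm x * 1"
    by (cases "component E j x = 0") (auto simp: power2_eq_square)
qed

lemma sum_UNIV_option:
  fixes f :: "'m::finite option \<Rightarrow> 'b::comm_monoid_add"
  shows "(\<Sum>j\<in>UNIV. f j) = f None + (\<Sum>i\<in>UNIV. f (Some i))"
  by (simp add: UNIV_option_conv sum.reindex)

lemma T_sel_eq:
  assumes E: "hilbert_direct_sum E"
  shows "T_sel E \<theta> \<alpha> T \<iota> x = x - \<theta> *\<^sub>R sel E \<alpha> \<iota> (S_op \<theta> T x)"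
proof -
  have "Hi_op E \<theta> T i x = component E (Some i) (S_op \<theta> T x)" for i
  proof -
    define f where "f j = (case j of None \<Rightarrow> 0 | Some i \<Rightarrow> component E (Some i) (S_op \<theta> T x))" for j
    have "f j \<in> E j" for j
      using E by (cases j) (auto simp: f_def component_mem hilbert_direct_sum_def subspace_0)
    moreover have "H_op E \<theta> T x = (\<Sum>j\<in>UNIV. f j)"
      by (simp add: H_op_def sum_UNIV_option f_def)
    ultimately have "component E (Some i) (H_op E \<theta> T x) = f (Some i)"
      by (rule component_unique[OF E])
    then show ?thesis by (simp add: Hi_op_def f_def)
  qed
  then show ?thesis by (simp add: T_sel_def sel_def G_op_def)
qed

locale blocks = metric_op M
  for M :: "'a::{real_inner, banach} \<Rightarrow> 'a" +
  fixes E :: "'m::finite option \<Rightarrow> 'a set"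
  assumes direct_sum: "hilbert_direct_sum E" and orthogonal: "blocks_orthogonal_M M E"
begin

definition rest :: "'a \<Rightarrow> 'a" where
  "rest x = (\<Sum>i\<in>UNIV. component E (Some i) x)"

lemma first_plus_rest: "component E None x + rest x = x"
  using sum_component[OF direct_sum, of x] by (simp add: sum_UNIV_option rest_def)

lemma nm_square_blocks:
  "\<parallel>\<Sum>i\<in>UNIV. r i *\<^sub>R component E (Some i) x\<parallel>\<^sup>2 = (\<Sum>i\<in>UNIV. (r i)\<^sup>2 * \<parallel>component E (Some i) x\<parallel>\<^sup>2)"
proof -
  have "\<langle>component E (Some i) x, component E (Some j) x\<rangle> = 0" if "i \<noteq> j" for i j
    using orthogonal component_mem[OF direct_sum] that unfolding blocks_orthogonal_M_def by blast
  then have "\<langle>r i *\<^sub>R component E (Some i) x, r j *\<^sub>R component E (Some j) x\<rangle>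
      = (if j = i then (r i)\<^sup>2 * \<parallel>component E (Some i) x\<parallel>\<^sup>2 else 0)" for i j
    by (cases "i = j") (simp_all add: ip_simps nm_square power2_eq_square[of "r j"])
  then show ?thesis
    unfolding nm_square[of "\<Sum>i\<in>UNIV. r i *\<^sub>R component E (Some i) x"]
    by (simp add: ip_sum_left ip_sum_right)
qed

lemma nm_square_sel:
  "\<parallel>sel E \<alpha> \<iota> x\<parallel>\<^sup>2 = \<alpha>\<^sup>2 * \<parallel>component E None x\<parallel>\<^sup>2
     + 2 * \<alpha> * (\<Sum>i\<in>UNIV. (\<iota> $ i) * \<langle>component E None x, component E (Some i) x\<rangle>)
     + (\<Sum>i\<in>UNIV. (\<iota> $ i)\<^sup>2 * \<parallel>component E (Some i) x\<parallel>\<^sup>2)"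
  unfolding sel_def nm_square_add nm_square_blocks
  by (simp add: ip_simps ip_sum_right nm_scaleR power_mult_distrib sum_distrib_left mult_ac)

lemma ip_sel:
  "\<langle>sel E \<alpha> \<iota> x, w\<rangle> = \<alpha> * \<langle>component E None x, w\<rangle>
     + (\<Sum>i\<in>UNIV. (\<iota> $ i) * \<langle>component E (Some i) x, w\<rangle>)"
  by (simp add: sel_def ip_simps ip_sum_left)

text \<open>
  The admissible constants form a closed set that contains 1, so the least one exists.
\<close>

lemma friedrichs_cos_props:
  defines "c \<equiv> friedrichs_cos M (U1 E) (U2 E)"
  shows "0 \<le> c" "c \<le> 1" "g \<in> U1 E \<Longrightarrow> h \<in> U2 E \<Longrightarrow> \<bar>\<langle>g, h\<rangle>\<bar> \<le> c * \<parallel>g\<parallel> * \<parallel>h\<parallel>"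
proof -
  define Q where "Q = {c. 0 \<le> c \<and> c \<le> 1 \<and> (\<forall>g\<in>U1 E. \<forall>h\<in>U2 E. \<bar>\<langle>g, h\<rangle>\<bar> \<le> c * \<parallel>g\<parallel> * \<parallel>h\<parallel>)}"
  have "closed Q"
  proof -
    have "Q = {0..1} \<inter> (\<Inter>g\<in>U1 E. \<Inter>h\<in>U2 E. {c. \<bar>\<langle>g, h\<rangle>\<bar> \<le> c * \<parallel>g\<parallel> * \<parallel>h\<parallel>})"
      by (auto simp: Q_def)
    moreover have "closed {c. \<bar>\<langle>g, h\<rangle>\<bar> \<le> c * \<parallel>g\<parallel> * \<parallel>h\<parallel>}" for g h
      by (intro closed_Collect_le continuous_intros)
    ultimately show ?thesis by (auto intro!: closed_Int closed_INT)
  qed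
  moreover have "1 \<in> Q" using ip_le by (simp add: Q_def)
  moreover have bdd: "bdd_below Q" unfolding bdd_below_def Q_def by blast
  ultimately have "Inf Q \<in> Q" by (intro closed_contains_Inf) auto
  moreover have "c = Inf Q"
    unfolding c_def friedrichs_cos_def
  proof (rule Least_equality)
    show "0 \<le> Inf Q \<and> Inf Q \<le> 1 \<and> (\<forall>g\<in>U1 E. \<forall>h\<in>U2 E. \<bar>\<langle>g, h\<rangle>\<bar> \<le> Inf Q * \<parallel>g\<parallel> * \<parallel>h\<parallel>)"
      using \<open>Inf Q \<in> Q\<close> by (simp add: Q_def)
    show "Inf Q \<le> c'" if "0 \<le> c' \<and> c' \<le> 1 \<and> (\<forall>g\<in>U1 E. \<forall>h\<in>U2 E. \<bar>\<langle>g, h\<rangle>\<bar> \<le> c' * \<parallel>g\<parallel> * \<parallel>h\<parallel>)"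
      for c'
      using that by (intro cInf_lower bdd) (simp add: Q_def)
  qed
  ultimately have "c \<in> Q" by simp
  then show "0 \<le> c" "c \<le> 1" "g \<in> U1 E \<Longrightarrow> h \<in> U2 E \<Longrightarrow> \<bar>\<langle>g, h\<rangle>\<bar> \<le> c * \<parallel>g\<parallel> * \<parallel>h\<parallel>"
    by (auto simp: Q_def)
qed

text \<open>
  With \<open>g\<close> the first block and \<open>h\<close> the rest, \<open>\<parallel>g + h\<parallel>\<^sup>2 \<ge> \<parallel>g\<parallel>\<^sup>2 - 2 c \<parallel>g\<parallel> \<parallel>h\<parallel> + \<parallel>h\<parallel>\<^sup>2\<close>, which is smallest at
  \<open>\<parallel>g\<parallel> = c \<parallel>h\<parallel>\<close>.
\<close>

lemma rest_square_le:
  "(1 - (friedrichs_cos M (U1 E) (U2 E))\<^sup>2) * \<parallel>rest x\<parallel>\<^sup>2 \<le> \<parallel>x\<parallel>\<^sup>2"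
proof -
  define c where "c = friedrichs_cos M (U1 E) (U2 E)"
  let ?g = "component E None x" and ?h = "rest x"
  have "?g \<in> U1 E" using component_mem[OF direct_sum] by (simp add: U1_def)
  moreover have "?h \<in> U2 E" using component_mem[OF direct_sum] unfolding U2_def rest_def by blast
  ultimately have "\<bar>\<langle>?g, ?h\<rangle>\<bar> \<le> c * \<parallel>?g\<parallel> * \<parallel>?h\<parallel>"
    unfolding c_def by (rule friedrichs_cos_props)
  moreover have "0 \<le> (\<parallel>?g\<parallel> - c * \<parallel>?h\<parallel>)\<^sup>2" by simp
  ultimately have "(1 - c\<^sup>2) * \<parallel>?h\<parallel>\<^sup>2 \<le> \<parallel>?g\<parallel>\<^sup>2 + 2 * \<langle>?g, ?h\<rangle> + \<parallel>?h\<parallel>\<^sup>2"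
    by (simp add: power2_diff power_mult_distrib algebra_simps abs_le_iff)
  also have "\<dots> = \<parallel>x\<parallel>\<^sup>2" unfolding nm_square_add[symmetric] first_plus_rest ..
  finally show ?thesis unfolding c_def .
qed

end

section \<open>Random block selections\<close>

locale random_selection = blocks M E
  for M :: "'a::{real_inner, banach} \<Rightarrow> 'a" and E :: "'m::finite option \<Rightarrow> 'a set" +
  fixes D :: "(real ^ 'm) measure" and \<alpha> :: real
  assumes prob_D: "prob_space D" and sets_D: "sets D = sets borel"
    and unit_D: "AE \<iota> in D. \<forall>i. 0 \<le> \<iota> $ i \<and> \<iota> $ i \<le> 1"
    and mean_D: "(\<integral>\<iota>. \<iota> \<partial>D) = \<alpha> *\<^sub>R (\<chi> i. 1)"
    and \<alpha>: "0 < \<alpha>" "\<alpha> \<le> 1"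
begin

sublocale D: prob_space D by (rule prob_D)

lemma measurable_D: "f \<in> borel_measurable borel \<Longrightarrow> f \<in> borel_measurable D"
  using measurable_cong_sets[OF sets_D refl] by blast

lemma integrable_nth: "integrable D (\<lambda>\<iota>. \<iota> $ i)"
  using unit_D by (intro D.integrable_const_bound[where B=1] measurable_D) (auto elim: AE_mp)

lemma integrable_nth_square: "integrable D (\<lambda>\<iota>. (\<iota> $ i)\<^sup>2)"
proof (rule D.integrable_const_bound[where B=1])
  show "AE \<iota> in D. norm ((\<iota> $ i)\<^sup>2) \<le> 1"
    using unit_D by eventually_elim (auto simp: power_le_one)
qed (auto intro!: measurable_D)

lemma integral_nth: "(\<integral>\<iota>. \<iota> $ i \<partial>D) = \<alpha>"
proof -
  have "integrable D (\<lambda>\<iota>. \<iota>)"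
  proof (rule D.integrable_const_bound[where B="real CARD('m)"])
    show "AE \<iota> in D. norm \<iota> \<le> real CARD('m)"
      using unit_D
    proof eventually_elim
      case (elim \<iota>)
      have "norm \<iota> \<le> (\<Sum>i\<in>UNIV. \<bar>\<iota> $ i\<bar>)" by (rule norm_le_l1_cart)
      also have "\<dots> \<le> (\<Sum>i\<in>(UNIV :: 'm set). 1)" using elim by (intro sum_mono) auto
      finally show ?case by simp
    qed
  qed (simp add: measurable_D)
  from integral_bounded_linear[OF bounded_linear_vec_nth this, of i] show ?thesis
    by (simp add: mean_D)
qed

lemma integrable_sel: "integrable D (\<lambda>\<iota>. \<parallel>sel E \<alpha> \<iota> x\<parallel>\<^sup>2)" "integrable D (\<lambda>\<iota>. \<langle>sel E \<alpha> \<iota> x, w\<rangle>)"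
  unfolding nm_square_sel ip_sel
  by (auto intro!: Bochner_Integration.integrable_add Bochner_Integration.integrable_sum
      integrable_nth integrable_nth_square integrable_mult_left integrable_mult_right)

lemma integral_ip_sel: "(\<integral>\<iota>. \<langle>sel E \<alpha> \<iota> x, w\<rangle> \<partial>D) = \<alpha> * \<langle>x, w\<rangle>"
proof -
  have "(\<integral>\<iota>. \<langle>sel E \<alpha> \<iota> x, w\<rangle> \<partial>D) = \<alpha> * \<langle>component E None x, w\<rangle> + \<alpha> * \<langle>rest x, w\<rangle>"
    unfolding ip_sel
    by (simp add: integrable_nth integral_nth D.prob_space rest_def ip_sum_left sum_distrib_left)
  also have "\<dots> = \<alpha> * \<langle>component E None x + rest x, w\<rangle>" by (simp add: ip_simps algebra_simps)
  finally show ?thesis by (simp add: first_plus_rest)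
qed

text \<open>
  The coordinates of a selection lie in the unit interval, so \<open>\<iota>\<^sub>i\<^sup>2 \<le> \<iota>\<^sub>i\<close>.  As the blocks are orthogonal, only the
  squares contribute to the excess of the second moment over \<open>\<alpha>\<^sup>2 \<parallel>x\<parallel>\<^sup>2\<close>.
\<close>

lemma integral_sel_le:
  "(\<integral>\<iota>. \<parallel>sel E \<alpha> \<iota> x\<parallel>\<^sup>2 \<partial>D) \<le> \<alpha>\<^sup>2 * \<parallel>x\<parallel>\<^sup>2 + \<alpha> * (1 - \<alpha>) * \<parallel>rest x\<parallel>\<^sup>2"
proof -
  let ?g = "component E None x" and ?h = "\<lambda>i. component E (Some i) x"
  define F where "F \<iota> = \<alpha>\<^sup>2 * \<parallel>?g\<parallel>\<^sup>2 + 2 * \<alpha> * (\<Sum>i\<in>UNIV. (\<iota> $ i) * \<langle>?g, ?h i\<rangle>)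
     + (\<Sum>i\<in>UNIV. (\<iota> $ i) * \<parallel>?h i\<parallel>\<^sup>2)" for \<iota> :: "real ^ 'm"
  have "(\<integral>\<iota>. \<parallel>sel E \<alpha> \<iota> x\<parallel>\<^sup>2 \<partial>D) \<le> (\<integral>\<iota>. F \<iota> \<partial>D)"
  proof (rule integral_mono_AE)
    show "integrable D F" unfolding F_def
      by (auto intro!: Bochner_Integration.integrable_add Bochner_Integration.integrable_sum
          integrable_nth integrable_mult_left integrable_mult_right)
    show "AE \<iota> in D. \<parallel>sel E \<alpha> \<iota> x\<parallel>\<^sup>2 \<le> F \<iota>"
      using unit_D
    proof eventually_elim
      case (elim \<iota>)
      have "(\<iota> $ i)\<^sup>2 \<le> \<iota> $ i" for i
        using elim[rule_format, of i] by (simp add: power2_eq_square mult_left_le_one_le)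
      then show ?case unfolding nm_square_sel F_def
        by (intro add_left_mono sum_mono mult_right_mono) auto
    qed
  qed (rule integrable_sel)
  also have "(\<integral>\<iota>. F \<iota> \<partial>D) = \<alpha>\<^sup>2 * \<parallel>?g\<parallel>\<^sup>2 + 2 * \<alpha> * (\<Sum>i\<in>UNIV. \<alpha> * \<langle>?g, ?h i\<rangle>)
     + (\<Sum>i\<in>UNIV. \<alpha> * \<parallel>?h i\<parallel>\<^sup>2)"
    unfolding F_def by (simp add: integrable_nth integral_nth D.prob_space)
  also have "\<dots> = \<alpha>\<^sup>2 * (\<parallel>?g\<parallel>\<^sup>2 + 2 * \<langle>?g, rest x\<rangle>) + \<alpha> * \<parallel>rest x\<parallel>\<^sup>2"
    using nm_square_blocks[of "\<lambda>_. 1" x]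
    by (simp add: rest_def ip_sum_right sum_distrib_left power2_eq_square algebra_simps)
  also have "\<dots> = \<alpha>\<^sup>2 * \<parallel>?g + rest x\<parallel>\<^sup>2 + \<alpha> * (1 - \<alpha>) * \<parallel>rest x\<parallel>\<^sup>2"
    unfolding nm_square_add by (simp add: power2_eq_square algebra_simps)
  finally show ?thesis by (simp add: first_plus_rest)
qed

definition second_moment_bound :: "real \<Rightarrow> bool" where
  "second_moment_bound \<beta> \<longleftrightarrow> (\<forall>x. (\<integral>\<iota>. \<parallel>sel E \<alpha> \<iota> x\<parallel>\<^sup>2 \<partial>D) \<le> \<beta> * \<parallel>x\<parallel>\<^sup>2)"

lemma second_moment_boundI:
  assumes \<beta>: "\<alpha> * (1 - \<alpha>) \<le> (\<beta> - \<alpha>\<^sup>2) * (1 - (friedrichs_cos M (U1 E) (U2 E))\<^sup>2)" and ge: "\<alpha>\<^sup>2 \<le> \<beta>"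
  shows "second_moment_bound \<beta>"
  unfolding second_moment_bound_def
proof
  fix x
  let ?c = "friedrichs_cos M (U1 E) (U2 E)"
  have "\<alpha> * (1 - \<alpha>) * \<parallel>rest x\<parallel>\<^sup>2 \<le> (\<beta> - \<alpha>\<^sup>2) * (1 - ?c\<^sup>2) * \<parallel>rest x\<parallel>\<^sup>2"
    using \<beta> by (intro mult_right_mono) auto
  also have "\<dots> \<le> (\<beta> - \<alpha>\<^sup>2) * \<parallel>x\<parallel>\<^sup>2"
    unfolding mult.assoc using ge by (intro mult_left_mono rest_square_le) auto
  finally show "(\<integral>\<iota>. \<parallel>sel E \<alpha> \<iota> x\<parallel>\<^sup>2 \<partial>D) \<le> \<beta> * \<parallel>x\<parallel>\<^sup>2"
    using integral_sel_le[of x] by (simp add: algebra_simps)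
qed

text \<open>
  The mean of \<open>sel E \<alpha> \<iota> x\<close> is \<open>\<alpha> x\<close>, and its variance is nonnegative.
\<close>

lemma integral_sel_ge:
  "\<alpha>\<^sup>2 * \<parallel>x\<parallel>\<^sup>2 \<le> (\<integral>\<iota>. \<parallel>sel E \<alpha> \<iota> x\<parallel>\<^sup>2 \<partial>D)"
proof -
  have "0 \<le> (\<integral>\<iota>. \<parallel>sel E \<alpha> \<iota> x - \<alpha> *\<^sub>R x\<parallel>\<^sup>2 \<partial>D)" by simp
  also have "\<dots> = (\<integral>\<iota>. \<parallel>sel E \<alpha> \<iota> x\<parallel>\<^sup>2 \<partial>D) - 2 * (\<alpha> * (\<alpha> * \<langle>x, x\<rangle>)) + \<alpha>\<^sup>2 * \<parallel>x\<parallel>\<^sup>2"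
    unfolding nm_square_diff nm_scaleR ip_simps(6)
    using integrable_sel by (simp add: integral_ip_sel D.prob_space power_mult_distrib)
  finally show ?thesis by (simp add: nm_square[of x, symmetric] power2_eq_square[of \<alpha>])
qed

text \<open>
  A second moment bound below \<open>\<alpha>\<^sup>2\<close> is possible only if all vectors vanish.  Raising it to \<open>\<alpha>\<^sup>2\<close> then
  changes no estimate, and makes the noise level \<open>\<beta> - \<alpha>\<^sup>2\<close> nonnegative.
\<close>

lemma second_moment_bound_max:
  assumes "second_moment_bound \<beta>"
  shows "second_moment_bound (max \<beta> (\<alpha>\<^sup>2))"
    and "(max \<beta> (\<alpha>\<^sup>2) - \<alpha>\<^sup>2) * \<parallel>x\<parallel>\<^sup>2 = (\<beta> - \<alpha>\<^sup>2) * \<parallel>x\<parallel>\<^sup>2"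
proof -
  have "\<beta> * \<parallel>x\<parallel>\<^sup>2 \<le> max \<beta> (\<alpha>\<^sup>2) * \<parallel>x\<parallel>\<^sup>2" for x by (intro mult_right_mono) auto
  then show "second_moment_bound (max \<beta> (\<alpha>\<^sup>2))"
    using assms unfolding second_moment_bound_def by (meson order_trans)
  have "\<alpha>\<^sup>2 * \<parallel>x\<parallel>\<^sup>2 \<le> \<beta> * \<parallel>x\<parallel>\<^sup>2"
    using order_trans[OF integral_sel_ge] assms unfolding second_moment_bound_def by blast
  then show "(max \<beta> (\<alpha>\<^sup>2) - \<alpha>\<^sup>2) * \<parallel>x\<parallel>\<^sup>2 = (\<beta> - \<alpha>\<^sup>2) * \<parallel>x\<parallel>\<^sup>2"
    by (cases "\<alpha>\<^sup>2 \<le> \<beta>") (auto simp: max_def mult_le_cancel_right)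
qed

text \<open>
  The threshold on the angle is the value of \<open>c\<close> at which \<open>\<alpha>\<^sup>2 + \<alpha> (1 - \<alpha>) / (1 - c\<^sup>2)\<close> equals \<open>\<alpha> / \<theta>\<close>.  Clearing
  denominators covers \<open>c = 1\<close>, which the hypothesis allows when \<open>\<alpha> = 1\<close>.
\<close>

lemma second_moment_bound_critical:
  assumes \<theta>: "0 < \<theta>" "\<theta> \<le> 1" "\<alpha> * \<theta> < 1"
    and c: "friedrichs_cos M (U1 E) (U2 E) \<le> sqrt ((1 - \<theta>) / (1 - \<alpha> * \<theta>))"
  shows "second_moment_bound (\<alpha> / \<theta>)" and "\<alpha>\<^sup>2 < \<alpha> / \<theta>"
proof -
  let ?c = "friedrichs_cos M (U1 E) (U2 E)"
  have "?c\<^sup>2 \<le> (1 - \<theta>) / (1 - \<alpha> * \<theta>)"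
    using power_mono[OF c friedrichs_cos_props(1), of 2] \<theta> by simp
  then have "\<theta> * (1 - \<alpha>) \<le> (1 - \<alpha> * \<theta>) * (1 - ?c\<^sup>2)"
    using \<theta> by (simp add: field_simps)
  then have "(\<alpha> / \<theta>) * (\<theta> * (1 - \<alpha>)) \<le> (\<alpha> / \<theta>) * ((1 - \<alpha> * \<theta>) * (1 - ?c\<^sup>2))"
    using \<theta> \<alpha> by (intro mult_left_mono) auto
  moreover have "(\<alpha> / \<theta>) * (\<theta> * (1 - \<alpha>)) = \<alpha> * (1 - \<alpha>)" using \<theta> by simp
  moreover have "(\<alpha> / \<theta>) * ((1 - \<alpha> * \<theta>) * (1 - ?c\<^sup>2)) = (\<alpha> / \<theta> - \<alpha>\<^sup>2) * (1 - ?c\<^sup>2)"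
    using \<theta> by (simp add: field_simps power2_eq_square)
  ultimately have "\<alpha> * (1 - \<alpha>) \<le> (\<alpha> / \<theta> - \<alpha>\<^sup>2) * (1 - ?c\<^sup>2)" by simp
  moreover show less: "\<alpha>\<^sup>2 < \<alpha> / \<theta>"
    using mult_strict_left_mono[OF \<theta>(3) \<alpha>(1)] \<theta> by (simp add: field_simps power2_eq_square)
  ultimately show "second_moment_bound (\<alpha> / \<theta>)" by (intro second_moment_boundI) auto
qed

lemma second_moment_bound_subcritical:
  assumes \<theta>: "0 < \<theta>" "\<theta> \<le> 1" "\<alpha> * \<theta> < 1"
    and c: "friedrichs_cos M (U1 E) (U2 E) < sqrt ((1 - \<theta>) / (1 - \<alpha> * \<theta>))"
  shows "\<exists>\<beta>>0. \<beta> < \<alpha> / \<theta> \<and> second_moment_bound \<beta>"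
proof -
  let ?c = "friedrichs_cos M (U1 E) (U2 E)"
  have c2: "?c\<^sup>2 < (1 - \<theta>) / (1 - \<alpha> * \<theta>)"
    using power_strict_mono[OF c friedrichs_cos_props(1), of 2] \<theta> by simp
  have "\<alpha> * \<theta> \<le> \<theta>" using \<theta> \<alpha> by simp
  then have "(1 - \<theta>) / (1 - \<alpha> * \<theta>) \<le> 1" using \<theta> by simp
  then have pos: "0 < 1 - ?c\<^sup>2" using c2 by linarith
  define \<beta> where "\<beta> = \<alpha>\<^sup>2 + \<alpha> * (1 - \<alpha>) / (1 - ?c\<^sup>2)"
  have ge: "\<alpha>\<^sup>2 \<le> \<beta>" using pos \<alpha> by (simp add: \<beta>_def)
  have "\<theta> * (1 - \<alpha>) < (1 - \<alpha> * \<theta>) * (1 - ?c\<^sup>2)"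
    using c2 \<theta> by (simp add: field_simps)
  then have "(1 - \<alpha>) / (1 - ?c\<^sup>2) < (1 - \<alpha> * \<theta>) / \<theta>"
    using pos \<theta> by (simp add: field_simps)
  then have "\<alpha> * ((1 - \<alpha>) / (1 - ?c\<^sup>2)) < \<alpha> * ((1 - \<alpha> * \<theta>) / \<theta>)"
    using \<alpha> by (intro mult_strict_left_mono) auto
  moreover have "\<alpha> * ((1 - \<alpha> * \<theta>) / \<theta>) = \<alpha> / \<theta> - \<alpha>\<^sup>2"
    using \<theta> by (simp add: field_simps power2_eq_square)
  ultimately have "\<beta> < \<alpha> / \<theta>" by (simp add: \<beta>_def)
  moreover have "second_moment_bound \<beta>"
    using ge pos by (intro second_moment_boundI) (auto simp: \<beta>_def)
  moreover have "0 < \<beta>" using ge \<alpha> by (meson less_le_trans zero_less_power)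
  ultimately show ?thesis by blast
qed

end

section \<open>The random iteration\<close>

lemma (in prob_space) AE_summable:
  fixes f :: "nat \<Rightarrow> 'a \<Rightarrow> real"
  assumes f: "\<And>k. integrable M (f k)" "\<And>k \<omega>. 0 \<le> f k \<omega>"
    and sum: "summable (\<lambda>k. \<integral>\<omega>. f k \<omega> \<partial>M)"
  shows "AE \<omega> in M. summable (\<lambda>k. f k \<omega>)"
proof -
  have meas: "(\<lambda>\<omega>. ennreal (f k \<omega>)) \<in> borel_measurable M" for k
    using f(1)[of k] by simp
  have "(\<integral>\<^sup>+\<omega>. (\<Sum>k. ennreal (f k \<omega>)) \<partial>M) = (\<Sum>k. \<integral>\<^sup>+\<omega>. ennreal (f k \<omega>) \<partial>M)"
    by (rule nn_integral_suminf[OF meas])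
  also have "\<dots> = (\<Sum>k. ennreal (\<integral>\<omega>. f k \<omega> \<partial>M))"
    using f by (simp add: nn_integral_eq_integral)
  also have "\<dots> = ennreal (\<Sum>k. \<integral>\<omega>. f k \<omega> \<partial>M)"
    using f by (intro suminf_ennreal2 sum) simp
  finally have "(\<integral>\<^sup>+\<omega>. (\<Sum>k. ennreal (f k \<omega>)) \<partial>M) \<noteq> \<infinity>" by simp
  then have "AE \<omega> in M. (\<Sum>k. ennreal (f k \<omega>)) \<noteq> \<infinity>"
    using meas by (intro nn_integral_noteq_infinite) auto
  then show ?thesis
    by eventually_elim (use f(2) in \<open>auto intro!: summable_suminf_not_top\<close>)
qed

context metric_op
begin

lemma continuous_nm_square: "continuous_on UNIV (\<lambda>x. \<parallel>x - w\<parallel>\<^sup>2)"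
  unfolding nm_square inner_M_def
  by (intro continuous_intros bounded_linear.continuous_on[OF bounded_linear_M])

lemma continuous_ip: "continuous_on UNIV (\<lambda>x. \<langle>x - w, v\<rangle>)"
  unfolding inner_M_def by (intro continuous_intros)

lemma bounded_nm_square: "\<exists>C. \<forall>x. norm x \<le> B \<longrightarrow> \<bar>\<parallel>x - w\<parallel>\<^sup>2\<bar> \<le> C"
proof -
  obtain K where K: "0 < K" "\<And>x. \<parallel>x\<parallel> \<le> K * norm x" using nm_le_norm by blast
  have "\<bar>\<parallel>x - w\<parallel>\<^sup>2\<bar> \<le> (K * (B + norm w))\<^sup>2" if "norm x \<le> B" for x
  proof -
    have "\<parallel>x - w\<parallel> \<le> K * norm (x - w)" by (rule K)
    also have "\<dots> \<le> K * (B + norm w)"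
      using K that norm_triangle_ineq4[of x w] by (intro mult_left_mono) auto
    finally have "\<parallel>x - w\<parallel>\<^sup>2 \<le> (K * (B + norm w))\<^sup>2" by (rule power_mono) simp
    then show ?thesis by simp
  qed
  then show ?thesis by blast
qed

lemma bounded_ip: "\<exists>C. \<forall>x. norm x \<le> B \<longrightarrow> \<bar>\<langle>x - w, v\<rangle>\<bar> \<le> C"
proof -
  have "\<bar>\<langle>x - w, v\<rangle>\<bar> \<le> (B + norm w) * norm (M v)" if "norm x \<le> B" for x
  proof -
    have "\<bar>\<langle>x - w, v\<rangle>\<bar> \<le> norm (x - w) * norm (M v)"
      unfolding inner_M_def by (rule Cauchy_Schwarz_ineq2)
    also have "\<dots> \<le> (B + norm w) * norm (M v)"
      using that norm_triangle_ineq4[of x w] by (intro mult_right_mono) auto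
    finally show ?thesis .
  qed
  then show ?thesis by blast
qed

lemma integrable_nm_square:
  assumes "prob_space N" "unif_simple N Z"
  shows "integrable N (\<lambda>\<omega>. \<parallel>Z \<omega>\<parallel>\<^sup>2)"
proof -
  interpret N: prob_space N by fact
  show ?thesis
    using N.unif_simple_integrable[OF assms(2) continuous_nm_square[of 0] bounded_nm_square] by simp
qed

lemma integrable_ip:
  assumes "prob_space N" "unif_simple N Z"
  shows "integrable N (\<lambda>\<omega>. \<langle>Z \<omega>, v\<rangle>)"
proof -
  interpret N: prob_space N by fact
  show ?thesis
    using N.unif_simple_integrable[OF assms(2) continuous_ip[of 0] bounded_ip] by simp
qed

text \<open>
  The mean of \<open>\<parallel>Z - s w\<parallel>\<^sup>2\<close> is nonnegative for the best multiple \<open>s\<close>, as in the proof of Cauchy-Schwarz.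
\<close>

lemma expectation_ip_le:
  assumes N: "prob_space N" and Z: "unif_simple N Z"
  shows "\<bar>\<integral>\<omega>. \<langle>Z \<omega>, w\<rangle> \<partial>N\<bar> \<le> sqrt (\<integral>\<omega>. \<parallel>Z \<omega>\<parallel>\<^sup>2 \<partial>N) * \<parallel>w\<parallel>"
proof (cases "w = 0")
  case False
  interpret N: prob_space N by fact
  define m where "m = (\<integral>\<omega>. \<langle>Z \<omega>, w\<rangle> \<partial>N)"
  have w: "0 < \<parallel>w\<parallel>\<^sup>2" using False by (simp add: nm_square ip_self_pos)
  define s where "s = m / \<parallel>w\<parallel>\<^sup>2"
  have "0 \<le> (\<integral>\<omega>. \<parallel>Z \<omega> - s *\<^sub>R w\<parallel>\<^sup>2 \<partial>N)" by simp
  also have "\<dots> = (\<integral>\<omega>. \<parallel>Z \<omega>\<parallel>\<^sup>2 \<partial>N) - 2 * (s * m) + s\<^sup>2 * \<parallel>w\<parallel>\<^sup>2"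
    unfolding nm_square_diff
    by (simp add: ip_simps nm_scaleR power_mult_distrib integrable_nm_square[OF N Z]
        integrable_ip[OF N Z] N.prob_space m_def)
  also have "\<dots> = (\<integral>\<omega>. \<parallel>Z \<omega>\<parallel>\<^sup>2 \<partial>N) - m\<^sup>2 / \<parallel>w\<parallel>\<^sup>2"
    using False w unfolding s_def by (simp add: field_simps power2_eq_square)
  finally have "m\<^sup>2 \<le> (\<integral>\<omega>. \<parallel>Z \<omega>\<parallel>\<^sup>2 \<partial>N) * \<parallel>w\<parallel>\<^sup>2"
    using w by (simp add: field_simps)
  then have "sqrt (m\<^sup>2) \<le> sqrt ((\<integral>\<omega>. \<parallel>Z \<omega>\<parallel>\<^sup>2 \<partial>N) * \<parallel>w\<parallel>\<^sup>2)" by (rule real_sqrt_le_mono)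
  then show ?thesis by (simp add: real_sqrt_mult m_def)
qed (simp add: ip_simps)

end

locale selected_operator = cocoercive_op M S u + random_selection M E D \<alpha>
  for M :: "'a::{real_inner, banach} \<Rightarrow> 'a" and S :: "'a \<Rightarrow> 'a" and u :: 'a
    and E :: "'m::finite option \<Rightarrow> 'a set" and D :: "(real ^ 'm) measure" and \<alpha> :: real +
  fixes \<theta> :: real
  assumes \<theta>: "0 < \<theta>" and step_less: "\<alpha> * \<theta> < 1"
begin

definition move :: "real ^ 'm \<Rightarrow> 'a \<Rightarrow> 'a" where
  "move \<iota> z = z - \<theta> *\<^sub>R sel E \<alpha> \<iota> (S z)"

lemma step_pos: "0 < \<alpha> * \<theta>"
  using \<alpha> \<theta> by simp

lemma integral_ip_move:
  "(\<integral>\<iota>. \<langle>move \<iota> z - w, v\<rangle> \<partial>D) = \<langle>z - w, v\<rangle> - \<alpha> * \<theta> * \<langle>S z, v\<rangle>"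
proof -
  have eq: "\<langle>move \<iota> z - w, v\<rangle> = \<langle>z - w, v\<rangle> - \<theta> * \<langle>sel E \<alpha> \<iota> (S z), v\<rangle>" for \<iota>
    by (simp add: move_def ip_simps)
  show ?thesis
    unfolding eq using integrable_sel(2) by (simp add: integral_ip_sel D.prob_space)
qed

text \<open>
  The mean of a random step from \<open>z\<close> is the forward step from \<open>z\<close>, which cocoercivity brings closer to the
  forward step from \<open>y\<close>; the variance of the step costs a multiple of \<open>\<parallel>S z\<parallel>\<^sup>2\<close>.  Expanding \<open>\<parallel>S z\<parallel>\<^sup>2\<close> around
  \<open>S y\<close> charges its quadratic part to the gain from cocoercivity, which pays for it exactly when
  \<open>\<theta>\<^sup>2 \<beta> \<le> \<alpha> \<theta>\<close>.
\<close>

lemma integral_move_square_le: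
  assumes \<beta>: "second_moment_bound \<beta>"
  shows "(\<integral>\<iota>. \<parallel>move \<iota> z - (y - (\<alpha> * \<theta>) *\<^sub>R S y)\<parallel>\<^sup>2 \<partial>D)
    \<le> \<parallel>z - y\<parallel>\<^sup>2 - (\<alpha> * \<theta> - \<theta>\<^sup>2 * \<beta>) * \<parallel>S z - S y\<parallel>\<^sup>2
      + (\<theta>\<^sup>2 * \<beta> - (\<alpha> * \<theta>)\<^sup>2) * (2 * \<langle>S z - S y, S y\<rangle> + \<parallel>S y\<parallel>\<^sup>2)"
proof -
  let ?a = "\<alpha> * \<theta>"
  let ?w = "z - (y - ?a *\<^sub>R S y)"
  have eq: "\<parallel>move \<iota> z - (y - ?a *\<^sub>R S y)\<parallel>\<^sup>2
      = \<parallel>?w\<parallel>\<^sup>2 - 2 * \<theta> * \<langle>sel E \<alpha> \<iota> (S z), ?w\<rangle> + \<theta>\<^sup>2 * \<parallel>sel E \<alpha> \<iota> (S z)\<parallel>\<^sup>2" for \<iota>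
  proof -
    have "move \<iota> z - (y - ?a *\<^sub>R S y) = ?w - \<theta> *\<^sub>R sel E \<alpha> \<iota> (S z)" by (simp add: move_def)
    then show ?thesis
      by (simp only: nm_square_diff[of ?w] nm_scaleR power_mult_distrib ip_simps(6)
          ip_commute[of ?w "sel E \<alpha> \<iota> (S z)"]) simp
  qed
  have "(\<integral>\<iota>. \<parallel>move \<iota> z - (y - ?a *\<^sub>R S y)\<parallel>\<^sup>2 \<partial>D)
      = \<parallel>?w\<parallel>\<^sup>2 - 2 * \<theta> * (\<alpha> * \<langle>S z, ?w\<rangle>) + \<theta>\<^sup>2 * (\<integral>\<iota>. \<parallel>sel E \<alpha> \<iota> (S z)\<parallel>\<^sup>2 \<partial>D)"
    unfolding eq using integrable_sel by (simp add: integral_ip_sel D.prob_space)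
  also have "\<dots> \<le> \<parallel>?w\<parallel>\<^sup>2 - 2 * \<theta> * (\<alpha> * \<langle>S z, ?w\<rangle>) + \<theta>\<^sup>2 * (\<beta> * \<parallel>S z\<parallel>\<^sup>2)"
    using \<beta> unfolding second_moment_bound_def by (intro add_left_mono mult_left_mono) auto
  also have "\<dots> = \<parallel>z - y\<parallel>\<^sup>2 - ?a * (2 * \<langle>z - y, S z - S y\<rangle>) + ?a\<^sup>2 * \<parallel>S z - S y\<parallel>\<^sup>2
      + (\<theta>\<^sup>2 * \<beta> - ?a\<^sup>2) * \<parallel>S z\<parallel>\<^sup>2"
  proof -
    have w: "?w = (z - y) + ?a *\<^sub>R S y" by simp
    have "\<parallel>?w\<parallel>\<^sup>2 = \<parallel>z - y\<parallel>\<^sup>2 + 2 * ?a * \<langle>z - y, S y\<rangle> + ?a\<^sup>2 * \<parallel>S y\<parallel>\<^sup>2"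
      unfolding w nm_square_add[of "z - y"] nm_scaleR ip_simps(6) power_mult_distrib power2_abs by simp
    moreover have "\<langle>S z, ?w\<rangle> = \<langle>z - y, S z\<rangle> + ?a * \<langle>S z, S y\<rangle>"
      unfolding w ip_simps(2)[of "S z"] ip_simps(6) by (simp add: ip_commute[of "S z" "z - y"])
    ultimately show ?thesis
      unfolding nm_square_diff[of "S z" "S y"] ip_simps(4)[of "z - y"]
      by (simp add: algebra_simps power2_eq_square)
  qed
  also have "\<dots> \<le> \<parallel>z - y\<parallel>\<^sup>2 - ?a * \<parallel>S z - S y\<parallel>\<^sup>2 + ?a\<^sup>2 * \<parallel>S z - S y\<parallel>\<^sup>2
      + (\<theta>\<^sup>2 * \<beta> - ?a\<^sup>2) * \<parallel>S z\<parallel>\<^sup>2"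
    using mult_left_mono[OF cocoercive[of z y], of ?a] step_pos by linarith
  also have "\<parallel>S z\<parallel>\<^sup>2 = \<parallel>S z - S y\<parallel>\<^sup>2 + (2 * \<langle>S z - S y, S y\<rangle> + \<parallel>S y\<parallel>\<^sup>2)"
    using nm_square_add[of "S z - S y" "S y"] by simp
  finally show ?thesis by (simp add: algebra_simps)
qed

lemma S_uniformly_continuous: "uniformly_continuous_on UNIV S"
proof -
  obtain K where K: "0 < K" "\<And>x. \<parallel>x\<parallel> \<le> K * norm x" using nm_le_norm by blast
  obtain L where L: "0 < L" "\<And>x. norm x \<le> L * \<parallel>x\<parallel>" using norm_le_nm by blast
  have "(L * (2 * K))-lipschitz_on UNIV S"
  proof (rule lipschitz_onI)
    fix x y
    have "norm (S x - S y) \<le> L * \<parallel>S x - S y\<parallel>" by (rule L)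
    also have "\<dots> \<le> L * (2 * \<parallel>x - y\<parallel>)" using L by (intro mult_left_mono S_lipschitz) auto
    also have "\<dots> \<le> L * (2 * (K * norm (x - y)))" using L K by (intro mult_left_mono) auto
    finally show "dist (S x) (S y) \<le> L * (2 * K) * dist x y" by (simp add: dist_norm)
  qed (use K L in auto)
  then show ?thesis by (rule lipschitz_on_uniformly_continuous)
qed

lemma unif_simple_move:
  assumes z: "unif_simple N z" and r: "\<And>i. unif_simple N (\<lambda>\<omega>. r \<omega> $ i)"
  shows "unif_simple N (\<lambda>\<omega>. move (r \<omega>) (z \<omega>))"
proof -
  have Sz: "unif_simple N (\<lambda>\<omega>. S (z \<omega>))"
    by (rule unif_simple_uniformly_continuous[OF z S_uniformly_continuous])
  have c: "unif_simple N (\<lambda>\<omega>. component E j (S (z \<omega>)))" for j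
    by (rule unif_simple_bounded_linear[OF Sz bounded_linear_component[OF direct_sum]])
  show ?thesis
    unfolding move_def sel_def
    by (intro unif_simple_diff unif_simple_add unif_simple_sum unif_simple_scaleR
        unif_simple_const z c r)
qed

lemma continuous_move: "continuous_on UNIV (\<lambda>\<iota>. move \<iota> z)"
  unfolding move_def sel_def by (intro continuous_intros)

lemma sel_bounded:
  "\<exists>K\<ge>0. \<forall>\<iota> x. (\<forall>i. 0 \<le> \<iota> $ i \<and> \<iota> $ i \<le> 1) \<longrightarrow> \<parallel>sel E \<alpha> \<iota> x\<parallel> \<le> K * \<parallel>x\<parallel>"
proof -
  obtain K where K: "0 < K" "\<And>x. \<parallel>x\<parallel> \<le> K * norm x" using nm_le_norm by blast
  obtain L where L: "0 < L" "\<And>x. norm x \<le> L * \<parallel>x\<parallel>" using norm_le_nm by blast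
  have "\<exists>B\<ge>0. \<forall>x. norm (component E j x) \<le> norm x * B" for j
    using bounded_linear.nonneg_bounded[OF bounded_linear_component[OF direct_sum]] by blast
  then obtain B where B: "\<And>j. 0 \<le> B j" "\<And>j x. norm (component E j x) \<le> norm x * B j" by metis
  have comp: "\<parallel>component E j x\<parallel> \<le> (K * L * B j) * \<parallel>x\<parallel>" for j x
  proof -
    have "\<parallel>component E j x\<parallel> \<le> K * norm (component E j x)" by (rule K)
    also have "\<dots> \<le> K * (norm x * B j)" using K B by (intro mult_left_mono) auto
    also have "\<dots> \<le> K * ((L * \<parallel>x\<parallel>) * B j)" using K L B by (intro mult_left_mono mult_right_mono) auto
    finally show ?thesis by (simp add: mult_ac)
  qed
  define A where "A = (\<Sum>j\<in>UNIV. K * L * B j)"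
  have "0 \<le> A" unfolding A_def using K L B by (intro sum_nonneg) auto
  moreover have "\<parallel>sel E \<alpha> \<iota> x\<parallel> \<le> A * \<parallel>x\<parallel>" if \<iota>: "\<forall>i. 0 \<le> \<iota> $ i \<and> \<iota> $ i \<le> 1" for \<iota> x
  proof -
    have "\<parallel>sel E \<alpha> \<iota> x\<parallel> \<le> \<parallel>\<alpha> *\<^sub>R component E None x\<parallel> + (\<Sum>i\<in>UNIV. \<parallel>(\<iota> $ i) *\<^sub>R component E (Some i) x\<parallel>)"
      unfolding sel_def by (intro order_trans[OF nm_triangle] add_left_mono nm_sum)
    also have "\<dots> \<le> \<parallel>component E None x\<parallel> + (\<Sum>i\<in>UNIV. \<parallel>component E (Some i) x\<parallel>)"
      using \<alpha> \<iota> by (intro add_mono sum_mono) (auto simp: nm_scaleR intro!: mult_left_le_one_le)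
    also have "\<dots> = (\<Sum>j\<in>UNIV. \<parallel>component E j x\<parallel>)" by (simp add: sum_UNIV_option)
    also have "\<dots> \<le> A * \<parallel>x\<parallel>" unfolding A_def sum_distrib_right by (intro sum_mono comp)
    finally show ?thesis .
  qed
  ultimately show ?thesis by blast
qed

end

locale random_iteration = selected_operator M S u E D \<alpha> \<theta>
  for M :: "'a::{real_inner, banach} \<Rightarrow> 'a" and S :: "'a \<Rightarrow> 'a" and u :: 'a
    and E :: "'m::finite option \<Rightarrow> 'a set" and D :: "(real ^ 'm) measure" and \<alpha> \<theta> :: real +
  fixes P :: "'w measure" and \<I> :: "nat \<Rightarrow> 'w \<Rightarrow> real ^ 'm" and x :: "nat \<Rightarrow> 'w \<Rightarrow> 'a" and x0 :: 'a
  assumes prob_P: "prob_space P"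
    and indep: "prob_space.indep_vars P (\<lambda>_. borel) \<I> UNIV"
    and ident: "\<And>k. distr P borel (\<I> k) = D"
    and range: "\<And>k \<omega> i. \<omega> \<in> space P \<Longrightarrow> 0 \<le> \<I> k \<omega> $ i \<and> \<I> k \<omega> $ i \<le> 1"
    and x_0: "\<And>\<omega>. \<omega> \<in> space P \<Longrightarrow> x 0 \<omega> = x0"
    and x_Suc: "\<And>k \<omega>. \<omega> \<in> space P \<Longrightarrow> x (Suc k) \<omega> = move (\<I> k \<omega>) (x k \<omega>)"
begin

sublocale P: prob_space P by (rule prob_P)

lemma selections_measurable: "\<I> k \<in> borel_measurable P"
  using indep unfolding P.indep_vars_def by simp

text \<open>
  Selections lie in the unit cube, where \<open>clip\<close> is the identity.  It makes the iterates bounded functions on the whole product space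
  of past selections.
\<close>

definition clip :: "real ^ 'm \<Rightarrow> real ^ 'm" where
  "clip \<iota> = (\<chi> i. max 0 (min 1 (\<iota> $ i)))"

lemma clip_id: "(\<And>i. 0 \<le> \<iota> $ i \<and> \<iota> $ i \<le> 1) \<Longrightarrow> clip \<iota> = \<iota>"
  by (simp add: clip_def vec_eq_iff)

lemma continuous_clip: "continuous_on UNIV clip"
  unfolding clip_def by (intro continuous_intros continuous_on_vec_lambda)

lemma unif_simple_clip:
  assumes "f \<in> borel_measurable N" shows "unif_simple N (\<lambda>\<omega>. clip (f \<omega>) $ i)"
proof (rule unif_simple_unit_interval)
  show "(\<lambda>\<omega>. clip (f \<omega>) $ i) \<in> borel_measurable N"
    by (rule borel_measurable_continuous_on[OF _ assms])
       (intro continuous_intros continuous_clip)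
qed (auto simp: clip_def)

abbreviation past :: "nat \<Rightarrow> 'w \<Rightarrow> nat \<Rightarrow> real ^ 'm" where
  "past k \<omega> \<equiv> restrict (\<lambda>i. \<I> i \<omega>) {..<k}"

lemma past_measurable: "past k \<in> measurable P (PiM {..<k} (\<lambda>_. borel))"
  by (intro measurable_restrict selections_measurable)

text \<open>
  The iterate is a function of the earlier selections only, hence independent of the next one.
\<close>

lemma iterate_of_past:
  "\<exists>\<Phi>. unif_simple (PiM {..<k} (\<lambda>_. borel)) \<Phi> \<and> (\<forall>\<omega>\<in>space P. x k \<omega> = \<Phi> (past k \<omega>))"
proof (induction k)
  case 0
  show ?case by (intro exI[of _ "\<lambda>_. x0"]) (auto simp: unif_simple_const x_0)
next
  case (Suc k)
  then obtain \<Phi> where \<Phi>: "unif_simple (PiM {..<k} (\<lambda>_. borel)) \<Phi>"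
    "\<forall>\<omega>\<in>space P. x k \<omega> = \<Phi> (past k \<omega>)" by blast
  let ?\<Phi> = "\<lambda>s. move (clip (s k)) (\<Phi> (restrict s {..<k}))"
  have "unif_simple (PiM {..<Suc k} (\<lambda>_. borel)) ?\<Phi>"
  proof (intro unif_simple_move unif_simple_clip)
    show "unif_simple (PiM {..<Suc k} (\<lambda>_. borel)) (\<lambda>s. \<Phi> (restrict s {..<k}))"
      by (rule unif_simple_comp[OF \<Phi>(1) measurable_restrict_subset]) auto
    show "(\<lambda>s. s k) \<in> borel_measurable (PiM {..<Suc k} (\<lambda>_. borel))"
      by (rule measurable_component_singleton) simp
  qed
  moreover have "x (Suc k) \<omega> = ?\<Phi> (past (Suc k) \<omega>)" if \<omega>: "\<omega> \<in> space P" for \<omega>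
  proof -
    have "restrict (past (Suc k) \<omega>) {..<k} = past k \<omega>"
      by (auto simp: restrict_def fun_eq_iff)
    then show ?thesis
      using \<omega> \<Phi>(2) clip_id[OF range[OF \<omega>]] by (simp add: x_Suc)
  qed
  ultimately show ?case by blast
qed

lemma unif_simple_x: "unif_simple P (x k)"
proof -
  obtain \<Phi> where \<Phi>: "unif_simple (PiM {..<k} (\<lambda>_. borel)) \<Phi>"
    "\<forall>\<omega>\<in>space P. x k \<omega> = \<Phi> (past k \<omega>)" using iterate_of_past by blast
  have "unif_simple P (\<lambda>\<omega>. \<Phi> (past k \<omega>))"
    by (rule unif_simple_comp[OF \<Phi>(1) past_measurable])
  then show ?thesis using \<Phi>(2) unfolding unif_simple_def by metis
qed

lemma unif_simple_Sx: "unif_simple P (\<lambda>\<omega>. S (x k \<omega>))"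
  by (rule unif_simple_uniformly_continuous[OF unif_simple_x S_uniformly_continuous])

text \<open>
  Conditioning on the past, written as Fubini's theorem for the joint law of the past and the next
  selection, which is a product measure by independence.
\<close>

lemma expectation_step:
  fixes \<phi> :: "'a \<Rightarrow> real"
  assumes \<phi>: "continuous_on UNIV \<phi>" and bnd: "\<And>B. \<exists>C. \<forall>x. norm x \<le> B \<longrightarrow> \<bar>\<phi> x\<bar> \<le> C"
  shows "integrable P (\<lambda>\<omega>. \<integral>\<iota>. \<phi> (move \<iota> (x k \<omega>)) \<partial>D)"
    and "(\<integral>\<omega>. \<phi> (x (Suc k) \<omega>) \<partial>P) = (\<integral>\<omega>. (\<integral>\<iota>. \<phi> (move \<iota> (x k \<omega>)) \<partial>D) \<partial>P)"
proof -
  obtain \<Phi> where \<Phi>: "unif_simple (PiM {..<k} (\<lambda>_. borel)) \<Phi>"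
    "\<forall>\<omega>\<in>space P. x k \<omega> = \<Phi> (past k \<omega>)" using iterate_of_past by blast
  let ?A = "PiM {..<k} (\<lambda>_. borel) :: (nat \<Rightarrow> real ^ 'm) measure"
  let ?B = "PiM {k} (\<lambda>_. borel) :: (nat \<Rightarrow> real ^ 'm) measure"
  let ?now = "\<lambda>\<omega>. restrict (\<lambda>i. \<I> i \<omega>) {k}"
  define Q where "Q = distr P ?A (past k)"
  define R where "R = distr P ?B ?now"
  define G where "G p = \<phi> (move (clip (snd p k)) (\<Phi> (fst p)))" for p
  define F where "F z = (\<integral>\<iota>. \<phi> (move \<iota> z) \<partial>D)" for z
  have now: "?now \<in> measurable P ?B"
    by (intro measurable_restrict selections_measurable)
  have coord: "(\<lambda>s. s k) \<in> borel_measurable ?B"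
    by (rule measurable_component_singleton) simp
  have R_D: "distr R borel (\<lambda>s. s k) = D"
    unfolding R_def by (subst distr_distr[OF coord now]) (simp add: comp_def ident)
  interpret Q: prob_space Q unfolding Q_def by (rule P.prob_space_distr[OF past_measurable])
  interpret R: prob_space R unfolding R_def by (rule P.prob_space_distr[OF now])
  interpret QR: pair_prob_space Q R ..
  have "P.indep_var ?A (past k) ?B ?now"
    by (rule P.indep_var_restrict[OF indep]) auto
  then have joint: "Q \<Otimes>\<^sub>M R = distr P (?A \<Otimes>\<^sub>M ?B) (\<lambda>\<omega>. (past k \<omega>, ?now \<omega>))"
    unfolding P.indep_var_distribution_eq Q_def R_def by simp
  have past': "(\<lambda>\<omega>. (past k \<omega>, ?now \<omega>)) \<in> measurable P (?A \<Otimes>\<^sub>M ?B)"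
    by (intro measurable_Pair past_measurable now)
  have inner: "unif_simple (?A \<Otimes>\<^sub>M ?B) (\<lambda>p. move (clip (snd p k)) (\<Phi> (fst p)))"
    by (intro unif_simple_move unif_simple_clip unif_simple_comp[OF \<Phi>(1)]
        measurable_compose[OF measurable_snd coord] measurable_fst)
  have G_meas: "G \<in> borel_measurable (?A \<Otimes>\<^sub>M ?B)"
    unfolding G_def
    by (rule borel_measurable_continuous_on[OF \<phi> unif_simple_borel_measurable[OF inner]])
  have "unif_simple (Q \<Otimes>\<^sub>M R) (\<lambda>p. move (clip (snd p k)) (\<Phi> (fst p)))"
    using unif_simple_comp[OF inner, of "\<lambda>p. p" "Q \<Otimes>\<^sub>M R"] by (simp add: joint)
  then have G_int: "integrable (Q \<Otimes>\<^sub>M R) G"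
    unfolding G_def by (rule QR.unif_simple_integrable[OF _ \<phi> bnd])
  have F_eq: "(\<integral>t. G (s, t) \<partial>R) = F (\<Phi> s)" for s
  proof -
    have m: "(\<lambda>\<iota>. \<phi> (move \<iota> z)) \<in> borel_measurable borel" for z
      using continuous_on_compose2[OF \<phi> continuous_move]
      by (intro borel_measurable_continuous_onI) auto
    have mc: "(\<lambda>\<iota>. \<phi> (move (clip \<iota>) z)) \<in> borel_measurable borel" for z
      by (rule measurable_compose[OF borel_measurable_continuous_onI[OF continuous_clip] m])
    have "(\<integral>t. G (s, t) \<partial>R) = (\<integral>\<iota>. \<phi> (move (clip \<iota>) (\<Phi> s)) \<partial>distr R borel (\<lambda>s. s k))"
      unfolding G_def fst_conv snd_conv
      by (rule integral_distr[symmetric, OF _ mc]) (use coord in \<open>simp add: R_def\<close>)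
    also have "\<dots> = F (\<Phi> s)"
      unfolding R_D F_def
    proof (rule integral_cong_AE)
      show "AE \<iota> in D. \<phi> (move (clip \<iota>) (\<Phi> s)) = \<phi> (move \<iota> (\<Phi> s))"
        using unit_D by eventually_elim (simp add: clip_id)
    qed (intro measurable_D m mc)+
    finally show ?thesis .
  qed
  have F_int: "integrable Q (\<lambda>s. F (\<Phi> s))"
    using QR.integrable_fst'[OF G_int] unfolding F_eq .
  have F_P: "integrable P (\<lambda>\<omega>. F (\<Phi> (past k \<omega>)))"
    using integrable_distr[OF past_measurable F_int[unfolded Q_def]] .
  show "integrable P (\<lambda>\<omega>. \<integral>\<iota>. \<phi> (move \<iota> (x k \<omega>)) \<partial>D)"
    using F_P unfolding F_def by (rule Bochner_Integration.integrable_cong[THEN iffD1, rotated 2]) (auto simp: \<Phi>(2))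
  have "(\<integral>\<omega>. \<phi> (x (Suc k) \<omega>) \<partial>P) = (\<integral>\<omega>. G (past k \<omega>, ?now \<omega>) \<partial>P)"
    using \<Phi>(2) clip_id[OF range] by (intro Bochner_Integration.integral_cong) (auto simp: G_def x_Suc)
  also have "\<dots> = integral\<^sup>L (Q \<Otimes>\<^sub>M R) G"
    unfolding joint by (rule integral_distr[OF past' G_meas, symmetric])
  also have "\<dots> = (\<integral>s. F (\<Phi> s) \<partial>Q)"
    using QR.integral_fst'[OF G_int] unfolding F_eq by simp
  also have "\<dots> = (\<integral>\<omega>. F (\<Phi> (past k \<omega>)) \<partial>P)"
    unfolding Q_def using F_int[unfolded Q_def]
    by (intro integral_distr past_measurable) (auto dest: borel_measurable_integrable)
  also have "\<dots> = (\<integral>\<omega>. F (x k \<omega>) \<partial>P)"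
    using \<Phi>(2) by (intro Bochner_Integration.integral_cong) auto
  finally show "(\<integral>\<omega>. \<phi> (x (Suc k) \<omega>) \<partial>P) = (\<integral>\<omega>. (\<integral>\<iota>. \<phi> (move \<iota> (x k \<omega>)) \<partial>D) \<partial>P)"
    unfolding F_def .
qed

end

section \<open>Distance to a deterministic trajectory\<close>

text \<open>
  The random iteration is compared with a deterministic trajectory \<open>y\<close> of the mean dynamics, which may
  start anywhere.
\<close>

locale shadowed_iteration = random_iteration M S u E D \<alpha> \<theta> P \<I> x x0
  for M :: "'a::{real_inner, banach} \<Rightarrow> 'a" and S :: "'a \<Rightarrow> 'a" and u :: 'a
    and E :: "'m::finite option \<Rightarrow> 'a set" and D :: "(real ^ 'm) measure" and \<alpha> \<theta> :: real
    and P :: "'w measure" and \<I> :: "nat \<Rightarrow> 'w \<Rightarrow> real ^ 'm" and x :: "nat \<Rightarrow> 'w \<Rightarrow> 'a" and x0 :: 'a +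
  fixes \<beta> :: real and y :: "nat \<Rightarrow> 'a"
  assumes second_moment: "second_moment_bound \<beta>"
    and \<beta>_ge: "\<alpha>\<^sup>2 \<le> \<beta>" and \<beta>_le: "\<beta> \<le> \<alpha> / \<theta>"
    and y_Suc: "\<And>k. y (Suc k) = y k - (\<alpha> * \<theta>) *\<^sub>R S (y k)"
begin

definition dist_sq :: "nat \<Rightarrow> real" where
  "dist_sq k = (\<integral>\<omega>. \<parallel>x k \<omega> - y k\<parallel>\<^sup>2 \<partial>P)"

definition disp_sq :: "nat \<Rightarrow> real" where
  "disp_sq k = (\<integral>\<omega>. \<parallel>S (x k \<omega>) - S (y k)\<parallel>\<^sup>2 \<partial>P)"

abbreviation a :: real where "a \<equiv> \<alpha> * \<theta>"

text \<open>
  In the recursion for the mean squared distance, \<open>slack\<close> is the remaining gain from cocoercivity and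
  \<open>noise\<close> the cost of the variance of a step.
\<close>

definition slack :: real where "slack = a - \<theta>\<^sup>2 * \<beta>"

definition noise :: real where "noise = \<theta>\<^sup>2 * \<beta> - a\<^sup>2"

lemma noise_eq: "noise = \<theta>\<^sup>2 * (\<beta> - \<alpha>\<^sup>2)"
  by (simp add: noise_def power_mult_distrib algebra_simps)

lemma noise_nonneg: "0 \<le> noise"
  unfolding noise_eq using \<beta>_ge by simp

lemma slack_eq: "slack = \<theta>\<^sup>2 * (\<alpha> / \<theta> - \<beta>)"
  using \<theta> by (simp add: slack_def power2_eq_square algebra_simps)

lemma slack_nonneg: "0 \<le> slack"
  unfolding slack_eq using \<beta>_le by simp

lemmas unif_simple_errors =
  unif_simple_diff[OF unif_simple_x unif_simple_const]
  unif_simple_diff[OF unif_simple_Sx unif_simple_const]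

lemma integrable_errors:
  "integrable P (\<lambda>\<omega>. \<parallel>x k \<omega> - w\<parallel>\<^sup>2)" "integrable P (\<lambda>\<omega>. \<parallel>S (x k \<omega>) - w\<parallel>\<^sup>2)"
  "integrable P (\<lambda>\<omega>. \<langle>x k \<omega> - w, v\<rangle>)" "integrable P (\<lambda>\<omega>. \<langle>S (x k \<omega>) - w, v\<rangle>)"
  by (intro integrable_nm_square integrable_ip prob_P unif_simple_errors)+

lemma dist_sq_nonneg: "0 \<le> dist_sq k" and disp_sq_nonneg: "0 \<le> disp_sq k"
  by (simp_all add: dist_sq_def disp_sq_def)

lemma disp_sq_le: "disp_sq k \<le> 4 * dist_sq k"
proof -
  have "\<parallel>S (x k \<omega>) - S (y k)\<parallel>\<^sup>2 \<le> 4 * \<parallel>x k \<omega> - y k\<parallel>\<^sup>2" for \<omega>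
    using power_mono[OF S_lipschitz, of "x k \<omega>" "y k" 2] by (simp add: power_mult_distrib)
  then have "disp_sq k \<le> (\<integral>\<omega>. 4 * \<parallel>x k \<omega> - y k\<parallel>\<^sup>2 \<partial>P)"
    unfolding disp_sq_def by (intro integral_mono integrable_errors integrable_mult_right) auto
  then show ?thesis by (simp add: dist_sq_def)
qed

lemma dist_sq_Suc:
  "dist_sq (Suc k) \<le> dist_sq k - slack * disp_sq k
    + noise * (2 * (\<integral>\<omega>. \<langle>S (x k \<omega>) - S (y k), S (y k)\<rangle> \<partial>P) + \<parallel>S (y k)\<parallel>\<^sup>2)"
proof -
  let ?F = "\<lambda>z. \<integral>\<iota>. \<parallel>move \<iota> z - y (Suc k)\<parallel>\<^sup>2 \<partial>D"
  let ?G = "\<lambda>z. \<parallel>z - y k\<parallel>\<^sup>2 - slack * \<parallel>S z - S (y k)\<parallel>\<^sup>2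
      + noise * (2 * \<langle>S z - S (y k), S (y k)\<rangle> + \<parallel>S (y k)\<parallel>\<^sup>2)"
  note step = expectation_step[OF continuous_nm_square bounded_nm_square, of k "y (Suc k)"]
  have "dist_sq (Suc k) = (\<integral>\<omega>. ?F (x k \<omega>) \<partial>P)" unfolding dist_sq_def by (rule step(2))
  also have "\<dots> \<le> (\<integral>\<omega>. ?G (x k \<omega>) \<partial>P)"
  proof (rule integral_mono[OF step(1)])
    show "integrable P (\<lambda>\<omega>. ?G (x k \<omega>))"
      by (intro Bochner_Integration.integrable_add Bochner_Integration.integrable_diff
          integrable_mult_right integrable_errors) auto
    show "?F (x k \<omega>) \<le> ?G (x k \<omega>)" for \<omega>
      using integral_move_square_le[OF second_moment, of "x k \<omega>" "y k"]
      unfolding y_Suc slack_def noise_def .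
  qed
  also have "\<dots> = dist_sq k - slack * disp_sq k
    + noise * (2 * (\<integral>\<omega>. \<langle>S (x k \<omega>) - S (y k), S (y k)\<rangle> \<partial>P) + \<parallel>S (y k)\<parallel>\<^sup>2)"
    by (simp add: integrable_errors dist_sq_def disp_sq_def P.prob_space)
  finally show ?thesis .
qed

definition drift :: "nat \<Rightarrow> real" where
  "drift k = (\<integral>\<omega>. \<langle>x k \<omega> - y k, u\<rangle> \<partial>P)"

lemma drift_Suc: "drift (Suc k) = drift k - a * (\<integral>\<omega>. \<langle>S (x k \<omega>) - S (y k), u\<rangle> \<partial>P)"
proof -
  note step = expectation_step(2)[OF continuous_ip bounded_ip, of k "y (Suc k)" u]
  have eq: "\<langle>z - y (Suc k), u\<rangle> - a * \<langle>S z, u\<rangle> = \<langle>z - y k, u\<rangle> - a * \<langle>S z - S (y k), u\<rangle>" for z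
    by (simp add: y_Suc ip_simps algebra_simps)
  have "drift (Suc k) = (\<integral>\<omega>. \<langle>x k \<omega> - y k, u\<rangle> - a * \<langle>S (x k \<omega>) - S (y k), u\<rangle> \<partial>P)"
    unfolding drift_def step integral_ip_move eq ..
  then show ?thesis by (simp add: integrable_errors drift_def)
qed

lemma drift_le: "\<bar>drift k\<bar> \<le> sqrt (dist_sq k) * \<parallel>u\<parallel>"
  unfolding drift_def dist_sq_def by (intro expectation_ip_le prob_P unif_simple_errors)

text \<open>
  The cross term of the recursion is close to a multiple of the mean of \<open>\<langle>S x\<^sub>k - S y\<^sub>k, u\<rangle>\<close>, which is minus
  the increment of \<open>drift\<close> divided by the step size.  Adding this multiple of \<open>drift\<close> to the distance
  removes the cross term, and by \<open>drift_le\<close> it changes the distance only by the order of its square root.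
\<close>

definition corrected :: "nat \<Rightarrow> real" where
  "corrected k = dist_sq k + (2 * noise / a) * drift k"

definition gap :: "nat \<Rightarrow> real" where
  "gap k = \<parallel>S (y k) - u\<parallel>"

lemma gap_tendsto: "gap \<longlonglongrightarrow> 0"
  using forward_displacement_tendsto[where y=y, OF step_pos step_less y_Suc] unfolding gap_def .

lemma near_corrected: "dist_sq k - (2 * noise / a * \<parallel>u\<parallel>) * sqrt (dist_sq k) \<le> corrected k"
proof -
  have "(2 * noise / a) * \<bar>drift k\<bar> \<le> (2 * noise / a) * (sqrt (dist_sq k) * \<parallel>u\<parallel>)"
    using noise_nonneg step_pos by (intro mult_left_mono drift_le) auto
  moreover have "(2 * noise / a) * (- \<bar>drift k\<bar>) \<le> (2 * noise / a) * drift k"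
    using noise_nonneg step_pos by (intro mult_left_mono) auto
  ultimately show ?thesis unfolding corrected_def by (simp add: algebra_simps)
qed

lemma corrected_Suc:
  "corrected (Suc k) \<le> corrected k - slack * disp_sq k
    + noise * (2 * (sqrt (disp_sq k) * gap k) + \<parallel>S (y k)\<parallel>\<^sup>2)"
proof -
  let ?q = "\<integral>\<omega>. \<langle>S (x k \<omega>) - S (y k), u\<rangle> \<partial>P"
  let ?r = "\<integral>\<omega>. \<langle>S (x k \<omega>) - S (y k), S (y k) - u\<rangle> \<partial>P"
  have split: "(\<integral>\<omega>. \<langle>S (x k \<omega>) - S (y k), S (y k)\<rangle> \<partial>P) = ?q + ?r"
    by (simp add: ip_simps(4) integrable_errors)
  have "?r \<le> sqrt (disp_sq k) * gap k"
    using expectation_ip_le[OF prob_P unif_simple_errors(2), of k "S (y k)" "S (y k) - u"]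
    unfolding disp_sq_def gap_def by linarith
  then have "noise * (2 * (?q + ?r) + \<parallel>S (y k)\<parallel>\<^sup>2)
      \<le> noise * (2 * (?q + sqrt (disp_sq k) * gap k) + \<parallel>S (y k)\<parallel>\<^sup>2)"
    using noise_nonneg by (intro mult_left_mono) auto
  moreover have "(2 * noise / a) * drift (Suc k) = (2 * noise / a) * drift k - 2 * noise * ?q"
    unfolding drift_Suc right_diff_distrib using \<alpha>(1) \<theta> by simp
  ultimately show ?thesis
    using dist_sq_Suc[of k] unfolding split corrected_def by (simp add: algebra_simps)
qed

text \<open>
  As \<open>slack\<close> may vanish, nothing controls \<open>disp_sq\<close> except Lipschitz continuity of \<open>S\<close>; since \<open>gap\<close> tends to 0, this
  still leaves increments of order \<open>o(sqrt (dist_sq k))\<close> and a constant.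
\<close>

theorem dist_sublinear: "(\<lambda>k. sqrt (dist_sq k) / real k) \<longlonglongrightarrow> 0"
proof (rule sqrt_sublinear[where c="2 * noise / a * \<parallel>u\<parallel>" and f=corrected
      and e="\<lambda>k. 4 * noise * gap k" and N="noise * \<parallel>S (y 0)\<parallel>\<^sup>2"])
  show "0 \<le> 2 * noise / a * \<parallel>u\<parallel>" using noise_nonneg step_pos by simp
  show "0 \<le> noise * \<parallel>S (y 0)\<parallel>\<^sup>2" using noise_nonneg by simp
  show "(\<lambda>k. 4 * noise * gap k) \<longlonglongrightarrow> 0" by (rule tendsto_mult_right_zero[OF gap_tendsto])
  show "corrected (Suc k) \<le> corrected k + 4 * noise * gap k * sqrt (dist_sq k) + noise * \<parallel>S (y 0)\<parallel>\<^sup>2" for k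
  proof -
    have "sqrt (disp_sq k) \<le> 2 * sqrt (dist_sq k)"
      using real_sqrt_le_mono[OF disp_sq_le[of k]] by (simp add: real_sqrt_mult)
    then have "noise * (2 * (sqrt (disp_sq k) * gap k)) \<le> noise * (2 * (2 * sqrt (dist_sq k) * gap k))"
      using noise_nonneg by (intro mult_left_mono mult_right_mono) (auto simp: gap_def)
    moreover have "noise * \<parallel>S (y k)\<parallel>\<^sup>2 \<le> noise * \<parallel>S (y 0)\<parallel>\<^sup>2"
      using noise_nonneg forward_bounded[where y=y and k=k, OF step_pos step_less y_Suc]
      by (intro mult_left_mono power_mono) auto
    moreover have "0 \<le> slack * disp_sq k" using slack_nonneg disp_sq_nonneg by simp
    ultimately show ?thesis using corrected_Suc[of k] by (simp add: algebra_simps)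
  qed
qed (rule dist_sq_nonneg near_corrected)+

text \<open>
  With positive \<open>slack\<close> the term with \<open>gap\<close> is absorbed by Young's inequality, and the increments tend
  to \<open>noise * \<parallel>u\<parallel>\<^sup>2\<close>.
\<close>

theorem dist_eventually_le:
  assumes \<beta>: "\<beta> < \<alpha> / \<theta>" and \<eta>: "0 < \<eta>"
  shows "\<forall>\<^sub>F k in sequentially. dist_sq k \<le> (noise * \<parallel>u\<parallel>\<^sup>2 + \<eta>) * real k"
proof (rule eventually_le_linear_perturbed[OF near_corrected _ _ dist_sublinear \<eta>])
  have slack: "0 < slack" unfolding slack_eq using \<beta> \<theta> by simp
  show "corrected (Suc k) \<le> corrected k + (noise * \<parallel>S (y k)\<parallel>\<^sup>2 + (noise * gap k)\<^sup>2 / slack)" for k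
    using corrected_Suc[of k] young[OF slack, of "sqrt (disp_sq k)" "noise * gap k"] disp_sq_nonneg[of k]
    by (simp add: algebra_simps)
  have "(\<lambda>k. \<parallel>S (y k)\<parallel> - \<parallel>u\<parallel>) \<longlonglongrightarrow> 0"
  proof (rule Lim_null_comparison[OF always_eventually gap_tendsto], rule allI)
    show "norm (\<parallel>S (y k)\<parallel> - \<parallel>u\<parallel>) \<le> gap k" for k
      using nm_triangle_sub[of "S (y k)" u] minimal_nm[of "y k"] by (simp add: gap_def)
  qed
  then have "(\<lambda>k. \<parallel>S (y k)\<parallel>) \<longlonglongrightarrow> \<parallel>u\<parallel>" by (simp add: LIM_zero_iff)
  then have "(\<lambda>k. noise * \<parallel>S (y k)\<parallel>\<^sup>2 + (noise * gap k)\<^sup>2 / slack)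
      \<longlonglongrightarrow> noise * \<parallel>u\<parallel>\<^sup>2 + (noise * 0)\<^sup>2 / slack"
    using slack by (intro tendsto_intros gap_tendsto) auto
  then show "(\<lambda>k. noise * \<parallel>S (y k)\<parallel>\<^sup>2 + (noise * gap k)\<^sup>2 / slack) \<longlonglongrightarrow> noise * \<parallel>u\<parallel>\<^sup>2"
    by simp
qed

text \<open>
  For the almost sure statement the size of the constant does not matter, but part of \<open>slack\<close> is kept: it controls
  how far the iterates move.
\<close>

lemma dist_sq_descent:
  assumes \<beta>: "\<beta> < \<alpha> / \<theta>"
  shows "\<exists>C\<ge>0. \<forall>k. dist_sq (Suc k) \<le> dist_sq k - slack / 2 * disp_sq k + C"
proof -
  define s where "s = slack / 2"
  have s: "0 < s" unfolding s_def slack_eq using \<beta> \<theta> by simp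
  define N where "N = \<parallel>S (y 0)\<parallel>"
  define C where "C = (noise * N)\<^sup>2 / s + noise * N\<^sup>2"
  have "0 \<le> C" using s noise_nonneg by (simp add: C_def)
  moreover have "dist_sq (Suc k) \<le> dist_sq k - slack / 2 * disp_sq k + C" for k
  proof -
    have N: "\<parallel>S (y k)\<parallel> \<le> N"
      unfolding N_def by (rule forward_bounded[where y=y, OF step_pos step_less y_Suc])
    let ?r = "\<integral>\<omega>. \<langle>S (x k \<omega>) - S (y k), S (y k)\<rangle> \<partial>P"
    have "?r \<le> sqrt (disp_sq k) * \<parallel>S (y k)\<parallel>"
      using expectation_ip_le[OF prob_P unif_simple_errors(2), of k "S (y k)" "S (y k)"]
      unfolding disp_sq_def by linarith
    also have "\<dots> \<le> sqrt (disp_sq k) * N" using N disp_sq_nonneg by (intro mult_left_mono) auto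
    finally have "noise * (2 * ?r) \<le> noise * (2 * (sqrt (disp_sq k) * N))"
      using noise_nonneg by (intro mult_left_mono) auto
    also have "\<dots> \<le> s * disp_sq k + (noise * N)\<^sup>2 / s"
      using young[OF s, of "sqrt (disp_sq k)" "noise * N"] disp_sq_nonneg[of k] by (simp add: mult_ac)
    finally have r: "noise * (2 * ?r) \<le> s * disp_sq k + (noise * N)\<^sup>2 / s" .
    have "noise * \<parallel>S (y k)\<parallel>\<^sup>2 \<le> noise * N\<^sup>2"
      using noise_nonneg N by (intro mult_left_mono power_mono) auto
    moreover have "slack = s + s" by (simp add: s_def)
    ultimately show ?thesis
      using dist_sq_Suc[of k] r unfolding C_def s_def[symmetric] by (simp add: algebra_simps)
  qed
  ultimately show ?thesis by blast
qed

text \<open>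
  The mean of \<open>\<parallel>x\<^sub>k - y\<^sub>k\<parallel>\<^sup>2\<close> is \<open>O(k)\<close>, so along squares \<open>k = n\<^sup>2\<close> the means of \<open>\<parallel>x\<^sub>k - y\<^sub>k\<parallel>\<^sup>2 / k\<^sup>2\<close> are summable and
  the quotients tend to 0 almost surely.  The motion between consecutive squares is controlled by
  \<open>\<parallel>S x\<^sub>k - S y\<^sub>k\<parallel>\<close>, whose squares are almost surely summable with weights \<open>(k+1)\<^bsup>-3/2\<^esup>\<close>.
\<close>

theorem AE_dist_sublinear:
  assumes \<beta>: "\<beta> < \<alpha> / \<theta>"
  shows "AE \<omega> in P. (\<lambda>k. \<parallel>x k \<omega> - y k\<parallel> / real k) \<longlonglongrightarrow> 0"
proof -
  define s where "s = slack / 2"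
  have s: "0 < s" unfolding s_def slack_eq using \<beta> \<theta> by simp
  obtain C where C: "0 \<le> C" "\<And>k. dist_sq (Suc k) \<le> dist_sq k - s * disp_sq k + C"
    using dist_sq_descent[OF \<beta>] unfolding s_def by blast
  let ?w = "\<lambda>k. real (Suc k) powr (-3/2)"
  have "summable (\<lambda>k. ?w k * (s * disp_sq k))"
    by (rule descent_weighted_summable[where d=dist_sq and p="\<lambda>k. s * disp_sq k" and w="?w",
          OF dist_sq_nonneg _ C(2) C(1) _ decseq_weights summable_weights])
       (use s disp_sq_nonneg in auto)
  then have "summable (\<lambda>k. (1 / s) * (?w k * (s * disp_sq k)))" by (rule summable_mult)
  then have sum1: "summable (\<lambda>k. ?w k * disp_sq k)" using s by simp
  have ae1: "AE \<omega> in P. summable (\<lambda>k. ?w k * \<parallel>S (x k \<omega>) - S (y k)\<parallel>\<^sup>2)"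
    by (rule P.AE_summable) (use sum1 in \<open>auto simp: integrable_errors disp_sq_def\<close>)
  have lin: "dist_sq k \<le> dist_sq 0 + C * real k" for k
    by (rule descent_le_linear[where d=dist_sq and p="\<lambda>k. s * disp_sq k", OF C(2)]) (use s disp_sq_nonneg in auto)
  have sum2: "summable (\<lambda>n. dist_sq (n\<^sup>2) / real n ^ 4)"
  proof (rule summable_comparison_test)
    show "summable (\<lambda>n. (dist_sq 0 + C) * inverse (real n ^ 2))"
      by (intro summable_mult inverse_power_summable) simp
    have "norm (dist_sq (n\<^sup>2) / real n ^ 4) \<le> (dist_sq 0 + C) * inverse (real n ^ 2)" for n
    proof (cases "n = 0")
      case False
      have "dist_sq (n\<^sup>2) \<le> dist_sq 0 * 1 + C * (real n)\<^sup>2" using lin[of "n\<^sup>2"] by simp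
      also have "\<dots> \<le> dist_sq 0 * (real n)\<^sup>2 + C * (real n)\<^sup>2"
        using False C(1) dist_sq_nonneg by (intro add_mono mult_left_mono one_le_power) auto
      finally have "dist_sq (n\<^sup>2) \<le> (dist_sq 0 + C) * (real n)\<^sup>2" by (simp add: algebra_simps)
      then have "dist_sq (n\<^sup>2) / real n ^ 4 \<le> (dist_sq 0 + C) * (real n)\<^sup>2 / real n ^ 4"
        by (rule divide_right_mono) simp
      also have "\<dots> = (dist_sq 0 + C) * inverse (real n ^ 2)"
        using False by (simp add: divide_simps eval_nat_numeral)
      finally show ?thesis using dist_sq_nonneg by simp
    qed simp
    then show "\<exists>N. \<forall>n\<ge>N. norm (dist_sq (n\<^sup>2) / real n ^ 4) \<le> (dist_sq 0 + C) * inverse (real n ^ 2)"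
      by blast
  qed
  have ae2: "AE \<omega> in P. summable (\<lambda>n. \<parallel>x (n\<^sup>2) \<omega> - y (n\<^sup>2)\<parallel>\<^sup>2 / real n ^ 4)"
    by (rule P.AE_summable) (use sum2 in \<open>auto simp: integrable_errors dist_sq_def\<close>)
  obtain K where K: "0 \<le> K" "\<And>\<iota> z. (\<forall>i. 0 \<le> \<iota> $ i \<and> \<iota> $ i \<le> 1) \<Longrightarrow> \<parallel>sel E \<alpha> \<iota> z\<parallel> \<le> K * \<parallel>z\<parallel>"
    using sel_bounded by blast
  define N where "N = \<parallel>S (y 0)\<parallel>"
  show ?thesis
    using ae1 ae2 AE_space
  proof eventually_elim
    case (elim \<omega>)
    show ?case
    proof (rule sublinear_from_squares[where K="\<theta> * K + a" and N=N, OF _ _ _ _ _ elim(1)])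
      show "\<parallel>x (Suc k) \<omega> - y (Suc k)\<parallel>
          \<le> \<parallel>x k \<omega> - y k\<parallel> + (\<theta> * K + a) * (\<parallel>S (x k \<omega>) - S (y k)\<parallel> + N)" for k
      proof -
        have Ny: "\<parallel>S (y k)\<parallel> \<le> N"
          unfolding N_def by (rule forward_bounded[where y=y, OF step_pos step_less y_Suc])
        let ?s = "sel E \<alpha> (\<I> k \<omega>) (S (x k \<omega>))"
        have eq: "x (Suc k) \<omega> - y (Suc k) = ((x k \<omega> - y k) - \<theta> *\<^sub>R ?s) + a *\<^sub>R S (y k)"
          using elim(3) by (simp add: x_Suc y_Suc move_def)
        have "\<parallel>x (Suc k) \<omega> - y (Suc k)\<parallel> \<le> \<parallel>x k \<omega> - y k\<parallel> + \<theta> * \<parallel>?s\<parallel> + a * \<parallel>S (y k)\<parallel>"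
          unfolding eq
          using nm_triangle[of "(x k \<omega> - y k) - \<theta> *\<^sub>R ?s" "a *\<^sub>R S (y k)"]
            nm_triangle_diff[of "x k \<omega> - y k" "\<theta> *\<^sub>R ?s"] \<theta> step_pos by (simp add: nm_scaleR)
        also have "\<theta> * \<parallel>?s\<parallel> \<le> \<theta> * (K * (\<parallel>S (x k \<omega>) - S (y k)\<parallel> + N))"
        proof -
          have "\<parallel>?s\<parallel> \<le> K * \<parallel>S (x k \<omega>)\<parallel>" using range[OF elim(3)] by (intro K(2)) auto
          also have "\<dots> \<le> K * (\<parallel>S (x k \<omega>) - S (y k)\<parallel> + N)"
            using nm_triangle_sub[of "S (x k \<omega>)" "S (y k)"] Ny K(1) by (intro mult_left_mono) auto
          finally show ?thesis using \<theta> by (intro mult_left_mono) auto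
        qed
        also have "a * \<parallel>S (y k)\<parallel> \<le> a * (\<parallel>S (x k \<omega>) - S (y k)\<parallel> + N)"
          using Ny step_pos by (intro mult_left_mono add_increasing) auto
        finally show ?thesis by (simp add: algebra_simps)
      qed
      show "(\<lambda>n. \<parallel>x (n\<^sup>2) \<omega> - y (n\<^sup>2)\<parallel> / real (n\<^sup>2)) \<longlonglongrightarrow> 0"
      proof -
        have "(\<lambda>n. sqrt (\<parallel>x (n\<^sup>2) \<omega> - y (n\<^sup>2)\<parallel>\<^sup>2 / real n ^ 4)) \<longlonglongrightarrow> sqrt 0"
          by (intro tendsto_real_sqrt summable_LIMSEQ_zero elim(2))
        moreover have "sqrt (\<parallel>x (n\<^sup>2) \<omega> - y (n\<^sup>2)\<parallel>\<^sup>2 / real n ^ 4)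
            = \<parallel>x (n\<^sup>2) \<omega> - y (n\<^sup>2)\<parallel> / real (n\<^sup>2)" for n
        proof -
          have "real n ^ 4 = (real (n\<^sup>2))\<^sup>2" by simp
          then show ?thesis by (simp only: real_sqrt_divide real_sqrt_abs) simp
        qed
        ultimately show ?thesis by simp
      qed
    qed (use K(1) \<theta> step_pos in \<open>auto simp: N_def\<close>)
  qed
qed

lemma trajectory_average: "(\<lambda>k. \<parallel>y k + (real k * a) *\<^sub>R u\<parallel> / real k) \<longlonglongrightarrow> 0"
  by (rule forward_average[where y=y, OF step_pos step_less y_Suc])

lemma average_eq:
  assumes "k \<noteq> 0"
  shows "\<parallel>(1 / real k) *\<^sub>R z + a *\<^sub>R u\<parallel> = \<parallel>z + (real k * a) *\<^sub>R u\<parallel> / real k"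
proof -
  have "(1 / real k) *\<^sub>R z + a *\<^sub>R u = (1 / real k) *\<^sub>R (z + (real k * a) *\<^sub>R u)"
    using assms by (simp add: scaleR_add_right)
  then show ?thesis by (simp only: nm_scaleR) simp
qed

corollary L2_average: "L2_tendsto_M M P (\<lambda>k \<omega>. (1 / real k) *\<^sub>R x k \<omega>) (\<lambda>_. - (a *\<^sub>R u))"
  unfolding L2_tendsto_M_def
proof
  have "unif_simple P (\<lambda>\<omega>. (1 / real k) *\<^sub>R x k \<omega> - - (a *\<^sub>R u))" for k
    by (intro unif_simple_diff unif_simple_const
        unif_simple_bounded_linear[OF unif_simple_x bounded_linear_scaleR_right])
  from integrable_nm_square[OF prob_P this]
  show "\<forall>k. integrable P (\<lambda>\<omega>. \<parallel>(1 / real k) *\<^sub>R x k \<omega> - - (a *\<^sub>R u)\<parallel>\<^sup>2)" by blast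
  have le: "norm (\<integral>\<omega>. \<parallel>(1 / real k) *\<^sub>R x k \<omega> - - (a *\<^sub>R u)\<parallel>\<^sup>2 \<partial>P)
      \<le> 2 * (sqrt (dist_sq k) / real k)\<^sup>2 + 2 * (\<parallel>y k + (real k * a) *\<^sub>R u\<parallel> / real k)\<^sup>2"
    if k: "k \<noteq> 0" for k
  proof -
    let ?c = "2 * (\<parallel>y k + (real k * a) *\<^sub>R u\<parallel> / real k)\<^sup>2"
    have "\<parallel>(1 / real k) *\<^sub>R x k \<omega> - - (a *\<^sub>R u)\<parallel>\<^sup>2 \<le> 2 / (real k)\<^sup>2 * \<parallel>x k \<omega> - y k\<parallel>\<^sup>2 + ?c" for \<omega>
    proof -
      have "\<parallel>x k \<omega> + (real k * a) *\<^sub>R u\<parallel>\<^sup>2 \<le> 2 * \<parallel>x k \<omega> - y k\<parallel>\<^sup>2 + 2 * \<parallel>y k + (real k * a) *\<^sub>R u\<parallel>\<^sup>2"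
        using nm_square_le_2[of "x k \<omega> - y k" "y k + (real k * a) *\<^sub>R u"] by simp
      then show ?thesis
        using k by (simp add: average_eq power_divide divide_right_mono flip: add_divide_distrib)
    qed
    then have "(\<integral>\<omega>. \<parallel>(1 / real k) *\<^sub>R x k \<omega> - - (a *\<^sub>R u)\<parallel>\<^sup>2 \<partial>P)
        \<le> (\<integral>\<omega>. 2 / (real k)\<^sup>2 * \<parallel>x k \<omega> - y k\<parallel>\<^sup>2 + ?c \<partial>P)"
      by (intro integral_mono \<open>\<forall>k. integrable P _\<close>[rule_format] Bochner_Integration.integrable_add
          integrable_mult_right integrable_errors) auto
    also have "\<dots> = 2 / (real k)\<^sup>2 * dist_sq k + ?c"
      by (simp add: integrable_errors dist_sq_def P.prob_space)
    also have "\<dots> = 2 * (sqrt (dist_sq k) / real k)\<^sup>2 + ?c"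
      using dist_sq_nonneg by (simp add: power_divide)
    finally show ?thesis by simp
  qed
  have "(\<lambda>k. 2 * (sqrt (dist_sq k) / real k)\<^sup>2 + 2 * (\<parallel>y k + (real k * a) *\<^sub>R u\<parallel> / real k)\<^sup>2)
      \<longlonglongrightarrow> 2 * 0\<^sup>2 + 2 * 0\<^sup>2"
    by (intro tendsto_intros dist_sublinear trajectory_average)
  then show "(\<lambda>k. \<integral>\<omega>. \<parallel>(1 / real k) *\<^sub>R x k \<omega> - - (a *\<^sub>R u)\<parallel>\<^sup>2 \<partial>P) \<longlonglongrightarrow> 0"
    by (intro Lim_null_comparison[OF eventually_mono[OF eventually_gt_at_top[of 0] le]]) simp_all
qed

corollary AE_average:
  assumes \<beta>: "\<beta> < \<alpha> / \<theta>"
  shows "AE \<omega> in P. (\<lambda>k. (1 / real k) *\<^sub>R x k \<omega>) \<longlonglongrightarrow> - (a *\<^sub>R u)"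
  using AE_dist_sublinear[OF \<beta>]
proof eventually_elim
  case (elim \<omega>)
  have "(\<lambda>k. \<parallel>x k \<omega> - y k\<parallel> / real k + \<parallel>y k + (real k * a) *\<^sub>R u\<parallel> / real k) \<longlonglongrightarrow> 0 + 0"
    by (intro tendsto_add elim trajectory_average)
  then have lim: "(\<lambda>k. \<parallel>x k \<omega> - y k\<parallel> / real k + \<parallel>y k + (real k * a) *\<^sub>R u\<parallel> / real k) \<longlonglongrightarrow> 0"
    by simp
  have le: "norm (\<parallel>(1 / real k) *\<^sub>R x k \<omega> - - (a *\<^sub>R u)\<parallel>)
      \<le> \<parallel>x k \<omega> - y k\<parallel> / real k + \<parallel>y k + (real k * a) *\<^sub>R u\<parallel> / real k" if "k > 0" for k
    using nm_triangle[of "x k \<omega> - y k" "y k + (real k * a) *\<^sub>R u"] that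
    by (simp add: average_eq divide_right_mono flip: add_divide_distrib)
  show ?case
    by (rule nm_tendsto_imp_norm_tendsto,
        rule Lim_null_comparison[OF eventually_mono[OF eventually_gt_at_top[of 0] le] lim])
qed

text \<open>
  The variance is at most the mean squared distance to any deterministic point, here \<open>y\<^sub>k / k\<close>.
\<close>

corollary limsup_variance:
  assumes \<beta>: "\<beta> < \<alpha> / \<theta>"
  shows "limsup (\<lambda>k. ereal (real k * Var_M M P (\<lambda>\<omega>. (1 / real k) *\<^sub>R x k \<omega>)))
    \<le> ereal (noise * \<parallel>u\<parallel>\<^sup>2)"
proof (rule ereal_le_epsilon2)
  fix \<eta> :: real assume "0 < \<eta>"
  have "limsup (\<lambda>k. ereal (real k * Var_M M P (\<lambda>\<omega>. (1 / real k) *\<^sub>R x k \<omega>)))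
    \<le> ereal (noise * \<parallel>u\<parallel>\<^sup>2 + \<eta>)"
  proof (rule Limsup_bounded)
    show "\<forall>\<^sub>F k in sequentially.
        ereal (real k * Var_M M P (\<lambda>\<omega>. (1 / real k) *\<^sub>R x k \<omega>)) \<le> ereal (noise * \<parallel>u\<parallel>\<^sup>2 + \<eta>)"
      using dist_eventually_le[OF \<beta> \<open>0 < \<eta>\<close>] eventually_gt_at_top[of 0]
    proof eventually_elim
      case (elim k)
      let ?X = "\<lambda>\<omega>. (1 / real k) *\<^sub>R x k \<omega>" and ?y = "(1 / real k) *\<^sub>R y k"
      have X: "unif_simple P ?X"
        by (rule unif_simple_bounded_linear[OF unif_simple_x bounded_linear_scaleR_right])
      have bl: "bounded_linear (\<lambda>z. \<langle>z, w\<rangle>)" for w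
        unfolding inner_M_def by (rule bounded_linear_inner_left)
      let ?e = "vec_expectation P ?X"
      have "0 \<le> \<parallel>?e - ?y\<parallel>\<^sup>2" by simp
      then have "Var_M M P ?X \<le> (\<integral>\<omega>. \<parallel>?X \<omega>\<parallel>\<^sup>2 \<partial>P) - 2 * \<langle>?e, ?y\<rangle> + \<parallel>?y\<parallel>\<^sup>2"
        unfolding Var_M_def nm_square_diff by simp
      also have "\<langle>?e, ?y\<rangle> = (\<integral>\<omega>. \<langle>?X \<omega>, ?y\<rangle> \<partial>P)"
        by (rule P.vec_expectation_linear[OF X bl])
      also have "(\<integral>\<omega>. \<parallel>?X \<omega>\<parallel>\<^sup>2 \<partial>P) - 2 * (\<integral>\<omega>. \<langle>?X \<omega>, ?y\<rangle> \<partial>P) + \<parallel>?y\<parallel>\<^sup>2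
          = (\<integral>\<omega>. \<parallel>?X \<omega> - ?y\<parallel>\<^sup>2 \<partial>P)"
        unfolding nm_square_diff
        using integrable_nm_square[OF prob_P X] integrable_ip[OF prob_P X]
        by (simp add: P.prob_space del: nm_scaleR)
      also have "\<dots> = dist_sq k / (real k)\<^sup>2"
        unfolding dist_sq_def
        by (simp add: nm_scaleR power_divide flip: scaleR_diff_right)
      finally have "real k * Var_M M P ?X \<le> real k * (dist_sq k / (real k)\<^sup>2)"
        by (rule mult_left_mono) simp
      also have "\<dots> = dist_sq k / real k" using elim by (simp add: power2_eq_square)
      also have "\<dots> \<le> noise * \<parallel>u\<parallel>\<^sup>2 + \<eta>" using elim by (simp add: field_simps)
      finally show ?case by simp
    qed
  qed
  then show "limsup (\<lambda>k. ereal (real k * Var_M M P (\<lambda>\<omega>. (1 / real k) *\<^sub>R x k \<omega>)))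
    \<le> ereal (noise * \<parallel>u\<parallel>\<^sup>2) + ereal \<eta>" by simp
qed

text \<open>
  A trajectory that starts where \<open>S\<close> takes the value \<open>u\<close> is \<open>y\<^sub>k = y\<^sub>0 - k a u\<close>, so the bias at time \<open>k\<close> is
  the distance to \<open>y\<^sub>k\<close> up to the fixed vector \<open>y\<^sub>0\<close>.
\<close>

corollary limsup_bias:
  assumes \<beta>: "\<beta> < \<alpha> / \<theta>" and y0: "S (y 0) = u"
  shows "limsup (\<lambda>k. ereal (real k * (\<integral>\<omega>. \<parallel>(1 / real k) *\<^sub>R x k \<omega> + a *\<^sub>R u\<parallel>\<^sup>2 \<partial>P)))
    \<le> ereal (noise * \<parallel>u\<parallel>\<^sup>2)"
proof (rule ereal_le_epsilon2)
  fix \<eta> :: real assume \<eta>: "0 < \<eta>"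
  let ?c = "noise * \<parallel>u\<parallel>\<^sup>2 + \<eta> / 3"
  have c: "0 < ?c" using \<eta> noise_nonneg by (intro add_nonneg_pos) auto
  \<comment> \<open>The three thirds of \<open>\<eta>\<close> go to the growth of the distance, to the Young factor \<open>1 + \<epsilon>\<close> that multiplies
  it, and to the contribution of \<open>y 0\<close>.\<close>
  define \<epsilon> where "\<epsilon> = \<eta> / (3 * ?c)"
  have \<epsilon>: "0 < \<epsilon>" using \<eta> c by (simp add: \<epsilon>_def)
  have y: "y k + (real k * a) *\<^sub>R u = y 0" for k
    using forward_from_minimal[where y=y and k=k, OF step_pos step_less y_Suc y0] by simp
  have "(\<lambda>k. (1 + 1 / \<epsilon>) * \<parallel>y 0\<parallel>\<^sup>2 * (1 / real k)) \<longlonglongrightarrow> (1 + 1 / \<epsilon>) * \<parallel>y 0\<parallel>\<^sup>2 * 0"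
    by (intro tendsto_intros lim_1_over_n)
  then have "\<forall>\<^sub>F k in sequentially. (1 + 1 / \<epsilon>) * \<parallel>y 0\<parallel>\<^sup>2 * (1 / real k) < \<eta> / 3"
    using \<eta> by (intro order_tendstoD) auto
  moreover have "\<forall>\<^sub>F k in sequentially. dist_sq k \<le> ?c * real k"
    using \<eta> by (intro dist_eventually_le[OF \<beta>]) simp
  ultimately have "\<forall>\<^sub>F k in sequentially.
      ereal (real k * (\<integral>\<omega>. \<parallel>(1 / real k) *\<^sub>R x k \<omega> + a *\<^sub>R u\<parallel>\<^sup>2 \<partial>P)) \<le> ereal (noise * \<parallel>u\<parallel>\<^sup>2 + \<eta>)"
    using eventually_gt_at_top[of 0]
  proof eventually_elim
    case (elim k)
    let ?I = "\<integral>\<omega>. \<parallel>(1 / real k) *\<^sub>R x k \<omega> + a *\<^sub>R u\<parallel>\<^sup>2 \<partial>P"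
    let ?b = "(1 + 1 / \<epsilon>) * \<parallel>y 0\<parallel>\<^sup>2"
    have "\<parallel>x k \<omega> + (real k * a) *\<^sub>R u\<parallel>\<^sup>2 \<le> (1 + \<epsilon>) * \<parallel>x k \<omega> - y k\<parallel>\<^sup>2 + ?b" for \<omega>
    proof -
      have "x k \<omega> + (real k * a) *\<^sub>R u = (x k \<omega> - y k) + y 0"
        unfolding y[of k, symmetric] by simp
      then have "\<parallel>x k \<omega> + (real k * a) *\<^sub>R u\<parallel>\<^sup>2
          = \<parallel>x k \<omega> - y k\<parallel>\<^sup>2 + 2 * \<langle>x k \<omega> - y k, y 0\<rangle> + \<parallel>y 0\<parallel>\<^sup>2"
        by (simp only: nm_square_add)
      then show ?thesis
        using ip_le'[of "x k \<omega> - y k" "y 0"] young[OF \<epsilon>, of "\<parallel>x k \<omega> - y k\<parallel>" "\<parallel>y 0\<parallel>"]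
        by (simp add: algebra_simps)
    qed
    then have "\<parallel>(1 / real k) *\<^sub>R x k \<omega> + a *\<^sub>R u\<parallel>\<^sup>2
        \<le> (1 / (real k)\<^sup>2) * ((1 + \<epsilon>) * \<parallel>x k \<omega> - y k\<parallel>\<^sup>2 + ?b)" for \<omega>
      using elim by (simp add: average_eq power_divide divide_right_mono)
    moreover have "integrable P (\<lambda>\<omega>. \<parallel>(1 / real k) *\<^sub>R x k \<omega> + a *\<^sub>R u\<parallel>\<^sup>2)"
      by (intro integrable_nm_square prob_P unif_simple_add unif_simple_const
        unif_simple_bounded_linear[OF unif_simple_x bounded_linear_scaleR_right])
    ultimately have "?I \<le> (\<integral>\<omega>. (1 / (real k)\<^sup>2) * ((1 + \<epsilon>) * \<parallel>x k \<omega> - y k\<parallel>\<^sup>2 + ?b) \<partial>P)"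
      by (intro integral_mono Bochner_Integration.integrable_add
          integrable_mult_right integrable_errors) auto
    also have "\<dots> = (1 / (real k)\<^sup>2) * ((1 + \<epsilon>) * dist_sq k + ?b)"
      by (simp add: integrable_errors dist_sq_def P.prob_space)
    finally have "real k * ?I \<le> real k * ((1 / (real k)\<^sup>2) * ((1 + \<epsilon>) * dist_sq k + ?b))"
      by (rule mult_left_mono) simp
    also have "\<dots> = (1 + \<epsilon>) * (dist_sq k / real k) + ?b * (1 / real k)"
      using elim by (simp add: field_simps power2_eq_square)
    also have "\<dots> \<le> (1 + \<epsilon>) * ?c + \<eta> / 3"
      using elim \<epsilon> by (intro add_mono mult_left_mono) (auto simp: field_simps)
    also have "\<dots> = noise * \<parallel>u\<parallel>\<^sup>2 + \<eta>"
    proof -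
      have "\<eta> / (3 * r) * r = \<eta> / 3" if "0 < r" for r using that by simp
      from this[OF c] have "\<epsilon> * ?c = \<eta> / 3" unfolding \<epsilon>_def .
      then show ?thesis by (simp add: distrib_right)
    qed
    finally show ?case by simp
  qed
  then have "limsup (\<lambda>k. ereal (real k * (\<integral>\<omega>. \<parallel>(1 / real k) *\<^sub>R x k \<omega> + a *\<^sub>R u\<parallel>\<^sup>2 \<partial>P)))
    \<le> ereal (noise * \<parallel>u\<parallel>\<^sup>2 + \<eta>)" by (rule Limsup_bounded)
  then show "limsup (\<lambda>k. ereal (real k * (\<integral>\<omega>. \<parallel>(1 / real k) *\<^sub>R x k \<omega> + a *\<^sub>R u\<parallel>\<^sup>2 \<partial>P)))
    \<le> ereal (noise * \<parallel>u\<parallel>\<^sup>2) + ereal \<eta>" by simp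
qed

end

section \<open>Convergence of the normalized iterates\<close>

theorem theorem7p1:
  fixes E :: "'m::finite option \<Rightarrow> 'a::{real_inner, banach} set"
    and M T :: "'a \<Rightarrow> 'a"
    and \<theta> \<alpha> c\<^sub>F :: real
    and v x0 :: 'a
    and P :: "'w measure"
    and D :: "(real ^ 'm) measure"
    and \<I> :: "nat \<Rightarrow> 'w \<Rightarrow> real ^ 'm"
    and x :: "nat \<Rightarrow> 'w \<Rightarrow> 'a"
  assumes "hilbert_direct_sum E"
    and "metric_operator M"
    and "0 < \<theta>" and "\<theta> \<le> 1"
    and "averaged_M M \<theta> T"
    and v: "v = inf_displacement M T"
    and "blocks_orthogonal_M M E"
    and "prob_space P"
    and indep: "prob_space.indep_vars P (\<lambda>_. borel) \<I> UNIV"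
    and ident: "\<And>k. distr P borel (\<I> k) = D"
    and range: "\<And>k \<omega> i. \<omega> \<in> space P \<Longrightarrow> 0 \<le> \<I> k \<omega> $ i \<and> \<I> k \<omega> $ i \<le> 1"
    and mean: "(\<integral>\<iota>. \<iota> \<partial>D) = \<alpha> *\<^sub>R (\<chi> i. 1)"
    and "0 < \<alpha>" and "\<alpha> \<le> 1" and "\<alpha> * \<theta> < 1"
    and x_0: "\<And>\<omega>. \<omega> \<in> space P \<Longrightarrow> x 0 \<omega> = x0"
    and x_Suc: "\<And>k \<omega>. \<omega> \<in> space P \<Longrightarrow> x (Suc k) \<omega> = T_sel E \<theta> \<alpha> T (\<I> k \<omega>) (x k \<omega>)"
    and c\<^sub>F: "c\<^sub>F = friedrichs_cos M (U1 E) (U2 E)"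
  shows
    "(c\<^sub>F \<le> sqrt ((1 - \<theta>) / (1 - \<alpha> * \<theta>)) \<longrightarrow>
        L2_tendsto_M M P (\<lambda>k \<omega>. (1 / real k) *\<^sub>R x k \<omega>) (\<lambda>_. - (\<alpha> *\<^sub>R v)))
     \<and>
     (c\<^sub>F < sqrt ((1 - \<theta>) / (1 - \<alpha> * \<theta>)) \<longrightarrow>
        (AE \<omega> in P. (\<lambda>k. (1 / real k) *\<^sub>R x k \<omega>) \<longlonglongrightarrow> - (\<alpha> *\<^sub>R v)) \<and>
        (\<exists>\<beta>>0. \<beta> < \<alpha> / \<theta> \<and>
           (\<forall>u. (\<integral>\<iota>. (norm_M M (sel E \<alpha> \<iota> u))\<^sup>2 \<partial>D) \<le> \<beta> * (norm_M M u)\<^sup>2)) \<and>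
        (\<forall>\<beta>>0. \<beta> < \<alpha> / \<theta> \<and>
           (\<forall>u. (\<integral>\<iota>. (norm_M M (sel E \<alpha> \<iota> u))\<^sup>2 \<partial>D) \<le> \<beta> * (norm_M M u)\<^sup>2) \<longrightarrow>
           (v \<in> range (\<lambda>x. x - T x) \<longrightarrow>
              limsup (\<lambda>k. ereal (real k *
                 (\<integral>\<omega>. (norm_M M ((1 / real k) *\<^sub>R x k \<omega> + \<alpha> *\<^sub>R v))\<^sup>2 \<partial>P)))
              \<le> ereal ((\<beta> - \<alpha>\<^sup>2) * (norm_M M v)\<^sup>2)) \<and>
           limsup (\<lambda>k. ereal (real k * Var_M M P (\<lambda>\<omega>. (1 / real k) *\<^sub>R x k \<omega>)))
             \<le> ereal ((\<beta> - \<alpha>\<^sup>2) * (norm_M M v)\<^sup>2)))"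
proof -
  interpret metric_op M by standard fact
  interpret P: prob_space P by fact
  obtain C where C: "nonexpansive_M M C" and T_C: "\<And>z. T z = (1 - \<theta>) *\<^sub>R z + \<theta> *\<^sub>R C z"
    using \<open>averaged_M M \<theta> T\<close> unfolding averaged_M_def by blast
  define S where "S = S_op \<theta> T"
  have S: "S z = z - C z" for z
    using \<open>0 < \<theta>\<close> by (simp add: S_def S_op_def T_C algebra_simps)
  have T: "T z = z - \<theta> *\<^sub>R S z" for z
    using \<open>0 < \<theta>\<close> by (simp add: S_def S_op_def)
  obtain u z where inf: "inf_displacement M T = \<theta> *\<^sub>R u"
    and z: "(\<lambda>n. \<parallel>S (z n) - u\<parallel>) \<longlonglongrightarrow> 0" and u: "\<And>x. \<parallel>u\<parallel>\<^sup>2 \<le> \<langle>u, S x\<rangle>"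
  proof (rule inf_displacement_props[where S=S and T=T, OF C S \<open>0 < \<theta>\<close> T])
    fix u z
    assume "inf_displacement M T = \<theta> *\<^sub>R u" "(\<lambda>n. \<parallel>S (z n) - u\<parallel>) \<longlonglongrightarrow> 0"
      "\<And>x. \<parallel>u\<parallel>\<^sup>2 \<le> \<langle>u, S x\<rangle>"
    then show thesis by (rule that[of u z])
  qed
  have v_u: "v = \<theta> *\<^sub>R u" using v inf by simp
  have \<I>_meas: "\<I> k \<in> borel_measurable P" for k
    using indep unfolding P.indep_vars_def by simp
  have unit: "AE \<iota> in D. \<forall>i. 0 \<le> \<iota> $ i \<and> \<iota> $ i \<le> 1"
    unfolding ident[of 0, symmetric]
    by (subst AE_distr_iff[OF \<I>_meas]) (use range in auto)
  have sets: "sets D = sets borel"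
    unfolding ident[of 0, symmetric] by simp
  have "prob_space D"
    unfolding ident[of 0, symmetric] by (rule P.prob_space_distr[OF \<I>_meas])
  then interpret law: prob_space D .
  interpret random_selection M E D \<alpha>
    by unfold_locales fact+
  interpret cocoercive_op M S u
    by standard (use nonexpansive_imp_cocoercive[OF C S] z u in blast)+
  interpret random_iteration M S u E D \<alpha> \<theta> P \<I> x x0
  proof unfold_locales
    have "selected_operator M S u E D \<alpha> \<theta>"
      by unfold_locales fact+
    then show "x (Suc k) \<omega> = selected_operator.move S E \<alpha> \<theta> (\<I> k \<omega>) (x k \<omega>)"
      if "\<omega> \<in> space P" for k \<omega>
      using x_Suc[OF that] T_sel_eq[OF \<open>hilbert_direct_sum E\<close>]
      by (simp add: selected_operator.move_def S_def)
  qed fact+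
  have \<alpha>v: "\<alpha> *\<^sub>R v = (\<alpha> * \<theta>) *\<^sub>R u" by (simp add: v_u)
  define trajectory where "trajectory y0 k = ((\<lambda>z. z - (\<alpha> * \<theta>) *\<^sub>R S z) ^^ k) y0" for y0 k
  have shadowed: "shadowed_iteration M S u E D \<alpha> \<theta> P \<I> x x0 \<beta> (trajectory y0)"
    if "second_moment_bound \<beta>" "\<alpha>\<^sup>2 \<le> \<beta>" "\<beta> \<le> \<alpha> / \<theta>" for \<beta> y0
    by unfold_locales (use that in \<open>auto simp: trajectory_def\<close>)
  have noise: "shadowed_iteration.noise \<alpha> \<theta> \<beta> * \<parallel>u\<parallel>\<^sup>2 = (\<beta> - \<alpha>\<^sup>2) * \<parallel>v\<parallel>\<^sup>2"
    if "second_moment_bound \<beta>" "\<alpha>\<^sup>2 \<le> \<beta>" "\<beta> \<le> \<alpha> / \<theta>" for \<beta>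
    using shadowed_iteration.noise_eq[OF shadowed[OF that]]
    by (simp add: v_u nm_scaleR power_mult_distrib)
  have L2: "L2_tendsto_M M P (\<lambda>k \<omega>. (1 / real k) *\<^sub>R x k \<omega>) (\<lambda>_. - (\<alpha> *\<^sub>R v))"
    if c: "c\<^sub>F \<le> sqrt ((1 - \<theta>) / (1 - \<alpha> * \<theta>))"
  proof -
    note crit = second_moment_bound_critical[OF \<open>0 < \<theta>\<close> \<open>\<theta> \<le> 1\<close> \<open>\<alpha> * \<theta> < 1\<close> c[unfolded c\<^sub>F]]
    show ?thesis
      unfolding \<alpha>v
      by (rule shadowed_iteration.L2_average[OF shadowed[of "\<alpha> / \<theta>" x0]]) (use crit in auto)
  qed
  show ?thesis
  proof (intro conjI impI L2)
    assume c: "c\<^sub>F < sqrt ((1 - \<theta>) / (1 - \<alpha> * \<theta>))"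
    have \<alpha>\<theta>: "\<alpha>\<^sup>2 < \<alpha> / \<theta>"
      by (rule second_moment_bound_critical(2)[OF \<open>0 < \<theta>\<close> \<open>\<theta> \<le> 1\<close> \<open>\<alpha> * \<theta> < 1\<close>])
         (use c in \<open>simp add: c\<^sub>F\<close>)
    obtain \<beta>0 where \<beta>0: "0 < \<beta>0" "\<beta>0 < \<alpha> / \<theta>" "second_moment_bound \<beta>0"
      using second_moment_bound_subcritical[OF \<open>0 < \<theta>\<close> \<open>\<theta> \<le> 1\<close> \<open>\<alpha> * \<theta> < 1\<close> c[unfolded c\<^sub>F]]
      by blast
    have max0: "second_moment_bound (max \<beta>0 (\<alpha>\<^sup>2))" "max \<beta>0 (\<alpha>\<^sup>2) < \<alpha> / \<theta>"
      using second_moment_bound_max(1)[OF \<beta>0(3)] \<beta>0(2) \<alpha>\<theta> by auto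
    show "AE \<omega> in P. (\<lambda>k. (1 / real k) *\<^sub>R x k \<omega>) \<longlonglongrightarrow> - (\<alpha> *\<^sub>R v)"
      unfolding \<alpha>v
      by (rule shadowed_iteration.AE_average[OF shadowed[of "max \<beta>0 (\<alpha>\<^sup>2)" x0]]) (use max0 in auto)
    show "\<exists>\<beta>>0. \<beta> < \<alpha> / \<theta> \<and>
        (\<forall>u. (\<integral>\<iota>. (norm_M M (sel E \<alpha> \<iota> u))\<^sup>2 \<partial>D) \<le> \<beta> * (norm_M M u)\<^sup>2)"
      using \<beta>0 unfolding second_moment_bound_def by blast
    show "\<forall>\<beta>>0. \<beta> < \<alpha> / \<theta> \<and>
           (\<forall>u. (\<integral>\<iota>. (norm_M M (sel E \<alpha> \<iota> u))\<^sup>2 \<partial>D) \<le> \<beta> * (norm_M M u)\<^sup>2) \<longrightarrow>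
           (v \<in> range (\<lambda>x. x - T x) \<longrightarrow>
              limsup (\<lambda>k. ereal (real k *
                 (\<integral>\<omega>. (norm_M M ((1 / real k) *\<^sub>R x k \<omega> + \<alpha> *\<^sub>R v))\<^sup>2 \<partial>P)))
              \<le> ereal ((\<beta> - \<alpha>\<^sup>2) * (norm_M M v)\<^sup>2)) \<and>
           limsup (\<lambda>k. ereal (real k * Var_M M P (\<lambda>\<omega>. (1 / real k) *\<^sub>R x k \<omega>)))
             \<le> ereal ((\<beta> - \<alpha>\<^sup>2) * (norm_M M v)\<^sup>2)"
    proof (intro allI impI, elim conjE, intro conjI impI)
      fix \<beta> :: real
      assume "0 < \<beta>" and less: "\<beta> < \<alpha> / \<theta>"
        and bound: "\<forall>u. (\<integral>\<iota>. (norm_M M (sel E \<alpha> \<iota> u))\<^sup>2 \<partial>D) \<le> \<beta> * (norm_M M u)\<^sup>2"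
      define \<gamma> where "\<gamma> = max \<beta> (\<alpha>\<^sup>2)"
      have \<beta>: "second_moment_bound \<beta>" using bound unfolding second_moment_bound_def .
      have \<gamma>: "second_moment_bound \<gamma>" "\<alpha>\<^sup>2 \<le> \<gamma>" "\<gamma> < \<alpha> / \<theta>"
        using second_moment_bound_max(1)[OF \<beta>] less \<alpha>\<theta> by (auto simp: \<gamma>_def)
      have const: "shadowed_iteration.noise \<alpha> \<theta> \<gamma> * \<parallel>u\<parallel>\<^sup>2 = (\<beta> - \<alpha>\<^sup>2) * \<parallel>v\<parallel>\<^sup>2"
        using noise[OF \<gamma>(1,2)] \<gamma>(3) second_moment_bound_max(2)[OF \<beta>, of v] by (simp add: \<gamma>_def)
      note shadow = shadowed[OF \<gamma>(1,2) less_imp_le[OF \<gamma>(3)]]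
      show "limsup (\<lambda>k. ereal (real k * Var_M M P (\<lambda>\<omega>. (1 / real k) *\<^sub>R x k \<omega>)))
             \<le> ereal ((\<beta> - \<alpha>\<^sup>2) * (norm_M M v)\<^sup>2)"
        using shadowed_iteration.limsup_variance[OF shadow \<gamma>(3)] unfolding const .
      assume "v \<in> range (\<lambda>x. x - T x)"
      then obtain y0 where "v = y0 - T y0" by blast
      then have "\<theta> *\<^sub>R u = \<theta> *\<^sub>R S y0" using v_u by (simp add: T)
      then have "S y0 = u" using \<open>0 < \<theta>\<close> by simp
      then have "S (trajectory y0 0) = u" by (simp add: trajectory_def)
      then show "limsup (\<lambda>k. ereal (real k *
                 (\<integral>\<omega>. (norm_M M ((1 / real k) *\<^sub>R x k \<omega> + \<alpha> *\<^sub>R v))\<^sup>2 \<partial>P)))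
              \<le> ereal ((\<beta> - \<alpha>\<^sup>2) * (norm_M M v)\<^sup>2)"
        using shadowed_iteration.limsup_bias[OF shadow \<gamma>(3)] unfolding const \<alpha>v by blast
    qed
  qed
qed

end
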